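(* Let $(R,\mathfrak m)$ be a Cohen-Macaulay local ring of dimension $d$ and let $I=(b,a_1,\dots,a_s)$ be an ideal with $\operatorname{grade}(I)\geq 1$ satisfying $\mathrm{SD}$. If $\dim(bH_i(a_1,\dots,a_s))\le d-s$ for all $i\ge1$, then (a) $bH_i(a_1,\dots,a_s)=0$ for all $i\ge1$; and (b) $\operatorname{depth}\big(R/((a_1,\dots,a_s):I)\big)\ge d-s$.
   Context: Rings are commutative Noetherian. $H_i(a_1,\dots,a_s)$ is the $i$-th Koszul homology of $a_1,\dots,a_s$ on $R$. An ideal $I=(f_1,\dots,f_r)$ of grade $g\ge1$ in a local ring of dimension $d$ satisfies $\mathrm{SD}$ (sliding depth) if $\operatorname{depth}H_i(f_1,\dots,f_r;R)\ge\min\{d-g,\,d-r+i\}$ for all $i\ge0$. The zero module has depth $\infty$ and dimension $-\infty$. *)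

theory Defs
  imports "HOL-Library.Extended_Real" "HOL-Algebra.QuotRing" "HOL-Algebra.Module" "HOL-Algebra.Ring_Divisibility"
begin

definition local_ring :: "('a, 'r) ring_scheme \<Rightarrow> 'a set \<Rightarrow> bool" where
  "local_ring R \<mm> \<longleftrightarrow>
     cring R \<and> maximalideal \<mm> R \<and> (\<forall>\<nn>. maximalideal \<nn> R \<longrightarrow> \<nn> = \<mm>)"

definition colon_ideal :: "('a, 'r) ring_scheme \<Rightarrow> 'a set \<Rightarrow> 'a set \<Rightarrow> 'a set" where
  "colon_ideal R J I = {r \<in> carrier R. \<forall>x\<in>I. r \<otimes>\<^bsub>R\<^esub> x \<in> J}"


section \<open>Modules\<close>

text \<open>In the library's module record the fields \<^const>\<open>monoid.mult\<close> and \<^const>\<open>one\<close> of a module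
  carry no meaning; they are left undefined.\<close>

definition ring_module :: "('a, 'r) ring_scheme \<Rightarrow> ('a, 'a) module" where
  "ring_module R =
     \<lparr>carrier = carrier R, monoid.mult = undefined, one = undefined,
      ring.zero = \<zero>\<^bsub>R\<^esub>, add = add R, smult = (\<otimes>\<^bsub>R\<^esub>)\<rparr>"

definition quot_module ::
    "('a, 'r) ring_scheme \<Rightarrow> ('a, 'b, 'm) module_scheme \<Rightarrow> 'b set \<Rightarrow> ('a, 'b set) module" where
  "quot_module R M N =
     \<lparr>carrier = a_rcosets\<^bsub>M\<^esub> N, monoid.mult = undefined, one = undefined,
      ring.zero = N, add = set_add M,
      smult = (\<lambda>r C. \<Union>x\<in>C. N +>\<^bsub>M\<^esub> (r \<odot>\<^bsub>M\<^esub> x))\<rparr>"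

definition scaled_module ::
    "'a \<Rightarrow> ('a, 'b, 'm) module_scheme \<Rightarrow> ('a, 'b, 'm) module_scheme" where
  "scaled_module b M = M\<lparr>carrier := (\<lambda>x. b \<odot>\<^bsub>M\<^esub> x) ` carrier M\<rparr>"

text \<open>\<open>AM\<close>, which for an ideal \<open>A\<close> is the usual product, and for \<open>A = {x\<^sub>1, \<dots>, x\<^sub>n}\<close> is
  \<open>(x\<^sub>1, \<dots>, x\<^sub>n)M\<close>.\<close>

definition set_smult ::
    "('a, 'r) ring_scheme \<Rightarrow> 'a set \<Rightarrow> ('a, 'b, 'm) module_scheme \<Rightarrow> 'b set" where
  "set_smult R A M =
     \<Inter>{N. submodule N R M \<and> (\<forall>x\<in>A. \<forall>y\<in>carrier M. x \<odot>\<^bsub>M\<^esub> y \<in> N)}"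

definition annihilator ::
    "('a, 'r) ring_scheme \<Rightarrow> ('a, 'b, 'm) module_scheme \<Rightarrow> 'a set" where
  "annihilator R M = {r \<in> carrier R. \<forall>x\<in>carrier M. r \<odot>\<^bsub>M\<^esub> x = \<zero>\<^bsub>M\<^esub>}"


section \<open>Dimension\<close>

text \<open>The zero ring has no primes, so that its dimension is \<^term>\<open>Sup {} = (-\<infinity> :: ereal)\<close>;
  hence the zero module has dimension \<open>-\<infinity>\<close>.\<close>

definition krull_dim :: "('a, 'r) ring_scheme \<Rightarrow> ereal" where
  "krull_dim R =
     Sup {ereal (real n) | n :: nat. \<exists>p :: nat \<Rightarrow> 'a set.
            (\<forall>i\<le>n. primeideal (p i) R) \<and> (\<forall>i<n. p i \<subset> p (Suc i))}"

definition module_dim ::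
    "('a, 'r) ring_scheme \<Rightarrow> ('a, 'b, 'm) module_scheme \<Rightarrow> ereal" where
  "module_dim R M = krull_dim (R Quot (annihilator R M))"


section \<open>Regular sequences, grade and depth\<close>

text \<open>The second conjunct says that the \<open>k\<close>-th element is a nonzerodivisor on
  \<open>M/(x\<^sub>0, \<dots>, x\<^bsub>k-1\<^esub>)M\<close>, with the quotient written out.\<close>

definition regular_sequence ::
    "('a, 'r) ring_scheme \<Rightarrow> ('a, 'b, 'm) module_scheme \<Rightarrow> 'a list \<Rightarrow> bool" where
  "regular_sequence R M xs \<longleftrightarrow>
     set xs \<subseteq> carrier R \<and>
     (\<forall>k<length xs. \<forall>y\<in>carrier M.
        (xs ! k) \<odot>\<^bsub>M\<^esub> y \<in> set_smult R (set (take k xs)) M \<longrightarrow>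
        y \<in> set_smult R (set (take k xs)) M) \<and>
     set_smult R (set xs) M \<noteq> carrier M"

text \<open>The convention \<open>grade(I, M) = \<infinity>\<close> for \<open>IM = M\<close> gives the zero module depth \<open>\<infinity>\<close>.\<close>

definition grade ::
    "('a, 'r) ring_scheme \<Rightarrow> 'a set \<Rightarrow> ('a, 'b, 'm) module_scheme \<Rightarrow> ereal" where
  "grade R I M =
     (if set_smult R I M = carrier M then \<infinity>
      else Sup {ereal (real (length xs)) | xs. set xs \<subseteq> I \<and> regular_sequence R M xs})"

definition depth ::
    "('a, 'r) ring_scheme \<Rightarrow> 'a set \<Rightarrow> ('a, 'b, 'm) module_scheme \<Rightarrow> ereal" where
  "depth R \<mm> M = grade R \<mm> M"

definition cohen_macaulay_local_ring :: "('a, 'r) ring_scheme \<Rightarrow> 'a set \<Rightarrow> bool" where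
  "cohen_macaulay_local_ring R \<mm> \<longleftrightarrow>
     noetherian_ring R \<and> local_ring R \<mm> \<and> depth R \<mm> (ring_module R) = krull_dim R"


section \<open>Koszul homology\<close>

text \<open>Let \<open>s\<close> be the length of \<open>as\<close>. An element of \<open>K\<^sub>i = \<Lambda>\<^sup>i R\<^sup>s\<close> is given by its coefficients
  with respect to the basis \<open>e\<^sub>S\<close>, where \<open>S\<close> ranges over the \<open>i\<close>-element subsets of
  \<open>{0, \<dots>, s - 1}\<close>; coefficients at all other sets are zero. Collecting the coefficient of
  \<open>e\<^sub>T\<close> in \<open>d e\<^sub>S = (\<Sum>j\<in>S. (-1) ^ card {t \<in> S. t < j} a\<^sub>j e\<^bsub>S - {j}\<^esub>)\<close> gives the
  formula for the differential below. It vanishes on \<open>K\<^sub>0\<close>.\<close>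

definition koszul_module ::
    "('a, 'r) ring_scheme \<Rightarrow> 'a list \<Rightarrow> nat \<Rightarrow> ('a, nat set \<Rightarrow> 'a) module" where
  "koszul_module R as i =
     \<lparr>carrier = {z. (\<forall>S. z S \<in> carrier R) \<and>
                    (\<forall>S. \<not> (S \<subseteq> {..<length as} \<and> card S = i) \<longrightarrow> z S = \<zero>\<^bsub>R\<^esub>)},
      monoid.mult = undefined, one = undefined,
      ring.zero = (\<lambda>S. \<zero>\<^bsub>R\<^esub>), add = (\<lambda>z w S. z S \<oplus>\<^bsub>R\<^esub> w S), smult = (\<lambda>r z S. r \<otimes>\<^bsub>R\<^esub> z S)\<rparr>"

definition koszul_diff ::
    "('a, 'r) ring_scheme \<Rightarrow> 'a list \<Rightarrow> (nat set \<Rightarrow> 'a) \<Rightarrow> nat set \<Rightarrow> 'a" where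
  "koszul_diff R as z =
     (\<lambda>T. \<Oplus>\<^bsub>R\<^esub>j\<in>{..<length as} - T.
        ((\<ominus>\<^bsub>R\<^esub> \<one>\<^bsub>R\<^esub>) [^]\<^bsub>R\<^esub> card {t \<in> T. t < j}) \<otimes>\<^bsub>R\<^esub> (as ! j) \<otimes>\<^bsub>R\<^esub> z (insert j T))"

definition koszul_cycles ::
    "('a, 'r) ring_scheme \<Rightarrow> 'a list \<Rightarrow> nat \<Rightarrow> (nat set \<Rightarrow> 'a) set" where
  "koszul_cycles R as i =
     {z \<in> carrier (koszul_module R as i). koszul_diff R as z = (\<lambda>T. \<zero>\<^bsub>R\<^esub>)}"

definition koszul_boundaries ::
    "('a, 'r) ring_scheme \<Rightarrow> 'a list \<Rightarrow> nat \<Rightarrow> (nat set \<Rightarrow> 'a) set" where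
  "koszul_boundaries R as i = koszul_diff R as ` carrier (koszul_module R as (Suc i))"

definition koszul_homology ::
    "('a, 'r) ring_scheme \<Rightarrow> 'a list \<Rightarrow> nat \<Rightarrow> ('a, (nat set \<Rightarrow> 'a) set) module" where
  "koszul_homology R as i =
     quot_module R ((koszul_module R as i)\<lparr>carrier := koszul_cycles R as i\<rparr>)
       (koszul_boundaries R as i)"


section \<open>Sliding depth\<close>

text \<open>The requirement \<open>grade \<ge> 1\<close> on the ideal generated by \<open>fs\<close> is not part of this
  definition.\<close>

definition sliding_depth :: "('a, 'r) ring_scheme \<Rightarrow> 'a set \<Rightarrow> 'a list \<Rightarrow> bool" where
  "sliding_depth R \<mm> fs \<longleftrightarrow>
     (\<forall>i :: nat.
        depth R \<mm> (koszul_homology R fs i) \<ge>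
          min (krull_dim R - grade R (Idl\<^bsub>R\<^esub> (set fs)) (ring_module R))
              (krull_dim R - ereal (real (length fs)) + ereal (real i)))"

end

theory Submission
  imports Defs
begin

text \<open>Let \<open>a = (a\<^sub>1, \<dots>, a\<^sub>s)\<close>, write \<open>Z\<^sub>i, B\<^sub>i, H\<^sub>i\<close> for the cycles, boundaries and homology of the
Koszul complex \<open>K(a)\<close>, and add \<open>(b,a)\<close> for those of \<open>K(b,a)\<close>. The complex \<open>K(b,a)\<close> is the mapping
cone of multiplication by \<open>b\<close> on \<open>K(a)\<close>: its elements are pairs \<open>(x,y)\<close> with
\<open>d(x,y) = (dx + by, -dy)\<close>. Put \<open>W\<^sub>i = {y \<in> Z\<^sub>i. by \<in> B\<^sub>i}\<close>. Multiplication by \<open>b\<close> identifies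
\<open>Z\<^sub>i/W\<^sub>i\<close> with \<open>bH\<^sub>i\<close>, and \<open>(x,y) \<mapsto> y\<close> gives exact sequences
\<open>0 \<rightarrow> Z\<^sub>i\<^sub>+\<^sub>1 \<rightarrow> Z\<^sub>i\<^sub>+\<^sub>1(b,a) \<rightarrow> W\<^sub>i \<rightarrow> 0\<close>. So the claims are that \<open>W\<^sub>i = Z\<^sub>i\<close> for \<open>i \<ge> 1\<close> and that
\<open>R/W\<^sub>0\<close> has depth at least \<open>d - s\<close>, where \<open>W\<^sub>0\<close> is \<open>(a) : b = (a) : I\<close>.

Let \<open>s \<le> d\<close>; otherwise \<open>bH\<^sub>i\<close> has negative dimension and the bound in (b) is negative. Sliding depth
gives \<open>depth Z\<^sub>i(b,a) \<ge> min d (d - s + i)\<close> (\<open>grade_ge_cycles\<close>), and \<open>grade I \<ge> 1\<close> gives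
\<open>Z\<^sub>s\<^sub>+\<^sub>1(b,a) = 0\<close>, hence \<open>W\<^sub>s = 0\<close>. Go down from \<open>i = s\<close> (\<open>W_eq_and_grade_ge\<close>). As
\<open>W\<^sub>i\<^sub>+\<^sub>1 = Z\<^sub>i\<^sub>+\<^sub>1\<close>, the exact sequence carries \<open>depth W\<^sub>i\<^sub>+\<^sub>1 \<ge> d - s + i + 2\<close> to
\<open>depth W\<^sub>i \<ge> d - s + i + 1\<close>. If \<open>i \<ge> 1\<close>, let \<open>J\<close> be the annihilator of \<open>bH\<^sub>i\<close>; then \<open>dim R/J \<le> d - s\<close>.
Since \<open>grade(J,M) \<ge> depth M - dim R/J\<close> (\<open>grade_ge_of_dim_le\<close>), the ideal \<open>J\<close> has grade at least \<open>2\<close>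
on \<open>W\<^sub>i\<close> and at least \<open>1\<close> on \<open>Z\<^sub>i\<close>, hence at least \<open>1\<close> on \<open>Z\<^sub>i/W\<^sub>i\<close>. But \<open>J\<close> annihilates this module, so it
is zero. For \<open>i = 0\<close>, the bounds \<open>depth W\<^sub>0 \<ge> d - s + 1\<close> and \<open>depth R = d\<close> give (b).

The bound on \<open>Z\<^sub>i(b,a)\<close> needs \<open>depth H\<^sub>j(b,a) \<ge> d - (s + 1) + j\<close> for all \<open>j\<close>. With \<open>g = grade I\<close> this is what
sliding depth says if \<open>j \<le> s + 1 - g\<close>, and for larger \<open>j\<close> the homology vanishes
(\<open>koszul_homology_vanishing\<close>).

Depth is handled without Ext or Koszul cohomology. All modules are subquotients \<open>A/B\<close> of one Noetherian
module, and \<open>grade_ge\<close> asks for a regular sequence of a given length. Everything rests on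
\<open>grade_ge_exchange\<close>: the grade of \<open>M/xM\<close> is the same for all nonzerodivisors \<open>x\<close> in the ideal. Because the
sequences can then begin with an element that is a nonzerodivisor on several modules at once, the depth
inequalities for short exact sequences follow by induction (\<open>grade_ge_submodule\<close>, \<open>grade_ge_quotient\<close>).\<close>

section \<open>Regular sequences on subquotients\<close>

definition mcong :: "('a, 'b, 'm) module_scheme \<Rightarrow> 'b set \<Rightarrow> 'b \<Rightarrow> 'b \<Rightarrow> bool" where
  "mcong M B u v \<longleftrightarrow> u \<ominus>\<^bsub>M\<^esub> v \<in> B"

definition nzd_mod :: "('a, 'b, 'm) module_scheme \<Rightarrow> 'a \<Rightarrow> 'b set \<Rightarrow> 'b set \<Rightarrow> bool" where
  "nzd_mod M x A B \<longleftrightarrow> (\<forall>a\<in>A. x \<odot>\<^bsub>M\<^esub> a \<in> B \<longrightarrow> a \<in> B)"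

text \<open>The submodule \<open>B + xA\<close>. Dividing \<open>A/B\<close> by \<open>x\<close> replaces \<open>B\<close> by \<open>B + xA\<close> and so stays among
the subquotients of \<open>M\<close>; an iterated quotient never leaves the type of \<open>M\<close>.\<close>

definition add_mult :: "('a, 'b, 'm) module_scheme \<Rightarrow> 'b set \<Rightarrow> 'a \<Rightarrow> 'b set \<Rightarrow> 'b set" where
  "add_mult M B x A = {u \<in> carrier M. \<exists>a\<in>A. mcong M B u (x \<odot>\<^bsub>M\<^esub> a)}"

text \<open>The subquotient \<open>A/B\<close> has a weakly regular sequence of length \<open>k\<close> in \<open>J\<close>. Nontriviality of the last
quotient is not asked for, so a zero module has every grade. The denominator is the last argument because it is
the one that changes in the recursion.\<close>

primrec grade_ge ::
    "('a, 'b, 'm) module_scheme \<Rightarrow> 'a set \<Rightarrow> 'b set \<Rightarrow> nat \<Rightarrow> 'b set \<Rightarrow> bool" where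
  "grade_ge M J A 0 B \<longleftrightarrow> True"
| "grade_ge M J A (Suc k) B \<longleftrightarrow>
     (\<exists>x\<in>J. nzd_mod M x A B \<and> grade_ge M J A k (add_mult M B x A))"

text \<open>No nonzero element of \<open>A/B\<close> is annihilated by \<open>J\<close>, that is, \<open>Hom(R/J, A/B) = 0\<close>.\<close>

definition no_socle :: "('a, 'b, 'm) module_scheme \<Rightarrow> 'a set \<Rightarrow> 'b set \<Rightarrow> 'b set \<Rightarrow> bool" where
  "no_socle M J A B \<longleftrightarrow> (\<forall>a\<in>A. (\<forall>j\<in>J. j \<odot>\<^bsub>M\<^esub> a \<in> B) \<longrightarrow> a \<in> B)"

definition subquot ::
    "('a, 'r) ring_scheme \<Rightarrow> ('a, 'b, 'm) module_scheme \<Rightarrow> 'b set \<Rightarrow> 'b set \<Rightarrow> bool" where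
  "subquot R M A B \<longleftrightarrow> submodule A R M \<and> submodule B R M \<and> B \<subseteq> A"

context module
begin

abbreviation module_smult (infixl "\<cdot>" 70) where
  "r \<cdot> x \<equiv> r \<odot>\<^bsub>M\<^esub> x"

lemma submodule_diff_closed:
  assumes "submodule B R M" "u \<in> B" "v \<in> B"
  shows "u \<ominus>\<^bsub>M\<^esub> v \<in> B"
  using submoduleE(3,5)[OF assms(1)] assms(2,3) by (simp add: a_minus_def)

lemma submodule_zero_closed: "submodule B R M \<Longrightarrow> \<zero>\<^bsub>M\<^esub> \<in> B"
  using subgroup.one_closed[of B "add_monoid M"] submodule.axioms(1) by fastforce

lemma submodule_carrier: "submodule B R M \<Longrightarrow> u \<in> B \<Longrightarrow> u \<in> carrier M"
  using submoduleE(1) by blast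

lemma submoduleI_smult:
  assumes "H \<subseteq> carrier M" "\<zero>\<^bsub>M\<^esub> \<in> H"
    and "\<And>a c. a \<in> H \<Longrightarrow> c \<in> H \<Longrightarrow> a \<oplus>\<^bsub>M\<^esub> c \<in> H"
    and sm: "\<And>r a. r \<in> carrier R \<Longrightarrow> a \<in> H \<Longrightarrow> r \<cdot> a \<in> H"
  shows "submodule H R M"
proof (rule submoduleI)
  fix a assume a: "a \<in> H"
  then have "(\<ominus> \<one>) \<cdot> a = \<ominus>\<^bsub>M\<^esub> a" using assms(1) by (simp add: smult_l_minus subset_iff)
  then show "\<ominus>\<^bsub>M\<^esub> a \<in> H" using sm[OF _ a, of "\<ominus> \<one>"] by simp
qed (use assms in auto)

lemma mcong_refl: "submodule B R M \<Longrightarrow> u \<in> carrier M \<Longrightarrow> mcong M B u u"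
  by (simp add: mcong_def submodule_zero_closed a_minus_def M.r_neg)

lemma mcong_sym:
  assumes "submodule B R M" "u \<in> carrier M" "v \<in> carrier M" "mcong M B u v"
  shows "mcong M B v u"
proof -
  have "v \<ominus>\<^bsub>M\<^esub> u = \<ominus>\<^bsub>M\<^esub> (u \<ominus>\<^bsub>M\<^esub> v)"
    using assms by (simp add: a_minus_def M.minus_add M.a_comm)
  then show ?thesis using assms submoduleE(3) by (simp add: mcong_def)
qed

lemma mcong_trans:
  assumes "submodule B R M" "u \<in> carrier M" "v \<in> carrier M" "w \<in> carrier M"
    "mcong M B u v" "mcong M B v w"
  shows "mcong M B u w"
proof -
  have "(u \<ominus>\<^bsub>M\<^esub> v) \<oplus>\<^bsub>M\<^esub> (v \<ominus>\<^bsub>M\<^esub> w) = u \<oplus>\<^bsub>M\<^esub> ((\<ominus>\<^bsub>M\<^esub> v \<oplus>\<^bsub>M\<^esub> v) \<oplus>\<^bsub>M\<^esub> \<ominus>\<^bsub>M\<^esub> w)"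
    using assms by (simp add: a_minus_def M.a_assoc)
  also have "\<dots> = u \<ominus>\<^bsub>M\<^esub> w" using assms by (simp add: M.l_neg a_minus_def)
  finally show ?thesis using assms submoduleE(5)[OF assms(1)] unfolding mcong_def by metis
qed

lemma mcong_smult:
  assumes "submodule B R M" "u \<in> carrier M" "v \<in> carrier M" "r \<in> carrier R" "mcong M B u v"
  shows "mcong M B (r \<cdot> u) (r \<cdot> v)"
proof -
  have "(r \<cdot> u) \<ominus>\<^bsub>M\<^esub> (r \<cdot> v) = r \<cdot> (u \<ominus>\<^bsub>M\<^esub> v)"
    using assms by (simp add: a_minus_def smult_r_distr smult_r_minus)
  then show ?thesis using assms submoduleE(4) by (simp add: mcong_def)
qed

lemma mcong_add:
  assumes "submodule B R M" "u \<in> carrier M" "v \<in> carrier M" "u' \<in> carrier M" "v' \<in> carrier M"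
    "mcong M B u v" "mcong M B u' v'"
  shows "mcong M B (u \<oplus>\<^bsub>M\<^esub> u') (v \<oplus>\<^bsub>M\<^esub> v')"
proof -
  have "(u \<oplus>\<^bsub>M\<^esub> u') \<ominus>\<^bsub>M\<^esub> (v \<oplus>\<^bsub>M\<^esub> v') = (u \<ominus>\<^bsub>M\<^esub> v) \<oplus>\<^bsub>M\<^esub> (u' \<ominus>\<^bsub>M\<^esub> v')"
    using assms by (simp add: a_minus_def M.minus_add M.a_ac)
  then show ?thesis using assms submoduleE(5) by (simp add: mcong_def)
qed

lemma mcong_mem:
  assumes "submodule B R M" "u \<in> carrier M" "v \<in> B" "mcong M B u v"
  shows "u \<in> B"
proof -
  have v: "v \<in> carrier M" using assms submodule_carrier by blast
  have "(u \<ominus>\<^bsub>M\<^esub> v) \<oplus>\<^bsub>M\<^esub> v = u"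
    using assms v by (simp add: a_minus_def M.a_assoc M.l_neg)
  then show ?thesis using assms submoduleE(5)[OF assms(1)] unfolding mcong_def by metis
qed

lemma mcong_mono: "B \<subseteq> C \<Longrightarrow> mcong M B u v \<Longrightarrow> mcong M C u v"
  unfolding mcong_def by blast

lemma mcong_zero_iff:
  assumes "u \<in> carrier M"
  shows "mcong M B u \<zero>\<^bsub>M\<^esub> \<longleftrightarrow> u \<in> B"
proof -
  have "u \<ominus>\<^bsub>M\<^esub> \<zero>\<^bsub>M\<^esub> = u" by (metis assms M.l_zero M.r_neg M.r_zero M.zero_closed M.a_inv_closed a_minus_def)
  then show ?thesis by (simp add: mcong_def)
qed

lemma nzd_mod_cancel:
  assumes "submodule B R M" "submodule A R M" "nzd_mod M x A B" "x \<in> carrier R" "u \<in> A" "v \<in> A"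
    "mcong M B (x \<cdot> u) (x \<cdot> v)"
  shows "mcong M B u v"
proof -
  have c: "u \<in> carrier M" "v \<in> carrier M" using assms submodule_carrier by auto
  have "x \<cdot> (u \<ominus>\<^bsub>M\<^esub> v) = (x \<cdot> u) \<ominus>\<^bsub>M\<^esub> (x \<cdot> v)"
    using assms c by (simp add: a_minus_def smult_r_distr smult_r_minus)
  then have "x \<cdot> (u \<ominus>\<^bsub>M\<^esub> v) \<in> B" using assms by (simp add: mcong_def)
  then show ?thesis
    using assms submodule_diff_closed unfolding mcong_def nzd_mod_def by blast
qed

lemma smult_left_commute:
  "x \<in> carrier R \<Longrightarrow> y \<in> carrier R \<Longrightarrow> u \<in> carrier M \<Longrightarrow>
   x \<cdot> (y \<cdot> u) = y \<cdot> (x \<cdot> u)"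
  by (simp add: smult_assoc1[symmetric] R.m_comm)

lemma add_multI:
  "u \<in> carrier M \<Longrightarrow> a \<in> A \<Longrightarrow> mcong M B u (x \<cdot> a) \<Longrightarrow> u \<in> add_mult M B x A"
  unfolding add_mult_def by blast

lemma add_multE:
  assumes "u \<in> add_mult M B x A"
  obtains a where "u \<in> carrier M" "a \<in> A" "mcong M B u (x \<cdot> a)"
  using assms unfolding add_mult_def by blast

lemma subquot_add_mult:
  assumes "subquot R M A B" "x \<in> carrier R"
  shows "subquot R M A (add_mult M B x A)" and "B \<subseteq> add_mult M B x A"
    and "\<And>a. a \<in> A \<Longrightarrow> x \<cdot> a \<in> add_mult M B x A"
proof -
  have A: "submodule A R M" and B: "submodule B R M" and "B \<subseteq> A"
    using assms by (auto simp: subquot_def)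
  note cA = submodule_carrier[OF A]
  show sub: "B \<subseteq> add_mult M B x A"
  proof
    fix u assume u: "u \<in> B"
    show "u \<in> add_mult M B x A"
      by (rule add_multI[of _ "\<zero>\<^bsub>M\<^esub>"])
        (use u submodule_carrier[OF B] submodule_zero_closed[OF A] assms in \<open>auto simp: mcong_zero_iff\<close>)
  qed
  show "x \<cdot> a \<in> add_mult M B x A" if "a \<in> A" for a
    by (rule add_multI[of _ a]) (use that cA assms mcong_refl[OF B] in auto)
  have "submodule (add_mult M B x A) R M"
  proof (rule submoduleI_smult)
    show "\<zero>\<^bsub>M\<^esub> \<in> add_mult M B x A" using sub submodule_zero_closed[OF B] by auto
  next
    fix a a' assume "a \<in> add_mult M B x A" "a' \<in> add_mult M B x A"
    then obtain c c' where c: "a \<in> carrier M" "c \<in> A" "mcong M B a (x \<cdot> c)"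
      and c': "a' \<in> carrier M" "c' \<in> A" "mcong M B a' (x \<cdot> c')" by (meson add_multE)
    show "a \<oplus>\<^bsub>M\<^esub> a' \<in> add_mult M B x A"
      by (rule add_multI[of _ "c \<oplus>\<^bsub>M\<^esub> c'"])
        (use c c' cA assms mcong_add[OF B _ _ _ _ c(3) c'(3)] submoduleE(5)[OF A]
          in \<open>auto simp: smult_r_distr\<close>)
  next
    fix r a assume r: "r \<in> carrier R" and "a \<in> add_mult M B x A"
    then obtain c where c: "a \<in> carrier M" "c \<in> A" "mcong M B a (x \<cdot> c)" by (meson add_multE)
    show "r \<cdot> a \<in> add_mult M B x A"
      by (rule add_multI[of _ "r \<cdot> c"])
        (use r c cA assms mcong_smult[OF B _ _ r c(3)] submoduleE(4)[OF A]
          in \<open>auto simp: smult_left_commute\<close>)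
  qed (auto simp: add_mult_def)
  moreover have "add_mult M B x A \<subseteq> A"
  proof
    fix u assume "u \<in> add_mult M B x A"
    then obtain a where a: "u \<in> carrier M" "a \<in> A" "mcong M B u (x \<cdot> a)" by (rule add_multE)
    show "u \<in> A"
      by (rule mcong_mem[OF A a(1) _ mcong_mono[OF \<open>B \<subseteq> A\<close> a(3)]])
        (use a assms submoduleE(4)[OF A] in auto)
  qed
  ultimately show "subquot R M A (add_mult M B x A)" using A by (auto simp: subquot_def)
qed

lemma add_mult_commute_subset:
  assumes "subquot R M A B" "x \<in> carrier R" "y \<in> carrier R"
  shows "add_mult M (add_mult M B x A) y A \<subseteq> add_mult M (add_mult M B y A) x A"
proof
  have A: "submodule A R M" and B: "submodule B R M"
    using assms by (auto simp: subquot_def)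
  note cA = submodule_carrier[OF A]
  fix u assume "u \<in> add_mult M (add_mult M B x A) y A"
  then obtain a where u: "u \<in> carrier M" and a: "a \<in> A"
    and "u \<ominus>\<^bsub>M\<^esub> (y \<cdot> a) \<in> add_mult M B x A" unfolding add_mult_def mcong_def by blast
  then obtain c where c: "c \<in> A" "(u \<ominus>\<^bsub>M\<^esub> (y \<cdot> a)) \<ominus>\<^bsub>M\<^esub> (x \<cdot> c) \<in> B"
    unfolding add_mult_def mcong_def by blast
  have "(u \<ominus>\<^bsub>M\<^esub> (y \<cdot> a)) \<ominus>\<^bsub>M\<^esub> (x \<cdot> c) = (u \<ominus>\<^bsub>M\<^esub> (x \<cdot> c)) \<ominus>\<^bsub>M\<^esub> (y \<cdot> a)"
    using assms u cA[OF a] cA[OF c(1)] by (simp add: a_minus_def M.a_ac)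
  then have "u \<ominus>\<^bsub>M\<^esub> (x \<cdot> c) \<in> add_mult M B y A"
    using c a u cA assms unfolding add_mult_def mcong_def by auto
  then show "u \<in> add_mult M (add_mult M B y A) x A"
    using u c unfolding add_mult_def mcong_def by auto
qed

lemma add_mult_commute:
  assumes "subquot R M A B" "x \<in> carrier R" "y \<in> carrier R"
  shows "add_mult M (add_mult M B x A) y A = add_mult M (add_mult M B y A) x A"
  using add_mult_commute_subset assms by blast

text \<open>This is half of the fact that regular sequences may be permuted: from \<open>xa = zn\<close> regularity of \<open>z\<close> modulo \<open>x\<close> gives \<open>n = xn'\<close>, and \<open>x\<close> cancels from \<open>xa = zxn'\<close>.\<close>

lemma nzd_mod_exchange:
  assumes S: "subquot R M A B" and x: "x \<in> carrier R" and z: "z \<in> carrier R"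
    and "nzd_mod M x A B" and "nzd_mod M z A (add_mult M B x A)"
  shows "nzd_mod M x A (add_mult M B z A)"
  unfolding nzd_mod_def
proof (intro ballI impI)
  have A: "submodule A R M" and B: "submodule B R M"
    using S by (auto simp: subquot_def)
  note cA = submodule_carrier[OF A]
  fix a assume a: "a \<in> A" and "x \<cdot> a \<in> add_mult M B z A"
  then obtain n where n: "n \<in> A" "mcong M B (x \<cdot> a) (z \<cdot> n)" by (meson add_multE)
  then have "z \<cdot> n \<in> add_mult M B x A"
    using a x z cA mcong_sym[OF B] by (intro add_multI[of _ a]) auto
  then have "n \<in> add_mult M B x A" using assms n unfolding nzd_mod_def by blast
  then obtain n' where n': "n' \<in> A" "mcong M B n (x \<cdot> n')" by (meson add_multE)
  have "mcong M B (z \<cdot> n) (z \<cdot> (x \<cdot> n'))"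
    using n n' x z cA by (intro mcong_smult[OF B]) auto
  then have "mcong M B (x \<cdot> a) (x \<cdot> (z \<cdot> n'))"
    using mcong_trans[OF B _ _ _ n(2)] n n' a x z cA
    by (simp add: smult_left_commute[of x z])
  then have "mcong M B a (z \<cdot> n')"
    using nzd_mod_cancel[OF B A] assms a n' submoduleE(4)[OF A] by blast
  then show "a \<in> add_mult M B z A" using a n' cA by (auto intro: add_multI)
qed

lemma grade_ge_SucD: "grade_ge M J A (Suc k) B \<Longrightarrow> grade_ge M J A k B"
proof (induction k arbitrary: B)
  case (Suc k)
  then show ?case by (metis grade_ge.simps(2))
qed simp

lemma grade_ge_antimono: "l \<le> k \<Longrightarrow> grade_ge M J A k B \<Longrightarrow> grade_ge M J A l B"
  by (induction k rule: dec_induct) (auto dest: grade_ge_SucD simp del: grade_ge.simps)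

lemma nzd_mod_no_socle: "x \<in> J \<Longrightarrow> nzd_mod M x A B \<Longrightarrow> no_socle M J A B"
  unfolding nzd_mod_def no_socle_def by blast

lemma grade_ge_trivial:
  assumes "x \<in> J" "submodule A R M" "x \<in> carrier R"
  shows "grade_ge M J A k A"
proof (induction k)
  case (Suc k)
  have "subquot R M A A" using assms by (simp add: subquot_def)
  then have "add_mult M A x A = A"
    using subquot_add_mult(1,2)[of A A x] assms by (auto simp: subquot_def)
  then show ?case using Suc assms unfolding grade_ge.simps nzd_mod_def by metis
qed simp

end

lemma submodule_vimage:
  assumes M: "module R M" and M': "module R M'" and A: "submodule A R M" and B: "submodule B R M'"
    and clos: "\<And>a. a \<in> A \<Longrightarrow> f a \<in> carrier M'"
    and add: "\<And>a c. a \<in> A \<Longrightarrow> c \<in> A \<Longrightarrow> f (a \<oplus>\<^bsub>M\<^esub> c) = f a \<oplus>\<^bsub>M'\<^esub> f c"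
    and smult: "\<And>r a. r \<in> carrier R \<Longrightarrow> a \<in> A \<Longrightarrow> f (r \<odot>\<^bsub>M\<^esub> a) = r \<odot>\<^bsub>M'\<^esub> f a"
  shows "submodule {a \<in> A. f a \<in> B} R M"
proof -
  interpret M: module R M by fact
  interpret M': module R M' by fact
  note zA = M.submodule_zero_closed[OF A] and EA = M.submoduleE[OF A] and EB = M'.submoduleE[OF B]
  have "f (\<zero>\<^bsub>R\<^esub> \<odot>\<^bsub>M\<^esub> \<zero>\<^bsub>M\<^esub>) = \<zero>\<^bsub>M'\<^esub>" using smult[OF M.R.zero_closed zA] M'.smult_l_null[OF clos[OF zA]] by (rule trans)
  then have "f \<zero>\<^bsub>M\<^esub> = \<zero>\<^bsub>M'\<^esub>" by simp
  then show ?thesis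
    by (intro M.submoduleI_smult)
      (use EA(1,4,5) EB(4,5) zA M'.submodule_zero_closed[OF B] add smult in auto)
qed

lemma submodule_image:
  assumes M: "module R M" and M': "module R M'" and A: "submodule A R M"
    and clos: "\<And>a. a \<in> A \<Longrightarrow> f a \<in> carrier M'"
    and add: "\<And>a c. a \<in> A \<Longrightarrow> c \<in> A \<Longrightarrow> f (a \<oplus>\<^bsub>M\<^esub> c) = f a \<oplus>\<^bsub>M'\<^esub> f c"
    and smult: "\<And>r a. r \<in> carrier R \<Longrightarrow> a \<in> A \<Longrightarrow> f (r \<odot>\<^bsub>M\<^esub> a) = r \<odot>\<^bsub>M'\<^esub> f a"
  shows "submodule (f ` A) R M'"
proof -
  interpret M: module R M by fact
  interpret M': module R M' by fact
  note zA = M.submodule_zero_closed[OF A] and EA = M.submoduleE[OF A]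
  have "f (\<zero>\<^bsub>R\<^esub> \<odot>\<^bsub>M\<^esub> \<zero>\<^bsub>M\<^esub>) = \<zero>\<^bsub>M'\<^esub>" using smult[OF M.R.zero_closed zA] M'.smult_l_null[OF clos[OF zA]] by (rule trans)
  then have f0: "f \<zero>\<^bsub>M\<^esub> = \<zero>\<^bsub>M'\<^esub>" by simp
  show ?thesis
  proof (rule M'.submoduleI_smult)
    show "f ` A \<subseteq> carrier M'" using clos by blast
    show "\<zero>\<^bsub>M'\<^esub> \<in> f ` A" using f0 zA by (metis imageI)
    fix x y assume "x \<in> f ` A" "y \<in> f ` A"
    then obtain a c where "a \<in> A" "c \<in> A" "x = f a" "y = f c" by blast
    then have "x \<oplus>\<^bsub>M'\<^esub> y = f (a \<oplus>\<^bsub>M\<^esub> c)" "a \<oplus>\<^bsub>M\<^esub> c \<in> A" using add EA(5) by auto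
    then show "x \<oplus>\<^bsub>M'\<^esub> y \<in> f ` A" by simp
  next
    fix r x assume r: "r \<in> carrier R" and "x \<in> f ` A"
    then obtain a where "a \<in> A" "x = f a" by blast
    then have "r \<odot>\<^bsub>M'\<^esub> x = f (r \<odot>\<^bsub>M\<^esub> a)" "r \<odot>\<^bsub>M\<^esub> a \<in> A" using smult r EA(4) by auto
    then show "r \<odot>\<^bsub>M'\<^esub> x \<in> f ` A" by simp
  qed
qed

text \<open>The map \<open>f\<close> induces an isomorphism \<open>A/B \<cong> A'/B'\<close>; a sequence of ring elements is then regular on both
sides. Stating this for a map on numerators makes it applicable to projections, inclusions and differentials
alike, without forming any quotient module.\<close>

lemma grade_ge_iso:
  assumes M: "module R M" and M': "module R M'"
    and S: "subquot R M A B" and S': "subquot R M' A' B'" and J: "J \<subseteq> carrier R"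
    and clos: "\<And>a. a \<in> A \<Longrightarrow> f a \<in> A'"
    and add: "\<And>a c. a \<in> A \<Longrightarrow> c \<in> A \<Longrightarrow> f (a \<oplus>\<^bsub>M\<^esub> c) = f a \<oplus>\<^bsub>M'\<^esub> f c"
    and smult: "\<And>r a. r \<in> carrier R \<Longrightarrow> a \<in> A \<Longrightarrow> f (r \<odot>\<^bsub>M\<^esub> a) = r \<odot>\<^bsub>M'\<^esub> f a"
    and surj: "\<And>a'. a' \<in> A' \<Longrightarrow> \<exists>a\<in>A. mcong M' B' a' (f a)"
    and ker: "\<And>a. a \<in> A \<Longrightarrow> f a \<in> B' \<longleftrightarrow> a \<in> B"
  shows "grade_ge M J A k B \<longleftrightarrow> grade_ge M' J A' k B'"
  using S S' surj ker
proof (induction k arbitrary: B B')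
  case (Suc k)
  interpret M: module R M by fact
  interpret M': module R M' by fact
  have A: "submodule A R M" and B: "submodule B R M" and BA: "B \<subseteq> A"
    and A': "submodule A' R M'" and B': "submodule B' R M'" and BA': "B' \<subseteq> A'"
    using Suc.prems by (auto simp: subquot_def)
  note cA = M.submodule_carrier[OF A] and cA' = M'.submodule_carrier[OF A']
  note sA = M.submoduleE(4)[OF A] and sA' = M'.submoduleE(4)[OF A']
  have fminus: "f (a \<ominus>\<^bsub>M\<^esub> c) = f a \<ominus>\<^bsub>M'\<^esub> f c" if "a \<in> A" "c \<in> A" for a c
  proof -
    have c': "(\<ominus>\<^bsub>R\<^esub> \<one>\<^bsub>R\<^esub>) \<odot>\<^bsub>M\<^esub> c = \<ominus>\<^bsub>M\<^esub> c" using that cA by (simp add: M.smult_l_minus)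
    have "f (\<ominus>\<^bsub>M\<^esub> c) = (\<ominus>\<^bsub>R\<^esub> \<one>\<^bsub>R\<^esub>) \<odot>\<^bsub>M'\<^esub> f c"
      using smult[of "\<ominus>\<^bsub>R\<^esub> \<one>\<^bsub>R\<^esub>" c] that unfolding c' by simp
    also have "\<dots> = \<ominus>\<^bsub>M'\<^esub> f c" using that clos cA' by (simp add: M'.smult_l_minus)
    finally show ?thesis using add[of a "\<ominus>\<^bsub>M\<^esub> c"] that M.submoduleE(3)[OF A] by (simp add: a_minus_def)
  qed
  have congr: "mcong M' B' (f a) (f c) \<longleftrightarrow> mcong M B a c" if "a \<in> A" "c \<in> A" for a c
    unfolding mcong_def using fminus[OF that, symmetric] Suc.prems(4) M.submodule_diff_closed[OF A that]
    by simp
  have memB': "u \<in> B' \<longleftrightarrow> f a \<in> B'" if "u \<in> A'" "a \<in> A" "mcong M' B' u (f a)" for u a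
    using that M'.mcong_mem[OF B'] M'.mcong_sym[OF B'] cA' clos by metis
  have eq: "nzd_mod M x A B \<longleftrightarrow> nzd_mod M' x A' B'"
    "grade_ge M J A k (add_mult M B x A) \<longleftrightarrow> grade_ge M' J A' k (add_mult M' B' x A')"
    if "x \<in> J" for x
  proof -
    have x: "x \<in> carrier R" using that J by blast
    show "nzd_mod M x A B \<longleftrightarrow> nzd_mod M' x A' B'"
    proof
      assume L: "nzd_mod M x A B"
      show "nzd_mod M' x A' B'" unfolding nzd_mod_def
      proof (intro ballI impI)
        fix u assume u: "u \<in> A'" "x \<odot>\<^bsub>M'\<^esub> u \<in> B'"
        obtain a where a: "a \<in> A" "mcong M' B' u (f a)" using Suc.prems(3) u by blast
        have "mcong M' B' (x \<odot>\<^bsub>M'\<^esub> u) (f (x \<odot>\<^bsub>M\<^esub> a))"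
          using M'.mcong_smult[OF B' _ _ x a(2)] u a cA' clos smult x by simp
        then have "f (x \<odot>\<^bsub>M\<^esub> a) \<in> B'" using memB' u a sA sA' x by blast
        then have "a \<in> B" using L a sA x Suc.prems(4) unfolding nzd_mod_def by blast
        then show "u \<in> B'" using memB' u a Suc.prems(4) by blast
      qed
    next
      assume L: "nzd_mod M' x A' B'"
      show "nzd_mod M x A B" unfolding nzd_mod_def
        using L clos smult x Suc.prems(4) sA unfolding nzd_mod_def by metis
    qed
    show "grade_ge M J A k (add_mult M B x A) \<longleftrightarrow> grade_ge M' J A' k (add_mult M' B' x A')"
    proof (rule Suc.IH)
      show "subquot R M A (add_mult M B x A)" "subquot R M' A' (add_mult M' B' x A')"
        using M.subquot_add_mult(1) M'.subquot_add_mult(1) Suc.prems x by auto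
      show "\<exists>a\<in>A. mcong M' (add_mult M' B' x A') a' (f a)" if "a' \<in> A'" for a'
        using Suc.prems(3)[OF that] M'.mcong_mono M'.subquot_add_mult(2)[OF Suc.prems(2) x] by blast
      show "f a \<in> add_mult M' B' x A' \<longleftrightarrow> a \<in> add_mult M B x A" if a: "a \<in> A" for a
      proof
        assume "f a \<in> add_mult M' B' x A'"
        then obtain u where u: "u \<in> A'" "mcong M' B' (f a) (x \<odot>\<^bsub>M'\<^esub> u)" by (meson M'.add_multE)
        obtain c where c: "c \<in> A" "mcong M' B' u (f c)" using Suc.prems(3) u by blast
        have "mcong M' B' (x \<odot>\<^bsub>M'\<^esub> u) (f (x \<odot>\<^bsub>M\<^esub> c))"
          using M'.mcong_smult[OF B' _ _ x c(2)] u c cA' clos smult x by simp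
        then have "mcong M' B' (f a) (f (x \<odot>\<^bsub>M\<^esub> c))"
          using M'.mcong_trans[OF B' _ _ _ u(2)] u a c cA' clos sA sA' x by blast
        then have "mcong M B a (x \<odot>\<^bsub>M\<^esub> c)" using congr a c sA x by blast
        then show "a \<in> add_mult M B x A" using a c cA by (auto intro: M.add_multI)
      next
        assume "a \<in> add_mult M B x A"
        then obtain c where c: "c \<in> A" "mcong M B a (x \<odot>\<^bsub>M\<^esub> c)" by (meson M.add_multE)
        then have "mcong M' B' (f a) (x \<odot>\<^bsub>M'\<^esub> f c)" using congr[of a "x \<odot>\<^bsub>M\<^esub> c"] a sA x smult by simp
        then show "f a \<in> add_mult M' B' x A'" using a c clos cA' by (auto intro: M'.add_multI)
      qed
    qed
  qed
  then show ?case by auto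
qed simp

section \<open>Primes, annihilators and common nonzerodivisors\<close>

text \<open>Multiply an element of \<open>J\<close> outside \<open>p\<close> by one element of each \<open>q\<close> outside \<open>p\<close>.\<close>

lemma (in cring) prime_ideal_not_containing_intersection:
  assumes "finite Q" "primeideal p R" "\<forall>q\<in>Q. ideal q R \<and> \<not> q \<subseteq> p" "ideal J R" "\<not> J \<subseteq> p"
  shows "\<exists>y\<in>J. y \<notin> p \<and> (\<forall>q\<in>Q. y \<in> q)"
  using assms(1,3)
proof (induction Q rule: finite_induct)
  case empty
  then show ?case using assms by blast
next
  case (insert q Q)
  then obtain y where y: "y \<in> J" "y \<notin> p" "\<forall>q\<in>Q. y \<in> q" by blast
  obtain u where u: "u \<in> q" "u \<notin> p" using insert.prems by blast
  have q: "ideal q R" using insert.prems by blast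
  have yR: "y \<in> carrier R" and uR: "u \<in> carrier R"
    using ideal.Icarr[OF \<open>ideal J R\<close> y(1)] ideal.Icarr[OF q u(1)] by auto
  have "y \<otimes> u \<in> J" using ideal.I_r_closed[OF assms(4) y(1) uR] .
  moreover have "y \<otimes> u \<notin> p" using primeideal.I_prime[OF assms(2) yR uR] y u by blast
  moreover have "\<forall>q'\<in>insert q Q. y \<otimes> u \<in> q'"
    using ideal.I_l_closed[OF q u(1) yR] ideal.I_r_closed[OF _ _ uR] y insert.prems by blast
  ultimately show ?case by blast
qed

text \<open>If one of the primes contains another one, the smaller one can be dropped. Otherwise pick \<open>p\<close> and
\<open>x \<in> J\<close> avoiding the other primes. If \<open>x \<in> p\<close>, add an element of \<open>J\<close> that lies in all primes but \<open>p\<close>.\<close>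

lemma (in cring) prime_avoidance:
  assumes "finite P" "\<forall>p\<in>P. primeideal p R" "ideal J R" "\<forall>p\<in>P. \<not> J \<subseteq> p"
  shows "\<exists>x\<in>J. \<forall>p\<in>P. x \<notin> p"
  using assms(1,2,4)
proof (induction P rule: finite_psubset_induct)
  case (psubset P)
  show ?case
  proof (cases "\<exists>p\<in>P. \<exists>q\<in>P. q \<noteq> p \<and> q \<subseteq> p")
    case True
    then obtain p q where pq: "p \<in> P" "q \<in> P" "q \<noteq> p" "q \<subseteq> p" by blast
    have "P - {q} \<subset> P" using pq by blast
    from psubset.IH[OF this] psubset.prems obtain x where "x \<in> J" "\<forall>p\<in>P - {q}. x \<notin> p" by blast
    moreover from this have "x \<notin> q" using pq by blast
    ultimately show ?thesis by blast
  next
    case False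
    show ?thesis
    proof (cases "P = {}")
      case True
      have "\<zero> \<in> J" using additive_subgroup.zero_closed[OF ideal.axioms(1)[OF assms(3)]] .
      then show ?thesis using True by blast
    next
      case ne: False
      then obtain p where p: "p \<in> P" by blast
      have "P - {p} \<subset> P" using p by blast
      from psubset.IH[OF this] psubset.prems obtain x where x: "x \<in> J" "\<forall>q\<in>P - {p}. x \<notin> q" by blast
      have "\<exists>y\<in>J. y \<notin> p \<and> (\<forall>q\<in>P - {p}. y \<in> q)"
      proof (rule prime_ideal_not_containing_intersection)
        show "finite (P - {p})" using psubset.hyps by simp
        show "primeideal p R" "\<not> J \<subseteq> p" using psubset.prems p by auto
        show "ideal J R" by fact
        show "\<forall>q\<in>P - {p}. ideal q R \<and> \<not> q \<subseteq> p"
        proof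
          fix q assume q: "q \<in> P - {p}"
          then have "primeideal q R" using psubset.prems by blast
          then show "ideal q R \<and> \<not> q \<subseteq> p" using False p q primeideal.axioms(1) by blast
        qed
      qed
      then obtain y where y: "y \<in> J" "y \<notin> p" "\<forall>q\<in>P - {p}. y \<in> q" by blast
      have xR: "x \<in> carrier R" and yR: "y \<in> carrier R" using ideal.Icarr[OF assms(3)] x y by auto
      show ?thesis
      proof (cases "x \<in> p")
        case False
        then show ?thesis using x by blast
      next
        case True
        have *: "u \<in> q" if "ideal q R" "u \<oplus> v \<in> q" "v \<in> q" "u \<in> carrier R" "v \<in> carrier R" for u v q
        proof -
          interpret q: ideal q R by fact
          have "(u \<oplus> v) \<oplus> (\<ominus> v) \<in> q" using that q.a_closed q.a_inv_closed by blast
          then show ?thesis using that by (simp add: a_assoc r_neg)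
        qed
        have "x \<oplus> y \<in> J" using additive_subgroup.a_closed[OF ideal.axioms(1)[OF assms(3)]] x y by blast
        moreover have "x \<oplus> y \<notin> q" if "q \<in> P" for q
        proof (cases "q = p")
          case True
          then show ?thesis using *[of p y x] psubset.prems p y \<open>x \<in> p\<close> xR yR primeideal.axioms(1)
            by (metis a_comm)
        next
          case False
          then show ?thesis using *[of q x y] psubset.prems that x y xR yR primeideal.axioms(1)
            by blast
        qed
        ultimately show ?thesis by blast
      qed
    qed
  qed
qed

lemma (in noetherian_ring) exists_maximal_ideal_in:
  assumes "C \<noteq> {}" "\<And>J. J \<in> C \<Longrightarrow> ideal J R"
  shows "\<exists>J\<in>C. \<forall>J'\<in>C. J \<subseteq> J' \<longrightarrow> J' = J"
proof (rule subset_Zorn)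
  fix D assume D: "subset.chain C D"
  show "\<exists>U\<in>C. \<forall>X\<in>D. X \<subseteq> U" 
  proof (cases "D = {}")
    case False
    have "subset.chain {I. ideal I R} D" using D assms unfolding pred_on.chain_def by auto
    then have "\<Union>D \<in> D" using ideal_chain_is_trivial False by blast
    moreover have "D \<subseteq> C" using D unfolding pred_on.chain_def by blast
    ultimately show ?thesis by (intro bexI[of _ "\<Union>D"]) auto
  qed (use assms in auto)
qed

lemma local_ring_proper_ideal:
  assumes "noetherian_ring R" "local_ring R \<mm>" "ideal J R" "J \<noteq> carrier R"
  shows "J \<subseteq> \<mm>"
proof -
  interpret noetherian_ring R by fact
  interpret cring R using assms by (simp add: local_ring_def)
  let ?C = "{K. ideal K R \<and> J \<subseteq> K \<and> K \<noteq> carrier R}"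
  have "\<exists>K\<in>?C. \<forall>K'\<in>?C. K \<subseteq> K' \<longrightarrow> K' = K"
    by (rule exists_maximal_ideal_in) (use assms in auto)
  then obtain K where K: "K \<in> ?C" "\<forall>K'\<in>?C. K \<subseteq> K' \<longrightarrow> K' = K" by blast
  have "maximalideal K R" 
  proof (rule maximalidealI)
    show "ideal K R" "carrier R \<noteq> K" using K by auto
    fix K' assume "ideal K' R" "K \<subseteq> K'" "K' \<subseteq> carrier R"
    then show "K' = K \<or> K' = carrier R"
    proof (cases "K' = carrier R")
      case False
      then have "K' \<in> ?C" using K(1) \<open>ideal K' R\<close> \<open>K \<subseteq> K'\<close> by blast
      then show ?thesis using K(2) \<open>K \<subseteq> K'\<close> by blast
    qed simp
  qed
  then have "K = \<mm>" using assms by (simp add: local_ring_def)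
  then show ?thesis using K by blast
qed

lemma local_ring_maximal_proper:
  assumes "local_ring R \<mm>"
  shows "ideal \<mm> R \<and> \<one>\<^bsub>R\<^esub> \<notin> \<mm>"
proof -
  have m: "maximalideal \<mm> R" using assms by (simp add: local_ring_def)
  show ?thesis
    using maximalideal.axioms(1)[OF m] maximalideal.I_notcarr[OF m]
      ideal.one_imp_carrier[OF maximalideal.axioms(1)[OF m]] by blast
qed

lemma local_ring_unit:
  fixes R (structure)
  assumes "noetherian_ring R" "local_ring R \<mm>" "r \<in> \<mm>"
  shows "\<exists>u\<in>carrier R. u \<otimes>\<^bsub>R\<^esub> (\<one>\<^bsub>R\<^esub> \<ominus>\<^bsub>R\<^esub> r) = \<one>\<^bsub>R\<^esub>"
proof -
  interpret cring R using assms by (simp add: local_ring_def)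
  interpret m: ideal \<mm> R using local_ring_maximal_proper assms by blast
  let ?v = "\<one> \<ominus> r"
  have v: "?v \<in> carrier R" using assms by auto
  have "?v \<notin> \<mm>"
  proof
    assume "?v \<in> \<mm>"
    then have "?v \<oplus> r \<in> \<mm>" using assms by blast
    moreover have "?v \<oplus> r = \<one>" using assms by (simp add: a_minus_def a_assoc l_neg)
    ultimately show False using local_ring_maximal_proper assms by metis
  qed
  moreover have "?v \<in> PIdl ?v" using v cgenideal_self by blast
  ultimately have "PIdl ?v = carrier R"
    using local_ring_proper_ideal[OF assms(1,2) cgenideal_ideal[OF v]] by blast
  then have "\<one> \<in> PIdl ?v" by blast
  then obtain u where "u \<in> carrier R" "\<one> = u \<otimes> ?v" unfolding cgenideal_def by blast
  then show ?thesis by metis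
qed

text \<open>That \<open>M\<close> is Noetherian is used in the form of maximal elements in sets of submodules: for the finiteness
of the set of maximal annihilators and for Nakayama's lemma.\<close>

locale noetherian_module = module +
  assumes noetherian_ring: "noetherian_ring R"
    and exists_maximal_submodule_in:
      "C \<noteq> {} \<Longrightarrow> (\<And>N. N \<in> C \<Longrightarrow> submodule N R M) \<Longrightarrow> \<exists>N\<in>C. \<forall>N'\<in>C. N \<subseteq> N' \<longrightarrow> N' = N"

text \<open>The annihilator of the class of \<open>a\<close> modulo \<open>B\<close>.\<close>

definition elt_ann :: "('a, 'r) ring_scheme \<Rightarrow> ('a, 'b, 'm) module_scheme \<Rightarrow> 'b set \<Rightarrow> 'b \<Rightarrow> 'a set" where
  "elt_ann R M B a = {r \<in> carrier R. r \<odot>\<^bsub>M\<^esub> a \<in> B}"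

text \<open>The submodule \<open>L + Ra\<close>.\<close>

definition add_cyclic ::
  "('a, 'r) ring_scheme \<Rightarrow> ('a, 'b, 'm) module_scheme \<Rightarrow> 'b set \<Rightarrow> 'b \<Rightarrow> 'b set" where
  "add_cyclic R M L a = {u \<in> carrier M. \<exists>r\<in>carrier R. mcong M L u (r \<odot>\<^bsub>M\<^esub> a)}"

context module begin

lemma zero_submodule: "submodule {\<zero>\<^bsub>M\<^esub>} R M"
  by (rule submoduleI_smult) auto

lemma submodule_add_cyclic:
  assumes L: "submodule L R M" and a: "a \<in> carrier M"
  shows "submodule (add_cyclic R M L a) R M" "L \<subseteq> add_cyclic R M L a" "a \<in> add_cyclic R M L a"
proof -
  note cL = submodule_carrier[OF L]
  show sub: "L \<subseteq> add_cyclic R M L a"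
    unfolding add_cyclic_def using cL a by (fastforce simp: mcong_zero_iff intro: bexI[of _ "\<zero>"])
  show "a \<in> add_cyclic R M L a"
    unfolding add_cyclic_def using mcong_refl[OF L a] a by (auto intro!: bexI[of _ "\<one>"])
  show "submodule (add_cyclic R M L a) R M"
  proof (rule submoduleI_smult)
    show "\<zero>\<^bsub>M\<^esub> \<in> add_cyclic R M L a" using sub submodule_zero_closed[OF L] by blast
  next
    fix u assume "u \<in> add_cyclic R M L a"
    then obtain r where r: "u \<in> carrier M" "r \<in> carrier R" "mcong M L u (r \<cdot> a)"
      unfolding add_cyclic_def by blast
    fix s assume s: "s \<in> carrier R"
    show "s \<cdot> u \<in> add_cyclic R M L a"
      using mcong_smult[OF L _ _ s r(3)] a s r unfolding add_cyclic_def
      by (auto intro!: bexI[of _ "s \<otimes> r"] simp: smult_assoc1)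
  next
    fix u u' assume "u \<in> add_cyclic R M L a" "u' \<in> add_cyclic R M L a"
    then obtain r r' where r: "u \<in> carrier M" "r \<in> carrier R" "mcong M L u (r \<cdot> a)"
      and r': "u' \<in> carrier M" "r' \<in> carrier R" "mcong M L u' (r' \<cdot> a)"
      unfolding add_cyclic_def by blast
    then show "u \<oplus>\<^bsub>M\<^esub> u' \<in> add_cyclic R M L a"
      using mcong_add[OF L _ _ _ _ r(3) r'(3)] a unfolding add_cyclic_def
      by (auto intro!: bexI[of _ "r \<oplus> r'"] simp: smult_l_distr)
  qed (auto simp: add_cyclic_def)
qed

lemma conductor_ideal:
  assumes B: "submodule B R M" and A: "A \<subseteq> carrier M"
  shows "ideal {r \<in> carrier R. \<forall>a\<in>A. r \<cdot> a \<in> B} R" (is "ideal ?J R")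
proof (rule idealI)
  have cA: "a \<in> carrier M" if "a \<in> A" for a using A that by blast
  note E = submoduleE(3-5)[OF B]
  show "ring R" using R.ring_axioms .
  show "subgroup ?J (add_monoid R)"
  proof (rule R.add.subgroupI)
    have "\<zero> \<in> ?J" using cA submodule_zero_closed[OF B] by simp
    then show "?J \<noteq> {}" by blast
  qed (use cA E in \<open>auto simp: smult_l_distr smult_l_minus\<close>)
  fix r x assume r: "r \<in> ?J" and x: "x \<in> carrier R"
  show "x \<otimes> r \<in> ?J" using r x cA E(2) by (simp add: smult_assoc1)
  then show "r \<otimes> x \<in> ?J" using r x R.m_comm[of r x] by simp
qed

lemma elt_ann_ideal:
  assumes "submodule B R M" "a \<in> carrier M"
  shows "ideal (elt_ann R M B a) R"
  using conductor_ideal[of B "{a}"] assms by (simp add: elt_ann_def)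

end

context noetherian_module begin

text \<open>Following Kaplansky: a maximal annihilator of a nonzero element of \<open>A/B\<close> is prime, and every zero
divisor lies in one. There are finitely many of them. Indeed, consider submodules \<open>L\<close> all of whose elements are
annihilated by the intersection of finitely many maximal annihilators, and take a maximal \<open>L\<close>. It contains
every element whose annihilator \<open>p\<close> is maximal, so \<open>p\<close> contains one of the finitely many primes belonging to \<open>L\<close>, and
equals it by maximality.\<close>

lemma zero_divisors_subset_finite_primes:
  assumes S: "subquot R M A B"
  shows "\<exists>P. finite P \<and> (\<forall>p\<in>P. primeideal p R \<and> (\<exists>a\<in>A - B. p = elt_ann R M B a)) \<and>
    (\<forall>r\<in>carrier R. \<not> nzd_mod M r A B \<longrightarrow> (\<exists>p\<in>P. r \<in> p))"
proof -
  have A: "submodule A R M" and B: "submodule B R M" and BA: "B \<subseteq> A"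
    using S by (auto simp: subquot_def)
  note cA = submodule_carrier[OF A]
  interpret N: noetherian_ring R by (rule noetherian_ring)
  let ?ann = "elt_ann R M B"
  define \<A> where "\<A> = ?ann ` (A - B)"
  define P where "P = {p \<in> \<A>. \<forall>q\<in>\<A>. p \<subseteq> q \<longrightarrow> q = p}"
  have A_ideal: "ideal p R" if "p \<in> \<A>" for p
    using that elt_ann_ideal[OF B] cA unfolding \<A>_def by blast
  have above: "\<exists>p\<in>P. q \<subseteq> p" if q: "q \<in> \<A>" for q
  proof -
    have "\<exists>p\<in>{p\<in>\<A>. q \<subseteq> p}. \<forall>p'\<in>{p\<in>\<A>. q \<subseteq> p}. p \<subseteq> p' \<longrightarrow> p' = p"
      by (rule N.exists_maximal_ideal_in) (use q A_ideal in auto)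
    then obtain p where p: "p \<in> \<A>" "q \<subseteq> p" "\<forall>p'\<in>{p\<in>\<A>. q \<subseteq> p}. p \<subseteq> p' \<longrightarrow> p' = p" by blast
    then have "p' = p" if "p' \<in> \<A>" "p \<subseteq> p'" for p' using p(2,3) that by (metis (mono_tags, lifting) mem_Collect_eq subset_trans)
    then show ?thesis using p(1,2) unfolding P_def by blast
  qed
  have prime: "primeideal p R" if p: "p \<in> P" for p
  proof (rule primeidealI)
    obtain a where a: "a \<in> A - B" "p = ?ann a" using p by (auto simp: P_def \<A>_def)
    show "ideal p R" "cring R" using p A_ideal R.is_cring by (auto simp: P_def)
    have "\<one> \<notin> p" using a cA by (auto simp: elt_ann_def)
    then show "carrier R \<noteq> p" by blast
    fix r s assume rs: "r \<in> carrier R" "s \<in> carrier R" "r \<otimes> s \<in> p"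
    show "r \<in> p \<or> s \<in> p"
    proof (rule disjCI)
      assume s: "s \<notin> p"
      then have sa: "s \<cdot> a \<in> A - B" using a rs submoduleE(4)[OF A] by (auto simp: elt_ann_def)
      have "p \<subseteq> ?ann (s \<cdot> a)"
        using a rs cA submoduleE(4)[OF B] by (auto simp: elt_ann_def smult_left_commute[of _ s])
      then have "?ann (s \<cdot> a) = p" using p sa by (auto simp: P_def \<A>_def)
      moreover have "r \<in> ?ann (s \<cdot> a)"
        using rs a cA by (auto simp: elt_ann_def smult_assoc1)
      ultimately show "r \<in> p" by blast
    qed
  qed
  \<comment> \<open>For \<open>T = {}\<close> the intersection is \<open>carrier R\<close>, so the zero submodule belongs to \<open>\<C>\<close>.\<close>
  define \<C> where "\<C> = {L. submodule L R M \<and>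
    (\<exists>T\<subseteq>P. finite T \<and> (\<forall>a\<in>L. carrier R \<inter> \<Inter>T \<subseteq> ?ann a))}"
  have "submodule {\<zero>\<^bsub>M\<^esub>} R M" by (rule zero_submodule)
  then have "{\<zero>\<^bsub>M\<^esub>} \<in> \<C>"
    using submodule_zero_closed[OF B] unfolding \<C>_def
    by (auto simp: elt_ann_def intro!: exI[of _ "{}"])
  then have "\<exists>L\<in>\<C>. \<forall>L'\<in>\<C>. L \<subseteq> L' \<longrightarrow> L' = L"
    by (intro exists_maximal_submodule_in) (auto simp: \<C>_def)
  then obtain L where L: "L \<in> \<C>" and Lmax: "\<forall>L'\<in>\<C>. L \<subseteq> L' \<longrightarrow> L' = L" by blast
  from L obtain T where sL: "submodule L R M" and T: "T \<subseteq> P" "finite T"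
    and TL: "\<forall>a\<in>L. carrier R \<inter> \<Inter>T \<subseteq> ?ann a" unfolding \<C>_def by blast
  have "P \<subseteq> T"
  proof
    fix p assume p: "p \<in> P"
    then obtain a where a: "a \<in> A - B" "p = ?ann a" by (auto simp: P_def \<A>_def)
    have ac: "a \<in> carrier M" using a cA by blast
    note cyc = submodule_add_cyclic[OF sL ac]
    have "carrier R \<inter> \<Inter>(insert p T) \<subseteq> ?ann u" if u: "u \<in> add_cyclic R M L a" for u
    proof
      fix x assume x: "x \<in> carrier R \<inter> \<Inter>(insert p T)"
      obtain r where r: "u \<in> carrier M" "r \<in> carrier R" "u \<ominus>\<^bsub>M\<^esub> r \<cdot> a \<in> L"
        using u unfolding add_cyclic_def mcong_def by blast
      have "x \<cdot> (u \<ominus>\<^bsub>M\<^esub> r \<cdot> a) \<in> B" using TL r x by (auto simp: elt_ann_def)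
      moreover have "x \<cdot> (r \<cdot> a) \<in> B"
        using x a r ac submoduleE(4)[OF B] by (auto simp: elt_ann_def smult_left_commute[of x r])
      ultimately have "x \<cdot> (u \<ominus>\<^bsub>M\<^esub> r \<cdot> a) \<oplus>\<^bsub>M\<^esub> x \<cdot> (r \<cdot> a) \<in> B"
        using submoduleE(5)[OF B] by blast
      moreover have "x \<cdot> (u \<ominus>\<^bsub>M\<^esub> r \<cdot> a) \<oplus>\<^bsub>M\<^esub> x \<cdot> (r \<cdot> a) = x \<cdot> u"
        using x r ac by (simp add: smult_r_distr[symmetric] a_minus_def M.a_assoc M.l_neg)
      ultimately show "x \<in> ?ann u" using x by (auto simp: elt_ann_def)
    qed
    then have "add_cyclic R M L a \<in> \<C>"
      unfolding \<C>_def using cyc(1) T p by (auto intro!: exI[of _ "insert p T"])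
    then have "a \<in> L" using Lmax cyc by blast
    then have "carrier R \<inter> \<Inter>T \<subseteq> p" using TL a by blast
    have "\<exists>q\<in>T. q \<subseteq> p"
    proof (rule ccontr)
      assume "\<not> ?thesis"
      moreover have "ideal q R" if "q \<in> T" for q
        using that T(1) prime primeideal.axioms(1) by blast
      ultimately have "\<forall>q\<in>T. ideal q R \<and> \<not> q \<subseteq> p" by blast
      moreover have "\<not> carrier R \<subseteq> p"
        using primeideal.I_notcarr[OF prime[OF p]] ideal.Icarr[OF primeideal.axioms(1)[OF prime[OF p]]]
        by blast
      ultimately have "\<exists>y\<in>carrier R. y \<notin> p \<and> (\<forall>q\<in>T. y \<in> q)"
        using R.prime_ideal_not_containing_intersection[OF T(2) prime[OF p] _ R.oneideal] by blast
      then show False using \<open>carrier R \<inter> \<Inter>T \<subseteq> p\<close> by blast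
    qed
    then show "p \<in> T" using T p unfolding P_def by blast
  qed
  then have "finite P" using T finite_subset by blast
  moreover have "\<exists>p\<in>P. r \<in> p" if "r \<in> carrier R" "\<not> nzd_mod M r A B" for r
  proof -
    obtain a where "a \<in> A - B" "r \<cdot> a \<in> B" using \<open>\<not> nzd_mod M r A B\<close> unfolding nzd_mod_def by blast
    then have "?ann a \<in> \<A>" "r \<in> ?ann a" using that by (auto simp: \<A>_def elt_ann_def)
    then show ?thesis using above by blast
  qed
  ultimately show ?thesis using prime by (intro exI[of _ P]) (auto simp: P_def \<A>_def)
qed

text \<open>If \<open>J\<close> contained no common nonzerodivisor, prime avoidance would put \<open>J\<close> into one of finitely many
annihilators of nonzero elements.\<close>

lemma common_nzd:
  assumes "finite Q" "ideal J R"
    "\<And>A B. (A, B) \<in> Q \<Longrightarrow> subquot R M A B \<and> no_socle M J A B"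
  shows "\<exists>x\<in>J. \<forall>(A, B)\<in>Q. nzd_mod M x A B"
proof -
  have "\<forall>X\<in>Q. \<exists>P. finite P \<and> (\<forall>p\<in>P. primeideal p R \<and> (\<exists>a\<in>fst X - snd X. p = elt_ann R M (snd X) a)) \<and>
    (\<forall>r\<in>carrier R. \<not> nzd_mod M r (fst X) (snd X) \<longrightarrow> (\<exists>p\<in>P. r \<in> p))"
    using zero_divisors_subset_finite_primes assms(3) by auto
  then obtain P where P: "\<And>X. X \<in> Q \<Longrightarrow> finite (P X)"
    "\<And>X p. X \<in> Q \<Longrightarrow> p \<in> P X \<Longrightarrow> primeideal p R \<and> (\<exists>a\<in>fst X - snd X. p = elt_ann R M (snd X) a)"
    "\<And>X r. X \<in> Q \<Longrightarrow> r \<in> carrier R \<Longrightarrow> \<not> nzd_mod M r (fst X) (snd X) \<Longrightarrow> \<exists>p\<in>P X. r \<in> p"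
    by metis
  have "\<exists>x\<in>J. \<forall>p\<in>(\<Union>X\<in>Q. P X). x \<notin> p"
  proof (rule R.prime_avoidance)
    show "\<forall>p\<in>\<Union> (P ` Q). \<not> J \<subseteq> p"
    proof (intro ballI notI)
      fix p assume "p \<in> \<Union> (P ` Q)" "J \<subseteq> p"
      then obtain A B a where AB: "(A, B) \<in> Q" and a: "a \<in> A" "a \<notin> B" "p = elt_ann R M B a"
        using P(2) by force
      then have "\<forall>j\<in>J. j \<cdot> a \<in> B" using \<open>J \<subseteq> p\<close> by (auto simp: elt_ann_def)
      then show False using assms(3)[OF AB] a by (auto simp: no_socle_def)
    qed
  qed (use P assms in auto)
  then obtain x where x: "x \<in> J" "\<forall>p\<in>(\<Union>X\<in>Q. P X). x \<notin> p" by blast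
  then have "nzd_mod M x A B" if "(A, B) \<in> Q" for A B
    using P(3)[OF that, of x] ideal.Icarr[OF assms(2)] that by auto
  then show ?thesis using x by blast
qed

lemma grade_ge_one_iff:
  assumes "ideal J R" "subquot R M A B"
  shows "grade_ge M J A (Suc 0) B \<longleftrightarrow> no_socle M J A B"
proof
  assume "grade_ge M J A (Suc 0) B"
  then obtain x where "x \<in> J" "nzd_mod M x A B" unfolding grade_ge.simps by blast
  then show "no_socle M J A B" by (rule nzd_mod_no_socle)
next
  assume ns: "no_socle M J A B"
  have "\<exists>x\<in>J. \<forall>(A', B')\<in>{(A, B)}. nzd_mod M x A' B'"
    by (rule common_nzd) (use assms ns in simp_all)
  then show "grade_ge M J A (Suc 0) B" by simp
qed

text \<open>The hypothesis says that \<open>N\<close> is the only submodule between \<open>B + \<mm>N\<close> and \<open>N\<close>, that is,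
\<open>N = B + \<mm>N\<close>. If \<open>N \<noteq> B\<close>, take \<open>L\<close> maximal among the proper submodules of \<open>N\<close> above \<open>B\<close>. The module
\<open>N/L\<close> is simple, hence annihilated by \<open>\<mm>\<close>, so \<open>L\<close> contains \<open>B + \<mm>N\<close>.\<close>

lemma nakayama:
  assumes "local_ring R \<mm>" and S: "subquot R M N B"
    and "\<And>L. subquot R M N L \<Longrightarrow> B \<subseteq> L \<Longrightarrow> (\<And>x y. x \<in> \<mm> \<Longrightarrow> y \<in> N \<Longrightarrow> x \<cdot> y \<in> L) \<Longrightarrow> L = N"
  shows "N = B"
proof (rule ccontr)
  assume "N \<noteq> B"
  let ?C = "{L. subquot R M N L \<and> B \<subseteq> L \<and> L \<noteq> N}"
  have "\<exists>L\<in>?C. \<forall>L'\<in>?C. L \<subseteq> L' \<longrightarrow> L' = L"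
    by (rule exists_maximal_submodule_in) (use S \<open>N \<noteq> B\<close> in \<open>auto simp: subquot_def\<close>)
  then obtain L where L: "subquot R M N L" "B \<subseteq> L" "L \<noteq> N" and Lmax: "\<forall>L'\<in>?C. L \<subseteq> L' \<longrightarrow> L' = L"
    by blast
  have N: "submodule N R M" and sL: "submodule L R M" and LN: "L \<subseteq> N" using L by (auto simp: subquot_def)
  have mR: "x \<in> carrier R" if "x \<in> \<mm>" for x
    using local_ring_maximal_proper[OF assms(1)] that ideal.Icarr by fast
  have "x \<cdot> y \<in> L" if x: "x \<in> \<mm>" and y: "y \<in> N" for x y
  proof (rule ccontr)
    assume nL: "x \<cdot> y \<notin> L"
    have yc: "y \<in> carrier M" and xc: "x \<in> carrier R" using y x mR submodule_carrier[OF N] by auto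
    then have xyc: "x \<cdot> y \<in> carrier M" and xyN: "x \<cdot> y \<in> N"
      using submoduleE(4)[OF N xc y] by auto
    let ?L = "add_cyclic R M L (x \<cdot> y)"
    note cyc = submodule_add_cyclic[OF sL xyc]
    have "?L \<subseteq> N"
    proof
      fix u assume "u \<in> ?L"
      then obtain r where r: "r \<in> carrier R" "u \<in> carrier M" "mcong M L u (r \<cdot> (x \<cdot> y))"
        unfolding add_cyclic_def by blast
      show "u \<in> N"
        using mcong_mem[OF N r(2) _ mcong_mono[OF LN r(3)]] submoduleE(4)[OF N r(1) xyN] by blast
    qed
    then have "?L = N" using Lmax cyc L nL N by (auto simp: subquot_def)
    then have "y \<in> ?L" using y by blast
    then obtain r where r: "r \<in> carrier R" "y \<ominus>\<^bsub>M\<^esub> r \<cdot> (x \<cdot> y) \<in> L"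
      unfolding add_cyclic_def mcong_def by blast
    interpret m: ideal \<mm> R using local_ring_maximal_proper[OF assms(1)] by blast
    have rx: "r \<otimes> x \<in> \<mm>" using x r m.I_l_closed by blast
    obtain u where u: "u \<in> carrier R" "u \<otimes> (\<one> \<ominus> r \<otimes> x) = \<one>"
      using local_ring_unit[OF noetherian_ring assms(1) rx] by blast
    have "y \<ominus>\<^bsub>M\<^esub> r \<cdot> (x \<cdot> y) = (\<one> \<ominus> r \<otimes> x) \<cdot> y"
      using r xc yc by (simp add: a_minus_def smult_l_distr smult_l_minus smult_assoc1)
    then have "u \<cdot> ((\<one> \<ominus> r \<otimes> x) \<cdot> y) \<in> L"
      using r u submoduleE(4)[OF sL] by simp
    moreover have "u \<cdot> ((\<one> \<ominus> r \<otimes> x) \<cdot> y) = y"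
      using u r xc yc by (simp add: smult_assoc1[symmetric])
    ultimately have "y \<in> L" by simp
    then show False using nL submoduleE(4)[OF sL xc] by blast
  qed
  then show False using assms(3)[OF L(1,2)] L(3) by blast
qed

end

section \<open>Grade in short exact sequences and grade against dimension\<close>

context noetherian_module begin

lemma subquot_trans: "subquot R M A A' \<Longrightarrow> subquot R M A' B \<Longrightarrow> subquot R M A B"
  unfolding subquot_def by blast

text \<open>Both socles are \<open>Ext\<^sup>1(R/J, A/B)\<close>. Concretely, if \<open>J\<close> maps \<open>a\<close> into \<open>B + yA\<close>, write \<open>xa = ya'\<close>; then \<open>J\<close>
maps \<open>a'\<close> into \<open>B + xA\<close>, and \<open>a' \<in> B + xA\<close> implies \<open>a \<in> B + yA\<close>.\<close>

lemma no_socle_exchange: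
  assumes S: "subquot R M A B" and J: "J \<subseteq> carrier R" and x: "x \<in> J" "nzd_mod M x A B"
    and y: "y \<in> J" "nzd_mod M y A B" and ns: "no_socle M J A (add_mult M B x A)"
  shows "no_socle M J A (add_mult M B y A)"
  unfolding no_socle_def
proof (intro ballI impI)
  have A: "submodule A R M" and B: "submodule B R M" using S by (auto simp: subquot_def)
  note cA = submodule_carrier[OF A] and sA = submoduleE(4)[OF A]
  have xR: "x \<in> carrier R" and yR: "y \<in> carrier R" using x y J by auto
  fix a assume a: "a \<in> A" and Ja: "\<forall>j\<in>J. j \<cdot> a \<in> add_mult M B y A"
  from Ja x obtain a' where a': "a' \<in> A" "mcong M B (x \<cdot> a) (y \<cdot> a')" by (meson add_multE)
  have "j \<cdot> a' \<in> add_mult M B x A" if j: "j \<in> J" for j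
  proof -
    have jR: "j \<in> carrier R" using j J by blast
    obtain c where c: "c \<in> A" "mcong M B (j \<cdot> a) (y \<cdot> c)" using Ja j by (meson add_multE)
    have "mcong M B (j \<cdot> (x \<cdot> a)) (j \<cdot> (y \<cdot> a'))"
      by (rule mcong_smult[OF B]) (use a a' cA xR yR jR in auto)
    then have 1: "mcong M B (x \<cdot> (j \<cdot> a)) (y \<cdot> (j \<cdot> a'))"
      using a a' cA xR yR jR by (simp add: smult_left_commute[of j])
    have "mcong M B (x \<cdot> (j \<cdot> a)) (x \<cdot> (y \<cdot> c))"
      by (rule mcong_smult[OF B]) (use a c cA xR yR jR in auto)
    then have 2: "mcong M B (x \<cdot> (j \<cdot> a)) (y \<cdot> (x \<cdot> c))"
      using c cA xR yR by (simp add: smult_left_commute[of x y])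
    have "mcong M B (y \<cdot> (j \<cdot> a')) (y \<cdot> (x \<cdot> c))"
      by (rule mcong_trans[OF B _ _ _ mcong_sym[OF B _ _ 1] 2]) (use a a' c cA xR yR jR in auto)
    from nzd_mod_cancel[OF B A y(2) yR _ _ this]
    have "mcong M B (j \<cdot> a') (x \<cdot> c)"
      using a' c sA xR jR by simp
    then show ?thesis by (intro add_multI[of _ c]) (use a' c cA jR in auto)
  qed
  then have "a' \<in> add_mult M B x A" using ns a' unfolding no_socle_def by blast
  then obtain c where c: "c \<in> A" "mcong M B a' (x \<cdot> c)" by (meson add_multE)
  have "mcong M B (y \<cdot> a') (y \<cdot> (x \<cdot> c))"
    by (rule mcong_smult[OF B]) (use a' c cA xR yR in auto)
  then have "mcong M B (y \<cdot> a') (x \<cdot> (y \<cdot> c))"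
    using c cA xR yR by (simp add: smult_left_commute[of x y])
  then have "mcong M B (x \<cdot> a) (x \<cdot> (y \<cdot> c))"
    using mcong_trans[OF B _ _ _ a'(2)] a a' c cA xR yR by auto
  from nzd_mod_cancel[OF B A x(2) xR _ _ this]
  have "mcong M B a (y \<cdot> c)" using a c sA yR by simp
  then show "a \<in> add_mult M B y A" by (intro add_multI[of _ c]) (use a c cA in auto)
qed

lemma grade_ge_no_socle:
  assumes "grade_ge M J A (Suc k) B"
  shows "no_socle M J A B"
  using assms nzd_mod_no_socle by auto

text \<open>Choose \<open>z \<in> J\<close> that is a nonzerodivisor on \<open>A/B\<close> and modulo both \<open>x\<close> and \<open>y\<close>. The induction hypothesis
modulo \<open>x\<close> lets the sequence after \<open>x\<close> start with \<open>z\<close>; swap \<open>x\<close> and \<open>z\<close>, replace \<open>x\<close> by \<open>y\<close> by the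
induction hypothesis modulo \<open>z\<close>, and swap back.\<close>

lemma grade_ge_exchange:
  assumes J: "ideal J R" and "subquot R M A B" "x \<in> J" "nzd_mod M x A B" "y \<in> J" "nzd_mod M y A B"
    "grade_ge M J A k (add_mult M B x A)"
  shows "grade_ge M J A k (add_mult M B y A)"
  using assms(2-)
proof (induction k arbitrary: B x y)
  case (Suc k)
  note S = Suc.prems(1)
  have JR: "J \<subseteq> carrier R" using ideal.Icarr[OF J] by blast
  have xR: "x \<in> carrier R" and yR: "y \<in> carrier R" using Suc.prems JR by auto
  note Sx = subquot_add_mult(1)[OF S xR] and Sy = subquot_add_mult(1)[OF S yR]
  have nsx: "no_socle M J A (add_mult M B x A)" using grade_ge_no_socle Suc.prems(6) by blast
  have nsy: "no_socle M J A (add_mult M B y A)"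
    using no_socle_exchange[OF S JR Suc.prems(2-5) nsx] .
  have ns: "no_socle M J A B" using nzd_mod_no_socle Suc.prems by blast
  have "\<exists>z\<in>J. \<forall>(A', B')\<in>{(A, B), (A, add_mult M B x A), (A, add_mult M B y A)}. nzd_mod M z A' B'"
    by (rule common_nzd[OF _ J]) (use S Sx Sy nsx nsy ns in auto)
  then obtain z where z: "z \<in> J" "nzd_mod M z A B" "nzd_mod M z A (add_mult M B x A)"
    "nzd_mod M z A (add_mult M B y A)" by auto
  have zR: "z \<in> carrier R" using z JR by auto
  note Sz = subquot_add_mult(1)[OF S zR]
  obtain w where w: "w \<in> J" "nzd_mod M w A (add_mult M B x A)"
    "grade_ge M J A k (add_mult M (add_mult M B x A) w A)" using Suc.prems(6) by auto
  have "grade_ge M J A k (add_mult M (add_mult M B x A) z A)"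
    using Suc.IH[OF Sx w(1,2) z(1,3) w(3)] .
  then have "grade_ge M J A k (add_mult M (add_mult M B z A) x A)"
    using add_mult_commute[OF S xR zR] by simp
  then have "grade_ge M J A k (add_mult M (add_mult M B z A) y A)"
    using Suc.IH[OF Sz Suc.prems(2) nzd_mod_exchange[OF S xR zR Suc.prems(3) z(3)]
      Suc.prems(4) nzd_mod_exchange[OF S yR zR Suc.prems(5) z(4)]] by blast
  then have "grade_ge M J A k (add_mult M (add_mult M B y A) z A)"
    using add_mult_commute[OF S yR zR] by simp
  then show ?case using z by auto
qed simp

lemma grade_ge_nzd:
  assumes "ideal J R" "subquot R M A B" "x \<in> J" "nzd_mod M x A B" "grade_ge M J A (Suc k) B"
  shows "grade_ge M J A k (add_mult M B x A)"
proof -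
  obtain w where "w \<in> J" "nzd_mod M w A B" "grade_ge M J A k (add_mult M B w A)" using assms(5) by auto
  then show ?thesis using grade_ge_exchange[OF assms(1,2)] assms(3,4) by blast
qed

text \<open>If \<open>y\<close> is a nonzerodivisor on \<open>A/A'\<close>, then \<open>A' \<inter> (B + yA) = B + yA'\<close>, so dividing the exact sequence
\<open>0 \<rightarrow> A'/B \<rightarrow> A/B \<rightarrow> A/A' \<rightarrow> 0\<close> by \<open>y\<close> keeps it exact.\<close>

lemma grade_ge_submodule_mod:
  assumes J: "J \<subseteq> carrier R" and S: "subquot R M A A'" and S': "subquot R M A' B"
    and y: "y \<in> carrier R" "nzd_mod M y A A'"
  shows "grade_ge M J A' k (add_mult M B y A') \<longleftrightarrow>
    grade_ge M J (add_mult M A' y A) k (add_mult M B y A)"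
proof -
  have A: "submodule A R M" and A': "submodule A' R M" and B: "submodule B R M"
    and sub: "A' \<subseteq> A" "B \<subseteq> A'"
    using S S' by (simp_all add: subquot_def)
  have SB: "subquot R M A B" using subquot_trans[OF S S'] .
  note cA = submodule_carrier[OF A] and sA = submoduleE(4)[OF A]
  note Q = subquot_add_mult[OF S y(1)] and Q' = subquot_add_mult[OF S' y(1)]
    and QB = subquot_add_mult[OF SB y(1)]
  have BA: "add_mult M B y A \<subseteq> add_mult M A' y A"
    unfolding add_mult_def using mcong_mono[OF sub(2)] by blast
  show ?thesis
  proof (rule grade_ge_iso[OF module_axioms module_axioms _ _ J, where f = "\<lambda>u. u"])
    show "subquot R M A' (add_mult M B y A')" by (rule Q')
    show "subquot R M (add_mult M A' y A) (add_mult M B y A)"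
      using Q QB BA by (auto simp: subquot_def)
    show "a \<in> add_mult M A' y A" if "a \<in> A'" for a using that Q by blast
    show "\<exists>a\<in>A'. mcong M (add_mult M B y A) u a" if u: "u \<in> add_mult M A' y A" for u
    proof -
      obtain c where c: "u \<in> carrier M" "c \<in> A" "u \<ominus>\<^bsub>M\<^esub> y \<cdot> c \<in> A'"
        using u unfolding add_mult_def mcong_def by blast
      have "u \<ominus>\<^bsub>M\<^esub> (u \<ominus>\<^bsub>M\<^esub> y \<cdot> c) = y \<cdot> c"
        using c cA y by (simp add: a_minus_def M.minus_add M.a_assoc[symmetric] M.r_neg)
      then have "mcong M (add_mult M B y A) u (u \<ominus>\<^bsub>M\<^esub> y \<cdot> c)"
        using QB(3)[OF c(2)] by (simp add: mcong_def)
      then show ?thesis using c by blast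
    qed
    show "a \<in> add_mult M B y A \<longleftrightarrow> a \<in> add_mult M B y A'" if a: "a \<in> A'" for a
    proof
      assume "a \<in> add_mult M B y A"
      then obtain c where c: "a \<in> carrier M" "c \<in> A" "mcong M B a (y \<cdot> c)" by (rule add_multE)
      have "y \<cdot> c \<in> A'"
        by (rule mcong_mem[OF A' _ a mcong_mono[OF sub(2) mcong_sym[OF B _ _ c(3)]]])
          (use c cA y in auto)
      then have "c \<in> A'" using y c unfolding nzd_mod_def by blast
      then show "a \<in> add_mult M B y A'" using c by (intro add_multI) auto
    next
      assume "a \<in> add_mult M B y A'"
      then show "a \<in> add_mult M B y A" using sub unfolding add_mult_def by blast
    qed
  qed auto
qed

text \<open>One of the three inequalities of the depth lemma, \<open>grade A'/B \<ge> min (grade A/B) (grade A/A' + 1)\<close>, by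
dividing the sequence by a common nonzerodivisor.\<close>

lemma grade_ge_submodule:
  assumes J: "ideal J R" and "subquot R M A A'" "subquot R M A' B"
    "grade_ge M J A (Suc k) B" "grade_ge M J A k A'"
  shows "grade_ge M J A' (Suc k) B"
  using assms(2-)
proof (induction k arbitrary: A' B)
  case 0
  then obtain x where x: "x \<in> J" "nzd_mod M x A B" by auto
  then have "nzd_mod M x A' B" using 0 unfolding subquot_def nzd_mod_def by blast
  then show ?case using x by auto
next
  case (Suc k)
  note S = Suc.prems(1) and S' = Suc.prems(2)
  have SB: "subquot R M A B" using subquot_trans[OF S S'] .
  have JR: "J \<subseteq> carrier R" using ideal.Icarr[OF J] by blast
  have "\<exists>y\<in>J. \<forall>(A1, B1)\<in>{(A, B), (A, A')}. nzd_mod M y A1 B1"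
    by (rule common_nzd[OF _ J])
      (use S SB grade_ge_no_socle[OF Suc.prems(3)] grade_ge_no_socle[OF Suc.prems(4)] in auto)
  then obtain y where y: "y \<in> J" "nzd_mod M y A B" "nzd_mod M y A A'" by auto
  have yR: "y \<in> carrier R" using y JR by blast
  have "add_mult M B y A \<subseteq> add_mult M A' y A"
    unfolding add_mult_def using mcong_mono[of B A'] S' unfolding subquot_def by blast
  then have "subquot R M (add_mult M A' y A) (add_mult M B y A)"
    using subquot_add_mult(1)[OF S yR] subquot_add_mult(1)[OF SB yR] unfolding subquot_def by blast
  from Suc.IH[OF subquot_add_mult(1)[OF S yR] this grade_ge_nzd[OF J SB y(1,2) Suc.prems(3)]
      grade_ge_nzd[OF J S y(1,3) Suc.prems(4)]]
  have "grade_ge M J (add_mult M A' y A) (Suc k) (add_mult M B y A)" .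
  then have "grade_ge M J A' (Suc k) (add_mult M B y A')"
    using grade_ge_submodule_mod[OF JR S S' yR y(3)] by blast
  moreover have "nzd_mod M y A' B" using y S unfolding subquot_def nzd_mod_def by blast
  ultimately show ?case unfolding grade_ge.simps(2)[of M J A' "Suc k"] using y(1) by blast
qed

text \<open>Another inequality of the depth lemma, \<open>grade A/A' \<ge> min (grade A/B) (grade A'/B - 1)\<close>. First, \<open>A/A'\<close>
has no socle: if \<open>J\<close> maps \<open>c\<close> into \<open>A'\<close>, then \<open>J\<close> kills the class of \<open>yc\<close> in \<open>A'/(B + yA')\<close>, which has
positive grade, so \<open>yc\<close> lies in \<open>B + yA'\<close> and \<open>c\<close> lies in \<open>A'\<close>. After that, divide by a
common nonzerodivisor.\<close>

lemma grade_ge_quotient: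
  assumes J: "ideal J R" and "subquot R M A A'" "subquot R M A' B"
    "grade_ge M J A' (Suc k) B" "grade_ge M J A k B"
  shows "grade_ge M J A k A'"
  using assms(2-)
proof (induction k arbitrary: A' B)
  case (Suc k)
  note S = Suc.prems(1) and S' = Suc.prems(2)
  have SB: "subquot R M A B" using subquot_trans[OF S S'] .
  have A: "submodule A R M" and A': "submodule A' R M" and B: "submodule B R M"
    and sub: "A' \<subseteq> A" "B \<subseteq> A'" using S S' by (auto simp: subquot_def)
  note cA = submodule_carrier[OF A]
  have JR: "J \<subseteq> carrier R" using ideal.Icarr[OF J] by blast
  note ns = grade_ge_no_socle[OF Suc.prems(3)] grade_ge_no_socle[OF Suc.prems(4)]
  have "\<exists>y\<in>J. \<forall>(A1, B1)\<in>{(A, B), (A', B)}. nzd_mod M y A1 B1"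
    by (rule common_nzd[OF _ J]) (use S' SB ns in auto)
  then obtain y where y: "y \<in> J" "nzd_mod M y A B" "nzd_mod M y A' B" by auto
  have yR: "y \<in> carrier R" using y JR by blast
  have nsq: "no_socle M J A' (add_mult M B y A')"
    using grade_ge_no_socle grade_ge_nzd[OF J S' y(1,3) Suc.prems(3)] by blast
  have nsA: "no_socle M J A A'" unfolding no_socle_def
  proof (intro ballI impI)
    fix c assume c: "c \<in> A" and Jc: "\<forall>j\<in>J. j \<cdot> c \<in> A'"
    have "w \<cdot> (y \<cdot> c) \<in> add_mult M B y A'" if w: "w \<in> J" for w
    proof -
      have "w \<cdot> (y \<cdot> c) = y \<cdot> (w \<cdot> c)"
        using w yR JR c cA by (intro smult_left_commute) auto
      then show ?thesis using subquot_add_mult(3)[OF S' yR] Jc w by simp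
    qed
    then have "y \<cdot> c \<in> add_mult M B y A'" using nsq Jc y unfolding no_socle_def by blast
    then obtain a where a: "a \<in> A'" "mcong M B (y \<cdot> c) (y \<cdot> a)" by (meson add_multE)
    then have "mcong M B c a" using nzd_mod_cancel[OF B A y(2) yR c] sub by blast
    then show "c \<in> A'" using mcong_mem[OF A' _ a(1)] mcong_mono[OF sub(2)] c cA by blast
  qed
  have "\<exists>y\<in>J. \<forall>(A1, B1)\<in>{(A, B), (A', B), (A, A')}. nzd_mod M y A1 B1"
    by (rule common_nzd[OF _ J]) (use S S' SB ns nsA in auto)
  then obtain z where z: "z \<in> J" "nzd_mod M z A B" "nzd_mod M z A' B" "nzd_mod M z A A'" by auto
  have zR: "z \<in> carrier R" using z JR by blast
  have "grade_ge M J (add_mult M A' z A) (Suc k) (add_mult M B z A)"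
    using grade_ge_nzd[OF J S' z(1,3) Suc.prems(3)] grade_ge_submodule_mod[OF JR S S' zR z(4)] by blast
  moreover have "add_mult M B z A \<subseteq> add_mult M A' z A"
    unfolding add_mult_def using mcong_mono[OF sub(2)] by blast
  then have "subquot R M (add_mult M A' z A) (add_mult M B z A)"
    using subquot_add_mult(1)[OF S zR] subquot_add_mult(1)[OF SB zR] unfolding subquot_def by blast
  ultimately have "grade_ge M J A k (add_mult M A' z A)"
    using Suc.IH[OF subquot_add_mult(1)[OF S zR]] grade_ge_nzd[OF J SB z(1,2) Suc.prems(4)] by blast
  then show ?case using z by auto
qed simp

text \<open>The grade of \<open>J\<close> is attained at a prime above \<open>J\<close>: if all elements of \<open>J\<close> are zero divisors, then \<open>J\<close>
lies in a prime that annihilates a nonzero element.\<close>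

lemma grade_ge_of_primes:
  assumes "ideal J R" "subquot R M A B"
    "\<And>p. primeideal p R \<Longrightarrow> J \<subseteq> p \<Longrightarrow> grade_ge M p A k B"
  shows "grade_ge M J A k B"
  using assms(2-)
proof (induction k arbitrary: B)
  case (Suc k)
  note S = Suc.prems(1)
  obtain P where P: "finite P" "\<And>p. p \<in> P \<Longrightarrow> primeideal p R \<and> (\<exists>a\<in>A - B. p = elt_ann R M B a)"
    "\<And>r. r \<in> carrier R \<Longrightarrow> \<not> nzd_mod M r A B \<Longrightarrow> \<exists>p\<in>P. r \<in> p"
    using zero_divisors_subset_finite_primes[OF S] by metis
  have "\<exists>x\<in>J. \<forall>p\<in>P. x \<notin> p"
  proof (rule R.prime_avoidance[OF P(1) _ assms(1)])
    show "\<forall>p\<in>P. primeideal p R" using P by blast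
    show "\<forall>p\<in>P. \<not> J \<subseteq> p"
    proof (intro ballI notI)
      fix p assume p: "p \<in> P" "J \<subseteq> p"
      then obtain a where a: "a \<in> A - B" "p = elt_ann R M B a" using P by blast
      have "no_socle M p A B" using Suc.prems(2) P p grade_ge_no_socle by blast
      then show False using a unfolding no_socle_def elt_ann_def by blast
    qed
  qed
  then obtain y where y: "y \<in> J" "\<forall>p\<in>P. y \<notin> p" by blast
  have yR: "y \<in> carrier R" using y ideal.Icarr[OF assms(1)] by blast
  have nzd: "nzd_mod M y A B" using P y yR by blast
  have "grade_ge M J A k (add_mult M B y A)"
  proof (rule Suc.IH)
    show "subquot R M A (add_mult M B y A)" by (rule subquot_add_mult[OF S yR])
    show "grade_ge M p A k (add_mult M B y A)" if "primeideal p R" "J \<subseteq> p" for p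
      using grade_ge_nzd[OF primeideal.axioms(1)[OF that(1)] S _ nzd Suc.prems(2)[OF that]] that y by blast
  qed
  then show ?case using y nzd by auto
qed simp

text \<open>Adding one element to an ideal raises the grade by at most one. The main point is that the submodule \<open>N\<close>
of elements killed by \<open>J\<close> is zero if \<open>J + Rx\<close> has grade at least \<open>2\<close>; here and below everything is read
modulo \<open>B\<close>. There is an embedding of \<open>N/xN\<close> into
\<open>Ext\<^sup>1(R/(J + Rx), A/B) = 0\<close>, sending \<open>n\<close> to the map \<open>j + rx \<mapsto> rn\<close> on \<open>J + Rx\<close>; so \<open>N = xN\<close> and
Nakayama's lemma applies. In terms of elements: for a nonzerodivisor \<open>y = j\<^sub>0 + r\<^sub>0x\<close> the class of
\<open>m\<^sub>0 = r\<^sub>0n\<close> modulo \<open>y\<close> is killed by \<open>J + Rx\<close>, so \<open>m\<^sub>0 = ym\<^sub>1\<close>, and cancelling \<open>y\<close> shows \<open>m\<^sub>1 \<in> N\<close> and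
\<open>xm\<^sub>1 = n\<close>.\<close>

lemma grade_ge_add_element:
  assumes J: "ideal J R" and loc: "local_ring R \<mm>" and x: "x \<in> \<mm>"
    and "subquot R M A B" "grade_ge M (J <+>\<^bsub>R\<^esub> PIdl x) A (Suc k) B"
  shows "grade_ge M J A k B"
  using assms(4-)
proof (induction k arbitrary: B)
  case (Suc k)
  note S = Suc.prems(1)
  have A: "submodule A R M" and B: "submodule B R M" and BA: "B \<subseteq> A" using S by (auto simp: subquot_def)
  note cA = submodule_carrier[OF A] and sA = submoduleE(4)[OF A]
  have JR: "j \<in> carrier R" if "j \<in> J" for j using ideal.Icarr[OF J that] .
  have xR: "x \<in> carrier R" using x local_ring_maximal_proper[OF loc] ideal.Icarr by fast
  let ?J = "J <+>\<^bsub>R\<^esub> PIdl x"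
  have idJ: "ideal ?J R" using R.add_ideals[OF J R.cgenideal_ideal[OF xR]] .
  have memJ: "w \<in> ?J \<longleftrightarrow> (\<exists>j\<in>J. \<exists>r\<in>carrier R. w = j \<oplus> r \<otimes> x)" for w
    unfolding set_add_def' cgenideal_def by blast
  have subJ: "J \<subseteq> ?J"
  proof
    fix j assume "j \<in> J"
    then show "j \<in> ?J" unfolding memJ using xR JR by (intro bexI[of _ j] bexI[of _ "\<zero>"]) auto
  qed
  obtain y where y: "y \<in> ?J" "nzd_mod M y A B" "grade_ge M ?J A (Suc k) (add_mult M B y A)"
    using Suc.prems(2) unfolding grade_ge.simps(2)[of M ?J A "Suc k"] by blast
  have yR: "y \<in> carrier R" using ideal.Icarr[OF idJ y(1)] .
  have nsy: "no_socle M ?J A (add_mult M B y A)" using y grade_ge_no_socle by blast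
  obtain j0 r0 where y0: "j0 \<in> J" "r0 \<in> carrier R" "y = j0 \<oplus> r0 \<otimes> x" using y memJ by blast
  define N where "N = {n \<in> A. \<forall>j\<in>J. j \<cdot> n \<in> B}"
  have N: "submodule N R M"
  proof (rule submoduleI_smult)
    show "N \<subseteq> carrier M" using cA by (auto simp: N_def)
    show "\<zero>\<^bsub>M\<^esub> \<in> N" using submodule_zero_closed[OF A] submodule_zero_closed[OF B] JR by (auto simp: N_def)
    show "a \<oplus>\<^bsub>M\<^esub> c \<in> N" if "a \<in> N" "c \<in> N" for a c
      using that submoduleE(5)[OF A] submoduleE(5)[OF B] JR cA by (auto simp: N_def smult_r_distr)
    show "r \<cdot> a \<in> N" if "r \<in> carrier R" "a \<in> N" for r a
      using that submoduleE(4)[OF A] submoduleE(4)[OF B] JR cA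
      by (auto simp: N_def smult_left_commute[of _ r])
  qed
  have SN: "subquot R M N B" using N B BA submoduleE(4)[OF B] JR by (auto simp: subquot_def N_def)
  have "N = B"
  proof (rule nakayama[OF loc SN])
    fix L assume L: "subquot R M N L" "B \<subseteq> L" and mL: "\<And>x y. x \<in> \<mm> \<Longrightarrow> y \<in> N \<Longrightarrow> x \<cdot> y \<in> L"
    have sL: "submodule L R M" using L by (auto simp: subquot_def)
    have "n \<in> L" if n: "n \<in> N" for n
    proof -
      have nA: "n \<in> A" and nc: "n \<in> carrier M" using n cA by (auto simp: N_def)
      define m0 where "m0 = r0 \<cdot> n"
      have m0: "m0 \<in> A" "m0 \<in> carrier M" using nA sA y0 cA by (auto simp: m0_def)
      \<comment> \<open>The map \<open>j + rx \<mapsto> rn\<close>, multiplied by \<open>y\<close>, is multiplication by \<open>m\<^sub>0\<close>; this is its well-definedness.\<close>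
      have key: "mcong M B ((j \<oplus> r \<otimes> x) \<cdot> m0) (y \<cdot> (r \<cdot> n))"
        if j: "j \<in> J" and r: "r \<in> carrier R" for j r
      proof -
        note c = JR[OF j] JR[OF y0(1)] r y0(2) xR nc
        have eq1: "(j \<oplus> r \<otimes> x) \<cdot> m0
            = (r0 \<otimes> j) \<cdot> n \<oplus>\<^bsub>M\<^esub> (r0 \<otimes> r \<otimes> x) \<cdot> n"
          using c unfolding m0_def
          by (simp add: smult_l_distr smult_assoc1[symmetric] R.m_ac R.r_distr)
        have eq2: "y \<cdot> (r \<cdot> n)
            = (r \<otimes> j0) \<cdot> n \<oplus>\<^bsub>M\<^esub> (r0 \<otimes> r \<otimes> x) \<cdot> n"
          using c unfolding y0(3)
          by (simp add: smult_l_distr smult_assoc1[symmetric] R.m_ac R.r_distr)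
        have "(r0 \<otimes> j) \<cdot> n \<in> B" "(r \<otimes> j0) \<cdot> n \<in> B"
          using c n j y0 submoduleE(4)[OF B] by (auto simp: smult_assoc1 N_def)
        then have "mcong M B ((r0 \<otimes> j) \<cdot> n) ((r \<otimes> j0) \<cdot> n)"
          using submodule_diff_closed[OF B] by (simp add: mcong_def)
        then show ?thesis unfolding eq1 eq2
          by (intro mcong_add[OF B] mcong_refl[OF B]) (use c in auto)
      qed
      have "w \<cdot> m0 \<in> add_mult M B y A" if "w \<in> ?J" for w
      proof -
        obtain j r where w: "j \<in> J" "r \<in> carrier R" "w = j \<oplus> r \<otimes> x" using \<open>w \<in> ?J\<close> memJ by blast
        show ?thesis
          by (rule add_multI[of _ "r \<cdot> n"]) (use w key[OF w(1,2)] m0 xR JR sA nA in auto)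
      qed
      then have "m0 \<in> add_mult M B y A" using nsy m0 unfolding no_socle_def by blast
      then obtain m1 where m1: "m1 \<in> A" "mcong M B m0 (y \<cdot> m1)" by (meson add_multE)
      have m1c: "m1 \<in> carrier M" using m1 cA by blast
      \<comment> \<open>Cancelling \<open>y\<close> shows that the map is multiplication by \<open>m\<^sub>1\<close>.\<close>
      have key1: "mcong M B ((j \<oplus> r \<otimes> x) \<cdot> m1) (r \<cdot> n)"
        if j: "j \<in> J" and r: "r \<in> carrier R" for j r
      proof -
        let ?w = "j \<oplus> r \<otimes> x"
        have wR: "?w \<in> carrier R" using JR[OF j] r xR by auto
        have "mcong M B (?w \<cdot> m0) (?w \<cdot> (y \<cdot> m1))"
          by (rule mcong_smult[OF B _ _ wR m1(2)]) (use m0 m1c yR in auto)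
        then have "mcong M B (?w \<cdot> m0) (y \<cdot> (?w \<cdot> m1))"
          using smult_left_commute[OF wR yR m1c] by simp
        from mcong_trans[OF B _ _ _ mcong_sym[OF B _ _ this] key[OF j r]]
        have "mcong M B (y \<cdot> (?w \<cdot> m1)) (y \<cdot> (r \<cdot> n))"
          using wR m0 m1c yR r nc by simp
        from nzd_mod_cancel[OF B A y(2) yR _ _ this]
        show ?thesis using wR m1 nA r sA by simp
      qed
      have "m1 \<in> N" unfolding N_def
      proof (intro CollectI conjI ballI)
        fix j assume j: "j \<in> J"
        have "mcong M B (j \<cdot> m1) \<zero>\<^bsub>M\<^esub>" using key1[OF j R.zero_closed] JR[OF j] xR nc by simp
        then show "j \<cdot> m1 \<in> B" using mcong_zero_iff JR[OF j] m1c by simp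
      qed (use m1 in auto)
      then have xm: "x \<cdot> m1 \<in> L" using mL x by blast
      have "\<zero> \<in> J" using additive_subgroup.zero_closed[OF ideal.axioms(1)[OF J]] .
      from key1[OF this R.one_closed] have "mcong M B (x \<cdot> m1) n" using xR nc by simp
      then show "n \<in> L"
        using mcong_mem[OF sL nc xm mcong_mono[OF L(2) mcong_sym[OF B _ nc]]] xR m1c by simp
    qed
    then show "L = N" using L by (auto simp: subquot_def)
  qed
  then have "no_socle M J A B" unfolding no_socle_def N_def by blast
  then have "grade_ge M J A (Suc 0) B" using grade_ge_one_iff[OF J S] by blast
  then obtain z where z: "z \<in> J" "nzd_mod M z A B" by auto
  have zR: "z \<in> carrier R" using z JR by blast
  have "grade_ge M ?J A (Suc k) (add_mult M B z A)"
    using grade_ge_nzd[OF idJ S _ z(2) Suc.prems(2)] z(1) subJ by blast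
  then have "grade_ge M J A k (add_mult M B z A)"
    using Suc.IH[OF subquot_add_mult(1)[OF S zR]] by blast
  then show ?case using z by auto
qed simp

text \<open>The inequality \<open>grade(J,M) \<ge> depth M - dim R/J\<close>, with the dimension bound stated as a bound on chains
of primes above \<open>J\<close>. It suffices to treat a prime \<open>p\<close> above \<open>J\<close>. If \<open>p \<noteq> \<mm>\<close>, adjoin some \<open>x \<in> \<mm> - p\<close>: the
dimension drops, as \<open>p\<close> can be put below every chain of primes above \<open>p + Rx\<close>, and the grade grows by at most
one.\<close>

lemma grade_ge_of_dim_le:
  assumes loc: "local_ring R \<mm>" and S: "subquot R M A B"
  shows "ideal J R \<Longrightarrow>
    (\<And>n p. (\<forall>i\<le>n. primeideal (p i) R \<and> J \<subseteq> p i) \<Longrightarrow> (\<forall>i<n. p i \<subset> p (Suc i)) \<Longrightarrow> n \<le> t) \<Longrightarrow>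
    grade_ge M \<mm> A (k + t) B \<Longrightarrow> grade_ge M J A k B"
proof (induction t arbitrary: J k)
  note [simp del] = grade_ge.simps
  have max: "maximalideal \<mm> R" using loc by (simp add: local_ring_def)
  have mprime: "primeideal \<mm> R" using R.maximalideal_prime[OF max] .
  have pm: "p \<subseteq> \<mm>" if "primeideal p R" for p
    using local_ring_proper_ideal[OF noetherian_ring loc primeideal.axioms(1)[OF that]]
      primeideal.I_notcarr[OF that] by blast
  {
    case 0
    show ?case
    proof (rule grade_ge_of_primes[OF 0(1) S])
      fix p assume p: "primeideal p R" "J \<subseteq> p"
      have "p = \<mm>"
      proof (rule ccontr)
        assume "p \<noteq> \<mm>"
        then have "p \<subset> \<mm>" using pm p by blast
        then have "1 \<le> (0::nat)"
          using 0(2)[of 1 "\<lambda>i. if i = 0 then p else \<mm>"] p mprime by fastforce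
        then show False by simp
      qed
      then show "grade_ge M p A k B" using 0(3) by simp
    qed
  next
    case (Suc t)
    show ?case
    proof (rule grade_ge_of_primes[OF Suc.prems(1) S])
      fix p assume p: "primeideal p R" "J \<subseteq> p"
      show "grade_ge M p A k B"
      proof (cases "p = \<mm>")
        case True
        then show ?thesis using grade_ge_antimono[OF _ Suc.prems(3), of k] by simp
      next
        case False
        then obtain x where x: "x \<in> \<mm>" "x \<notin> p" using pm p by blast
        have xR: "x \<in> carrier R" using ideal.Icarr[OF primeideal.axioms(1)[OF mprime] x(1)] .
        have idp: "ideal p R" using p primeideal.axioms(1) by blast
        let ?J = "p <+>\<^bsub>R\<^esub> PIdl x"
        have idJ: "ideal ?J R" using R.add_ideals[OF idp R.cgenideal_ideal[OF xR]] .
        have "p \<subseteq> ?J" "x \<in> ?J"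
        proof -
          have z: "\<zero> \<in> p" "\<zero> \<in> PIdl x" "x \<in> PIdl x"
            using additive_subgroup.zero_closed[OF ideal.axioms(1)] idp R.cgenideal_ideal[OF xR]
              R.cgenideal_self[OF xR] by auto
          show "p \<subseteq> ?J"
          proof
            fix u assume u: "u \<in> p"
            then have "u = u \<oplus> \<zero>" using ideal.Icarr[OF idp] by simp
            then show "u \<in> ?J" using u z unfolding set_add_def' by blast
          qed
          have "x = \<zero> \<oplus> x" using xR by simp
          then show "x \<in> ?J" using z unfolding set_add_def' by blast
        qed
        have "grade_ge M ?J A (Suc k) B"
        proof (rule Suc.IH[OF idJ])
          show "grade_ge M \<mm> A (Suc k + t) B" using Suc.prems(3) by simp
          fix n q assume q: "\<forall>i\<le>n. primeideal (q i) R \<and> ?J \<subseteq> q i" "\<forall>i<n. q i \<subset> q (Suc i)"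
          have "Suc n \<le> Suc t"
          proof (rule Suc.prems(2))
            show "\<forall>i\<le>Suc n. primeideal (case_nat p q i) R \<and> J \<subseteq> case_nat p q i"
              using q(1) p \<open>p \<subseteq> ?J\<close> by (auto split: nat.split)
            have "p \<subset> q 0" using q(1) \<open>p \<subseteq> ?J\<close> \<open>x \<in> ?J\<close> x by blast
            then show "\<forall>i<Suc n. case_nat p q i \<subset> case_nat p q (Suc i)"
              using q(2) by (auto split: nat.split)
          qed
          then show "n \<le> t" by simp
        qed
        then show ?thesis using grade_ge_add_element[OF idp loc x(1) S] by blast
      qed
    qed
  }
qed

end

section \<open>Quotient modules and depth\<close>

context module begin

lemma mem_coset_iff:
  assumes "submodule B R M" "a \<in> carrier M"
  shows "u \<in> B +>\<^bsub>M\<^esub> a \<longleftrightarrow> u \<in> carrier M \<and> mcong M B u a"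
proof
  assume "u \<in> B +>\<^bsub>M\<^esub> a"
  then obtain h where h: "h \<in> B" "u = h \<oplus>\<^bsub>M\<^esub> a" by (auto simp: a_r_coset_def')
  then have "u \<ominus>\<^bsub>M\<^esub> a = h"
    using submodule_carrier[OF assms(1)] assms by (simp add: a_minus_def M.a_assoc M.r_neg)
  then show "u \<in> carrier M \<and> mcong M B u a"
    using h submodule_carrier[OF assms(1)] assms by (simp add: mcong_def)
next
  assume u: "u \<in> carrier M \<and> mcong M B u a"
  then have "u = (u \<ominus>\<^bsub>M\<^esub> a) \<oplus>\<^bsub>M\<^esub> a"
    using assms by (simp add: a_minus_def M.a_assoc M.l_neg)
  then show "u \<in> B +>\<^bsub>M\<^esub> a" using u unfolding mcong_def a_r_coset_def' by blast
qed

lemma coset_eq_iff: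
  assumes B: "submodule B R M" and ac: "a \<in> carrier M" "c \<in> carrier M"
  shows "B +>\<^bsub>M\<^esub> a = B +>\<^bsub>M\<^esub> c \<longleftrightarrow> mcong M B a c"
proof
  assume "B +>\<^bsub>M\<^esub> a = B +>\<^bsub>M\<^esub> c"
  then show "mcong M B a c"
    using mem_coset_iff[OF B ac(1), of a] mem_coset_iff[OF B ac(2), of a] mcong_refl[OF B ac(1)] ac by simp
next
  assume "mcong M B a c"
  then show "B +>\<^bsub>M\<^esub> a = B +>\<^bsub>M\<^esub> c"
    using mem_coset_iff[OF B ac(1)] mem_coset_iff[OF B ac(2)] mcong_trans[OF B _ ac]
      mcong_trans[OF B _ ac(2,1)] mcong_sym[OF B ac] by blast
qed

context
  fixes A B Q
  assumes S: "subquot R M A B"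
  defines "Q \<equiv> quot_module R (M\<lparr>carrier := A\<rparr>) B"
begin

lemma quot_coset_simps:
  shows "carrier Q = (\<lambda>a. B +>\<^bsub>M\<^esub> a) ` A"
    and "\<And>a c. a \<in> A \<Longrightarrow> c \<in> A \<Longrightarrow> (B +>\<^bsub>M\<^esub> a) \<oplus>\<^bsub>Q\<^esub> (B +>\<^bsub>M\<^esub> c) = B +>\<^bsub>M\<^esub> (a \<oplus>\<^bsub>M\<^esub> c)"
    and "\<And>r a. r \<in> carrier R \<Longrightarrow> a \<in> A \<Longrightarrow> r \<odot>\<^bsub>Q\<^esub> (B +>\<^bsub>M\<^esub> a) = B +>\<^bsub>M\<^esub> (r \<odot>\<^bsub>M\<^esub> a)"
    and "\<zero>\<^bsub>Q\<^esub> = B +>\<^bsub>M\<^esub> \<zero>\<^bsub>M\<^esub>" and "\<zero>\<^bsub>Q\<^esub> = B"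
proof -
  have A: "submodule A R M" and B: "submodule B R M" and BA: "B \<subseteq> A" using S by (auto simp: subquot_def)
  note cA = submodule_carrier[OF A] and cB = submodule_carrier[OF B]
  show "carrier Q = (\<lambda>a. B +>\<^bsub>M\<^esub> a) ` A"
    unfolding Q_def quot_module_def A_RCOSETS_def' a_r_coset_def' by auto
  show "(B +>\<^bsub>M\<^esub> a) \<oplus>\<^bsub>Q\<^esub> (B +>\<^bsub>M\<^esub> c) = B +>\<^bsub>M\<^esub> (a \<oplus>\<^bsub>M\<^esub> c)" if ac: "a \<in> A" "c \<in> A" for a c
  proof -
    have c: "a \<in> carrier M" "c \<in> carrier M" "a \<oplus>\<^bsub>M\<^esub> c \<in> carrier M" using ac cA by auto
    have "(B +>\<^bsub>M\<^esub> a) \<oplus>\<^bsub>Q\<^esub> (B +>\<^bsub>M\<^esub> c) = (B +>\<^bsub>M\<^esub> a) <+>\<^bsub>M\<^esub> (B +>\<^bsub>M\<^esub> c)"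
      unfolding Q_def quot_module_def set_add_def' by simp
    also have "\<dots> = B +>\<^bsub>M\<^esub> (a \<oplus>\<^bsub>M\<^esub> c)"
    proof (intro equalityI subsetI)
      fix u assume "u \<in> (B +>\<^bsub>M\<^esub> a) <+>\<^bsub>M\<^esub> (B +>\<^bsub>M\<^esub> c)"
      then obtain v w where "v \<in> B +>\<^bsub>M\<^esub> a" "w \<in> B +>\<^bsub>M\<^esub> c" "u = v \<oplus>\<^bsub>M\<^esub> w"
        unfolding set_add_def' by blast
      then show "u \<in> B +>\<^bsub>M\<^esub> (a \<oplus>\<^bsub>M\<^esub> c)"
        using mem_coset_iff[OF B] mcong_add[OF B] c by simp
    next
      fix u assume "u \<in> B +>\<^bsub>M\<^esub> (a \<oplus>\<^bsub>M\<^esub> c)"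
      then have u: "u \<in> carrier M" "mcong M B u (a \<oplus>\<^bsub>M\<^esub> c)" using mem_coset_iff[OF B c(3)] by auto
      have "(u \<ominus>\<^bsub>M\<^esub> c) \<ominus>\<^bsub>M\<^esub> a = u \<ominus>\<^bsub>M\<^esub> (a \<oplus>\<^bsub>M\<^esub> c)"
        using u c by (simp add: a_minus_def M.minus_add M.a_ac)
      then have "u \<ominus>\<^bsub>M\<^esub> c \<in> B +>\<^bsub>M\<^esub> a" using u c mem_coset_iff[OF B c(1)] by (simp add: mcong_def)
      moreover have "c \<in> B +>\<^bsub>M\<^esub> c" using mem_coset_iff[OF B c(2)] mcong_refl[OF B] c by simp
      moreover have "u = (u \<ominus>\<^bsub>M\<^esub> c) \<oplus>\<^bsub>M\<^esub> c" using u c by (simp add: a_minus_def M.a_assoc M.l_neg)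
      ultimately show "u \<in> (B +>\<^bsub>M\<^esub> a) <+>\<^bsub>M\<^esub> (B +>\<^bsub>M\<^esub> c)" unfolding set_add_def' by blast
    qed
    finally show ?thesis .
  qed
  show "r \<odot>\<^bsub>Q\<^esub> (B +>\<^bsub>M\<^esub> a) = B +>\<^bsub>M\<^esub> (r \<odot>\<^bsub>M\<^esub> a)" if r: "r \<in> carrier R" and a: "a \<in> A" for r a
  proof -
    have c: "a \<in> carrier M" using a cA by auto
    have "r \<odot>\<^bsub>Q\<^esub> (B +>\<^bsub>M\<^esub> a) = (\<Union>x\<in>B +>\<^bsub>M\<^esub> a. B +>\<^bsub>M\<^esub> (r \<odot>\<^bsub>M\<^esub> x))"
      unfolding Q_def quot_module_def a_r_coset_def' by simp
    also have "\<dots> = (\<Union>x\<in>B +>\<^bsub>M\<^esub> a. B +>\<^bsub>M\<^esub> (r \<odot>\<^bsub>M\<^esub> a))"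
    proof (rule SUP_cong[OF refl])
      fix x assume "x \<in> B +>\<^bsub>M\<^esub> a"
      then have "x \<in> carrier M" "mcong M B x a" using mem_coset_iff[OF B c] by auto
      then show "B +>\<^bsub>M\<^esub> (r \<odot>\<^bsub>M\<^esub> x) = B +>\<^bsub>M\<^esub> (r \<odot>\<^bsub>M\<^esub> a)"
        using coset_eq_iff[OF B] mcong_smult[OF B] r c by simp
    qed
    also have "\<dots> = B +>\<^bsub>M\<^esub> (r \<odot>\<^bsub>M\<^esub> a)"
      using mem_coset_iff[OF B c, of a] mcong_refl[OF B c] c by auto
    finally show ?thesis .
  qed
  show "\<zero>\<^bsub>Q\<^esub> = B" by (simp add: Q_def quot_module_def)
  moreover have "B +>\<^bsub>M\<^esub> \<zero>\<^bsub>M\<^esub> = B"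
    using mem_coset_iff[OF B M.zero_closed] mcong_zero_iff cB by blast
  ultimately show "\<zero>\<^bsub>Q\<^esub> = B +>\<^bsub>M\<^esub> \<zero>\<^bsub>M\<^esub>" by simp
qed

lemma quot_module_module: "module R Q"
proof -
  have A: "submodule A R M" and B: "submodule B R M" and BA: "B \<subseteq> A" using S by (auto simp: subquot_def)
  note cA[simp] = submodule_carrier[OF A] and zA[simp] = submodule_zero_closed[OF A]
  note [simp] = submoduleE(3-5)[OF A] and q[simp] = quot_coset_simps(1-4)
  show ?thesis
  proof (rule moduleI)
    show "cring R" by (rule R.is_cring)
    show "abelian_group Q"
    proof (rule abelian_groupI)
      fix x assume "x \<in> carrier Q"
      then obtain a where a: "a \<in> A" "x = B +>\<^bsub>M\<^esub> a" by auto
      show "\<exists>y\<in>carrier Q. y \<oplus>\<^bsub>Q\<^esub> x = \<zero>\<^bsub>Q\<^esub>"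
        by (rule bexI[of _ "B +>\<^bsub>M\<^esub> (\<ominus>\<^bsub>M\<^esub> a)"]) (use a in \<open>simp_all add: M.l_neg del: quot_coset_simps(5)\<close>)
    qed (auto simp: M.a_ac)
  qed (auto simp: smult_l_distr smult_r_distr smult_assoc1)
qed

lemma grade_ge_quot_module:
  assumes J: "J \<subseteq> carrier R"
  shows "grade_ge Q J (carrier Q) k {\<zero>\<^bsub>Q\<^esub>} \<longleftrightarrow> grade_ge M J A k B"
proof -
  interpret Q: module R Q by (rule quot_module_module)
  have A: "submodule A R M" and B: "submodule B R M" and BA: "B \<subseteq> A" using S by (auto simp: subquot_def)
  note cA = submodule_carrier[OF A]
  have "grade_ge M J A k B \<longleftrightarrow> grade_ge Q J (carrier Q) k {\<zero>\<^bsub>Q\<^esub>}"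
  proof (rule grade_ge_iso[OF module_axioms Q.module_axioms S _ J])
    show "subquot R Q (carrier Q) {\<zero>\<^bsub>Q\<^esub>}"
      using Q.carrier_is_submodule Q.zero_submodule by (auto simp: subquot_def)
    fix a assume a: "a \<in> A"
    show "B +>\<^bsub>M\<^esub> a \<in> carrier Q" using a quot_coset_simps(1) by blast
    show "B +>\<^bsub>M\<^esub> a \<in> {\<zero>\<^bsub>Q\<^esub>} \<longleftrightarrow> a \<in> B"
      unfolding quot_coset_simps(4) using coset_eq_iff[OF B cA[OF a] M.zero_closed] mcong_zero_iff[OF cA[OF a]]
      by simp
  next
    fix x assume x: "x \<in> carrier Q"
    then obtain a where "a \<in> A" "x = B +>\<^bsub>M\<^esub> a" using quot_coset_simps(1) by blast
    then show "\<exists>a\<in>A. mcong Q {\<zero>\<^bsub>Q\<^esub>} x (B +>\<^bsub>M\<^esub> a)" using Q.mcong_refl[OF Q.zero_submodule x] by blast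
  qed (simp_all add: quot_coset_simps(2,3))
  then show ?thesis by simp
qed

end

lemma submodule_set_smult:
  assumes "X \<subseteq> carrier R"
  shows "submodule (set_smult R X M) R M"
proof -
  let ?F = "{N. submodule N R M \<and> (\<forall>x\<in>X. \<forall>y\<in>carrier M. x \<odot>\<^bsub>M\<^esub> y \<in> N)}"
  have "carrier M \<in> ?F" using carrier_is_submodule assms by blast
  then have c: "u \<in> carrier M" if "u \<in> set_smult R X M" for u
    using that unfolding set_smult_def by blast
  have mem: "u \<in> set_smult R X M \<longleftrightarrow> (\<forall>N\<in>?F. u \<in> N)" for u unfolding set_smult_def by blast
  show ?thesis
  proof (rule submoduleI_smult)
    show "set_smult R X M \<subseteq> carrier M" using c by blast
    show "\<zero>\<^bsub>M\<^esub> \<in> set_smult R X M" unfolding mem using submodule_zero_closed by blast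
    show "a \<oplus>\<^bsub>M\<^esub> b \<in> set_smult R X M" if "a \<in> set_smult R X M" "b \<in> set_smult R X M" for a b
      using that unfolding mem using submoduleE(5) by blast
    show "r \<odot>\<^bsub>M\<^esub> a \<in> set_smult R X M" if "r \<in> carrier R" "a \<in> set_smult R X M" for r a
      using that unfolding mem using submoduleE(4) by blast
  qed
qed

lemma set_smult_mem: "x \<in> X \<Longrightarrow> y \<in> carrier M \<Longrightarrow> x \<odot>\<^bsub>M\<^esub> y \<in> set_smult R X M"
  unfolding set_smult_def by blast

lemma set_smult_least:
  "submodule N R M \<Longrightarrow> (\<And>x y. x \<in> X \<Longrightarrow> y \<in> carrier M \<Longrightarrow> x \<odot>\<^bsub>M\<^esub> y \<in> N) \<Longrightarrow> set_smult R X M \<subseteq> N"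
  unfolding set_smult_def by blast

lemma set_smult_mono: "X \<subseteq> Y \<Longrightarrow> set_smult R X M \<subseteq> set_smult R Y M"
  unfolding set_smult_def by blast

lemma set_smult_empty: "set_smult R {} M = {\<zero>\<^bsub>M\<^esub>}"
  using set_smult_least[OF zero_submodule, of "{}"] submodule_zero_closed[OF submodule_set_smult[of "{}"]]
  by auto

lemma set_smult_insert:
  assumes "x \<in> carrier R" "X \<subseteq> carrier R"
  shows "set_smult R (insert x X) M = add_mult M (set_smult R X M) x (carrier M)"
proof -
  have sX: "submodule (set_smult R X M) R M" using submodule_set_smult assms by blast
  then have S: "subquot R M (carrier M) (set_smult R X M)"
    using carrier_is_submodule submoduleE(1) by (auto simp: subquot_def)
  have sxX: "submodule (set_smult R (insert x X) M) R M" using submodule_set_smult assms by blast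
  show ?thesis
  proof
    show "set_smult R (insert x X) M \<subseteq> add_mult M (set_smult R X M) x (carrier M)"
      by (rule set_smult_least)
        (use subquot_add_mult[OF S assms(1)] set_smult_mem[of _ X] in \<open>auto simp: subquot_def\<close>)
    show "add_mult M (set_smult R X M) x (carrier M) \<subseteq> set_smult R (insert x X) M"
    proof
      fix u assume "u \<in> add_mult M (set_smult R X M) x (carrier M)"
      then obtain a where a: "u \<in> carrier M" "a \<in> carrier M" "mcong M (set_smult R X M) u (x \<odot>\<^bsub>M\<^esub> a)"
        by (rule add_multE)
      show "u \<in> set_smult R (insert x X) M"
        by (rule mcong_mem[OF sxX a(1) set_smult_mem[of x] mcong_mono[OF set_smult_mono a(3)]]) (use a in auto)
    qed
  qed
qed

text \<open>The regular sequence is built from the front, so the statement for the induction carries the list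
\<open>ys\<close> of elements that are already divided out.\<close>

lemma grade_ge_imp_grade:
  assumes J: "J \<subseteq> carrier R" and g: "grade_ge M J (carrier M) k {\<zero>\<^bsub>M\<^esub>}"
  shows "ereal (real k) \<le> grade R J M"
proof -
  have *: "\<exists>zs. length zs = k \<and> set zs \<subseteq> J \<and>
      (\<forall>i<k. nzd_mod M (zs ! i) (carrier M) (set_smult R (set (ys @ take i zs)) M))"
    if "set ys \<subseteq> J" "grade_ge M J (carrier M) k (set_smult R (set ys) M)" for ys
    using that
  proof (induction k arbitrary: ys)
    case (Suc k)
    obtain x where x: "x \<in> J" "nzd_mod M x (carrier M) (set_smult R (set ys) M)"
      "grade_ge M J (carrier M) k (add_mult M (set_smult R (set ys) M) x (carrier M))"
      using Suc.prems(2) unfolding grade_ge.simps by blast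
    have xR: "x \<in> carrier R" "set ys \<subseteq> carrier R" using x Suc.prems J by auto
    have 1: "set (ys @ [x]) \<subseteq> J" using Suc.prems(1) x(1) by simp
    have 2: "grade_ge M J (carrier M) k (set_smult R (set (ys @ [x])) M)"
      using x(3) set_smult_insert[OF xR] by simp
    from Suc.IH[OF 1 2] obtain zs where zs: "length zs = k" "set zs \<subseteq> J"
      "\<forall>i<k. nzd_mod M (zs ! i) (carrier M) (set_smult R (set ((ys @ [x]) @ take i zs)) M)"
      by blast
    show ?case
    proof (intro exI[of _ "x # zs"] conjI allI impI)
      fix i assume "i < Suc k"
      then show "nzd_mod M ((x # zs) ! i) (carrier M) (set_smult R (set (ys @ take i (x # zs))) M)"
        using x(2) zs(3) by (cases i) auto
    qed (use x zs in auto)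
  qed simp
  obtain zs where zs: "length zs = k" "set zs \<subseteq> J"
    "\<forall>i<k. nzd_mod M (zs ! i) (carrier M) (set_smult R (set (take i zs)) M)"
    using *[of "[]", unfolded list.set(1) set_smult_empty append_Nil, OF empty_subsetI g] by blast
  show ?thesis
  proof (cases "set_smult R J M = carrier M")
    case False
    have "set_smult R (set zs) M \<noteq> carrier M"
    proof
      assume "set_smult R (set zs) M = carrier M"
      then have "carrier M \<subseteq> set_smult R J M" using set_smult_mono[OF zs(2)] by simp
      then show False using False submoduleE(1)[OF submodule_set_smult[OF J]] by blast
    qed
    then have "regular_sequence R M zs"
      using zs J unfolding regular_sequence_def nzd_mod_def by auto
    then have "ereal (real k) \<in> {ereal (real (length xs)) | xs. set xs \<subseteq> J \<and> regular_sequence R M xs}"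
      using zs by blast
    then show ?thesis unfolding grade_def using False by (simp add: Sup_upper)
  qed (simp add: grade_def)
qed

lemma grade_imp_grade_ge:
  assumes J: "J \<subseteq> carrier R" and g: "ereal (real k) \<le> grade R J M"
    and triv: "set_smult R J M = carrier M \<Longrightarrow> grade_ge M J (carrier M) k {\<zero>\<^bsub>M\<^esub>}"
  shows "grade_ge M J (carrier M) k {\<zero>\<^bsub>M\<^esub>}"
proof (cases "set_smult R J M = carrier M")
  case False
  have "\<exists>xs. set xs \<subseteq> J \<and> regular_sequence R M xs \<and> k \<le> length xs"
  proof (rule ccontr)
    assume no: "\<not> ?thesis"
    show False
    proof (cases k)
      case 0
      have "{\<zero>\<^bsub>M\<^esub>} \<noteq> carrier M"
      proof
        assume "{\<zero>\<^bsub>M\<^esub>} = carrier M"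
        then have "carrier M \<subseteq> set_smult R J M"
          using submodule_zero_closed[OF submodule_set_smult[OF J]] by (metis empty_subsetI insert_subset)
        then show False using False submoduleE(1)[OF submodule_set_smult[OF J]] by blast
      qed
      then have "regular_sequence R M []" by (simp add: regular_sequence_def set_smult_empty)
      then have "set [] \<subseteq> J \<and> regular_sequence R M [] \<and> k \<le> length []" using 0 by simp
      then show False using no by blast
    next
      case (Suc l)
      have "grade R J M \<le> ereal (real l)"
        unfolding grade_def using False no Suc by (auto intro!: Sup_least)
      then have "ereal (real k) \<le> ereal (real l)" using g by (rule order_trans[rotated])
      then show False using Suc by simp
    qed
  qed
  then obtain xs where xs: "set xs \<subseteq> J" "regular_sequence R M xs" "k \<le> length xs" by blast
  have "grade_ge M J (carrier M) l (set_smult R (set (take (length xs - l) xs)) M)"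
    if "l \<le> length xs" for l
    using that
  proof (induction l)
    case (Suc l)
    define n where "n = length xs - Suc l"
    have n: "n < length xs" "length xs - l = Suc n" using Suc.prems by (auto simp: n_def)
    have x: "xs ! n \<in> J" "xs ! n \<in> carrier R" "set (take n xs) \<subseteq> carrier R"
      using n(1) xs(1) J nth_mem[OF n(1)] set_take_subset[of n xs] by blast+
    have "set (take (Suc n) xs) = insert (xs ! n) (set (take n xs))"
      using n by (simp add: take_Suc_conv_app_nth)
    then have "grade_ge M J (carrier M) l (add_mult M (set_smult R (set (take n xs)) M) (xs ! n) (carrier M))"
      using Suc.IH Suc.prems n(2) set_smult_insert[OF x(2,3)] by simp
    moreover have "nzd_mod M (xs ! n) (carrier M) (set_smult R (set (take n xs)) M)"
      using xs(2) n(1) unfolding regular_sequence_def nzd_mod_def by blast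
    ultimately show ?case unfolding grade_ge.simps n_def[symmetric] using x(1) by blast
  qed simp
  from this[of "length xs"] have "grade_ge M J (carrier M) (length xs) {\<zero>\<^bsub>M\<^esub>}" by (simp add: set_smult_empty)
  then show ?thesis using grade_ge_antimono xs(3) by blast
qed (use triv in simp)

end

text \<open>If \<open>\<mm>(A/B) = A/B\<close>, the depth is infinite by convention; then \<open>A/B = 0\<close> by Nakayama's lemma, and zero
modules have every grade.\<close>

lemma (in noetherian_module) depth_quot_imp_grade_ge:
  fixes A B
  defines "Q \<equiv> quot_module R (M\<lparr>carrier := A\<rparr>) B"
  assumes loc: "local_ring R \<mm>" and S: "subquot R M A B" and d: "ereal (real k) \<le> depth R \<mm> Q"
  shows "grade_ge M \<mm> A k B"
proof -
  interpret Q: module R Q unfolding Q_def by (rule quot_module_module[OF S])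
  note q = quot_coset_simps[OF S, folded Q_def]
  have A: "submodule A R M" and B: "submodule B R M" and BA: "B \<subseteq> A" using S by (auto simp: subquot_def)
  note cA = submodule_carrier[OF A]
  have m: "ideal \<mm> R" using local_ring_maximal_proper[OF loc] by blast
  have mR: "\<mm> \<subseteq> carrier R" using ideal.Icarr[OF m] by blast
  have "grade_ge Q \<mm> (carrier Q) k {\<zero>\<^bsub>Q\<^esub>}"
  proof (rule Q.grade_imp_grade_ge[OF mR])
    show "ereal (real k) \<le> grade R \<mm> Q" using d by (simp add: depth_def)
    assume eq: "set_smult R \<mm> Q = carrier Q"
    have "A = B"
    proof (rule nakayama[OF loc S])
      fix L assume L: "subquot R M A L" "B \<subseteq> L"
        and mL: "\<And>x y. x \<in> \<mm> \<Longrightarrow> y \<in> A \<Longrightarrow> x \<odot>\<^bsub>M\<^esub> y \<in> L"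
      have sL: "submodule L R M" and LA: "L \<subseteq> A" using L by (auto simp: subquot_def)
      let ?L = "(\<lambda>a. B +>\<^bsub>M\<^esub> a) ` L"
      have "submodule ?L R Q"
      proof (rule submodule_image[OF module_axioms Q.module_axioms sL])
        show "B +>\<^bsub>M\<^esub> a \<in> carrier Q" if "a \<in> L" for a using q(1) that LA by blast
      qed (use q(2,3) subsetD[OF LA] in simp_all)
      then have "set_smult R \<mm> Q \<subseteq> ?L"
      proof (rule Q.set_smult_least)
        fix x y assume x: "x \<in> \<mm>" and "y \<in> carrier Q"
        then obtain a where a: "a \<in> A" "y = B +>\<^bsub>M\<^esub> a" using q(1) by blast
        then show "x \<odot>\<^bsub>Q\<^esub> y \<in> ?L" using q(3)[of x a] mL[OF x a(1)] mR x by auto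
      qed
      then have sub: "carrier Q \<subseteq> ?L" using eq by simp
      have "A \<subseteq> L"
      proof
        fix a assume a: "a \<in> A"
        then have "B +>\<^bsub>M\<^esub> a \<in> ?L" using sub q(1) by blast
        then obtain l where l: "l \<in> L" "B +>\<^bsub>M\<^esub> a = B +>\<^bsub>M\<^esub> l" by blast
        then have "mcong M B a l" using coset_eq_iff[OF B cA[OF a] cA[of l]] LA by blast
        then show "a \<in> L" using mcong_mem[OF sL cA[OF a] l(1) mcong_mono[OF L(2)]] by blast
      qed
      then show "L = A" using LA by blast
    qed
    then have "carrier Q = {\<zero>\<^bsub>Q\<^esub>}"
    proof -
      assume AB: "A = B"
      have "B +>\<^bsub>M\<^esub> a = \<zero>\<^bsub>Q\<^esub>" if "a \<in> A" for a
        unfolding q(4) using coset_eq_iff[OF B cA[OF that] M.zero_closed] mcong_zero_iff[OF cA[OF that]] that AB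
        by simp
      then show ?thesis unfolding q(1) using submodule_zero_closed[OF A] by force
    qed
    then show "grade_ge Q \<mm> (carrier Q) k {\<zero>\<^bsub>Q\<^esub>}"
      using Q.grade_ge_trivial[OF _ Q.zero_submodule, of "\<zero>\<^bsub>R\<^esub>" \<mm> k]
        additive_subgroup.zero_closed[OF ideal.axioms(1)[OF m]] by simp
  qed
  then show ?thesis using grade_ge_quot_module[OF S mR, folded Q_def] by blast
qed

lemma (in module) grade_ge_imp_depth_quot:
  assumes "subquot R M A B" "J \<subseteq> carrier R" "grade_ge M J A k B"
  shows "ereal (real k) \<le> depth R J (quot_module R (M\<lparr>carrier := A\<rparr>) B)"
  using module.grade_ge_imp_grade[OF quot_module_module[OF assms(1)] assms(2)]
    grade_ge_quot_module[OF assms(1,2)] assms(3) by (simp add: depth_def)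

section \<open>Modules of functions with prescribed support\<close>

text \<open>By Zorn's lemma: the union of a chain of submodules is finitely generated, so it belongs to the chain.\<close>

lemma (in module) noetherian_moduleI:
  assumes noeth: "noetherian_ring R"
    and fg: "\<And>N. submodule N R M \<Longrightarrow> \<exists>S\<subseteq>N. finite S \<and> (\<forall>L. submodule L R M \<and> S \<subseteq> L \<longrightarrow> N \<subseteq> L)"
  shows "noetherian_module R M"
proof (intro noetherian_module.intro noetherian_module_axioms.intro module_axioms noeth)
  fix C assume C: "C \<noteq> {}" "\<And>N. N \<in> C \<Longrightarrow> submodule N R M"
  show "\<exists>N\<in>C. \<forall>N'\<in>C. N \<subseteq> N' \<longrightarrow> N' = N"
  proof (rule subset_Zorn)
    fix D assume D: "subset.chain C D"
    then have DC: "D \<subseteq> C" and lin: "\<And>X Y. X \<in> D \<Longrightarrow> Y \<in> D \<Longrightarrow> X \<subseteq> Y \<or> Y \<subseteq> X"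
      unfolding pred_on.chain_def by auto
    show "\<exists>U\<in>C. \<forall>X\<in>D. X \<subseteq> U"
    proof (cases "D = {}")
      case False
      then obtain N0 where N0: "N0 \<in> D" by blast
      have sD: "submodule N R M" if "N \<in> D" for N using that DC C by blast
      have "submodule (\<Union>D) R M"
      proof (rule submoduleI_smult)
        show "\<Union>D \<subseteq> carrier M" using submodule_carrier[OF sD] by blast
        show "\<zero>\<^bsub>M\<^esub> \<in> \<Union>D" using N0 submodule_zero_closed[OF sD] by blast
        show "r \<odot>\<^bsub>M\<^esub> a \<in> \<Union>D" if "r \<in> carrier R" "a \<in> \<Union>D" for r a
          using that submoduleE(4)[OF sD] by blast
        show "a \<oplus>\<^bsub>M\<^esub> b \<in> \<Union>D" if ab: "a \<in> \<Union>D" "b \<in> \<Union>D" for a b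
        proof -
          obtain X Y where XY: "X \<in> D" "a \<in> X" "Y \<in> D" "b \<in> Y" using ab by blast
          then obtain Z where "Z \<in> D" "a \<in> Z" "b \<in> Z" using lin[of X Y] by blast
          then show ?thesis using submoduleE(5)[OF sD] by blast
        qed
      qed
      from fg[OF this] obtain S
        where S: "S \<subseteq> \<Union>D" "finite S" "\<forall>L. submodule L R M \<and> S \<subseteq> L \<longrightarrow> \<Union>D \<subseteq> L"
        by metis
      have "\<exists>X\<in>D. S \<subseteq> X" using S(2,1)
      proof (induction S rule: finite_induct)
        case (insert s S)
        then obtain X Y where XY: "X \<in> D" "S \<subseteq> X" "Y \<in> D" "s \<in> Y" by blast
        then show ?case using lin[of X Y] by blast
      qed (use N0 in blast)
      then obtain X where "X \<in> D" "S \<subseteq> X" by blast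
      then have "\<Union>D \<subseteq> X" using S(3)[rule_format, of X] sD[of X] by simp
      then show ?thesis using \<open>X \<in> D\<close> DC by blast
    qed (use C in blast)
  qed
qed

text \<open>All Koszul modules of lists of length at most \<open>n\<close> lie in the module of functions supported on the subsets
of \<open>{..<n}\<close>. The operations do not depend on the support, so different choices of \<open>X\<close> differ only in the carrier.\<close>

definition fun_module :: "('a, 'r) ring_scheme \<Rightarrow> 'i set \<Rightarrow> ('a, 'i \<Rightarrow> 'a) module" where
  "fun_module R X =
     \<lparr>carrier = {z. (\<forall>S. z S \<in> carrier R) \<and> (\<forall>S. S \<notin> X \<longrightarrow> z S = \<zero>\<^bsub>R\<^esub>)},
      monoid.mult = undefined, one = undefined,
      ring.zero = (\<lambda>S. \<zero>\<^bsub>R\<^esub>), add = (\<lambda>z w S. z S \<oplus>\<^bsub>R\<^esub> w S), smult = (\<lambda>r z S. r \<otimes>\<^bsub>R\<^esub> z S)\<rparr>"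

lemma fun_module_simps [simp]:
  "z \<oplus>\<^bsub>fun_module R X\<^esub> w = (\<lambda>S. z S \<oplus>\<^bsub>R\<^esub> w S)"
  "\<zero>\<^bsub>fun_module R X\<^esub> = (\<lambda>S. \<zero>\<^bsub>R\<^esub>)"
  "r \<odot>\<^bsub>fun_module R X\<^esub> z = (\<lambda>S. r \<otimes>\<^bsub>R\<^esub> z S)"
  by (simp_all add: fun_module_def)

lemma fun_module_carrier:
  "z \<in> carrier (fun_module R X) \<longleftrightarrow> (\<forall>S. z S \<in> carrier R) \<and> (\<forall>S. S \<notin> X \<longrightarrow> z S = \<zero>\<^bsub>R\<^esub>)"
  by (simp add: fun_module_def)

lemma fun_module_carrier_update:
  "(fun_module R X)\<lparr>carrier := A\<rparr> = (fun_module R Y)\<lparr>carrier := A\<rparr>"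
  by (simp add: fun_module_def)

context cring begin

lemma module_fun_module: "module R (fun_module R X)"
proof (rule moduleI)
  show "cring R" by (rule is_cring)
  show "abelian_group (fun_module R X)"
  proof (rule abelian_groupI)
    fix z assume "z \<in> carrier (fun_module R X)"
    then show "\<exists>w\<in>carrier (fun_module R X). w \<oplus>\<^bsub>fun_module R X\<^esub> z = \<zero>\<^bsub>fun_module R X\<^esub>"
      by (intro bexI[of _ "\<lambda>S. \<ominus> z S"]) (auto simp: fun_module_carrier l_neg)
  qed (auto simp: fun_module_carrier a_ac)
qed (auto simp: fun_module_carrier l_distr r_distr m_assoc)

lemma fun_module_uminus:
  assumes "z \<in> carrier (fun_module R X)"
  shows "\<ominus>\<^bsub>fun_module R X\<^esub> z = (\<lambda>S. \<ominus> z S)"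
proof -
  interpret F: module R "fun_module R X" by (rule module_fun_module)
  have "(\<lambda>S. \<ominus> z S) \<in> carrier (fun_module R X)" using assms by (auto simp: fun_module_carrier)
  moreover have "(\<lambda>S. \<ominus> z S) \<oplus>\<^bsub>fun_module R X\<^esub> z = \<zero>\<^bsub>fun_module R X\<^esub>"
    using assms by (simp add: fun_module_carrier l_neg)
  ultimately show ?thesis using F.minus_equality assms by blast
qed

lemma fun_module_minus:
  assumes "z \<in> carrier (fun_module R X)" "w \<in> carrier (fun_module R X)"
  shows "z \<ominus>\<^bsub>fun_module R X\<^esub> w = (\<lambda>S. z S \<ominus> w S)"
  using assms by (simp add: a_minus_def fun_module_uminus)

lemma fun_module_mono: "X \<subseteq> Y \<Longrightarrow> carrier (fun_module R X) \<subseteq> carrier (fun_module R Y)"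
  by (intro subsetI) (simp add: fun_module_carrier, blast)

lemma module_ring_module: "module R (ring_module R)"
proof (rule moduleI)
  show "cring R" by (rule is_cring)
  show "abelian_group (ring_module R)"
  proof (rule abelian_groupI)
    fix z assume "z \<in> carrier (ring_module R)"
    then show "\<exists>w\<in>carrier (ring_module R). w \<oplus>\<^bsub>ring_module R\<^esub> z = \<zero>\<^bsub>ring_module R\<^esub>"
      by (intro bexI[of _ "\<ominus> z"]) (auto simp: ring_module_def l_neg)
  qed (auto simp: ring_module_def a_ac)
qed (auto simp: ring_module_def l_distr r_distr m_assoc)

lemma ring_module_uminus:
  assumes "u \<in> carrier R"
  shows "\<ominus>\<^bsub>ring_module R\<^esub> u = \<ominus> u"
proof -
  interpret M: module R "ring_module R" by (rule module_ring_module)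
  show ?thesis
    by (rule M.minus_equality) (use assms in \<open>auto simp: ring_module_def l_neg\<close>)
qed

lemma ring_module_minus:
  assumes "u \<in> carrier R" "v \<in> carrier R"
  shows "u \<ominus>\<^bsub>ring_module R\<^esub> v = u \<ominus> v"
  using ring_module_uminus[OF assms(2)] by (simp add: ring_module_def a_minus_def)

lemma ring_submodule_iff: "submodule J R (ring_module R) \<longleftrightarrow> ideal J R"
proof -
  interpret M: module R "ring_module R" by (rule module_ring_module)
  show ?thesis
  proof
    assume J: "submodule J R (ring_module R)"
    note E = M.submoduleE[OF J] M.submodule_zero_closed[OF J]
    have cJ: "u \<in> carrier R" if "u \<in> J" for u using E(1) that by (auto simp: ring_module_def)
    have E3: "\<ominus> u \<in> J" if "u \<in> J" for u
      using E(3)[OF that] ring_module_uminus[OF cJ[OF that]] by simp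
    show "ideal J R"
    proof (rule idealI)
      show "ring R" by (rule ring_axioms)
      show "subgroup J (add_monoid R)"
        by (rule add.subgroupI) (use E(2,5) cJ E3 in \<open>auto simp: ring_module_def\<close>)
      show "x \<otimes> a \<in> J" if "a \<in> J" "x \<in> carrier R" for a x
        using E(4)[OF that(2,1)] by (simp add: ring_module_def)
      then show "a \<otimes> x \<in> J" if "a \<in> J" "x \<in> carrier R" for a x
        using that E(1) m_comm[of a x] by (auto simp: ring_module_def)
    qed
  next
    assume J: "ideal J R"
    interpret J: ideal J R by fact
    show "submodule J R (ring_module R)"
      by (rule M.submoduleI) (use J.I_l_closed J.a_inv_closed J.a_closed J.zero_closed J.Icarr in
        \<open>auto simp: ring_module_uminus, auto simp: ring_module_def\<close>)
  qed
qed

lemma fun_module_coordinate_ideal: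
  assumes N: "submodule N R (fun_module R Y)"
  shows "ideal ((\<lambda>z. z x) ` N) R"
proof -
  interpret F: module R "fun_module R Y" by (rule module_fun_module)
  have c: "z x \<in> carrier (ring_module R)" if "z \<in> N" for z
    using F.submodule_carrier[OF N that] by (simp add: fun_module_carrier ring_module_def)
  have "submodule ((\<lambda>z. z x) ` N) R (ring_module R)"
    by (rule submodule_image[OF module_fun_module module_ring_module N c]) (simp_all add: ring_module_def)
  then show ?thesis by (simp only: ring_submodule_iff)
qed

text \<open>Induction on the support. The values at one index \<open>x\<close> form a finitely generated ideal; lifts of its
generators, together with generators of the submodule of functions vanishing at \<open>x\<close>, generate.\<close>

lemma fun_module_finitely_generated:
  assumes noeth: "noetherian_ring R" and "finite X" "X \<subseteq> Y"
    and "submodule N R (fun_module R Y)" "N \<subseteq> carrier (fun_module R X)"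
  shows "\<exists>S\<subseteq>N. finite S \<and> (\<forall>L. submodule L R (fun_module R Y) \<and> S \<subseteq> L \<longrightarrow> N \<subseteq> L)"
  using assms(2-)
proof (induction X arbitrary: N rule: finite_induct)
  interpret F: module R "fun_module R Y" by (rule module_fun_module)
  {
    case empty
    have "z = (\<lambda>S. \<zero>)" if "z \<in> N" for z 
    proof
      have "z \<in> carrier (fun_module R {})" using empty(3) that by blast
      then show "z S = \<zero>" for S by (simp add: fun_module_carrier)
    qed
    then have "N \<subseteq> L" if "submodule L R (fun_module R Y)" for L
      using F.submodule_zero_closed[OF that] by auto
    then show ?case by blast
  next
    case (insert x X)
    interpret N: noetherian_ring R by (rule noeth)
    note E = F.submoduleE[OF insert.prems(2)]
    let ?I = "(\<lambda>z. z x) ` N"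
    obtain A where A: "A \<subseteq> carrier R" "finite A" "?I = Idl A"
      using N.finetely_gen[OF fun_module_coordinate_ideal[OF insert.prems(2)], of x] by metis
    have AI: "A \<subseteq> ?I" using genideal_self[OF A(1)] A(3) by simp
    then have "\<forall>a\<in>A. \<exists>z. z \<in> N \<and> z x = a" by auto
    then obtain g where g: "\<And>a. a \<in> A \<Longrightarrow> g a \<in> N \<and> g a x = a" by metis
    define N0 where "N0 = {z \<in> N. z x = \<zero>}"
    have NF: "z \<in> carrier (fun_module R Y)" if "z \<in> N" for z using E(1) that by blast
    have N0: "submodule N0 R (fun_module R Y)"
    proof -
      interpret M: module R "ring_module R" by (rule module_ring_module)
      have "submodule {z \<in> N. z x \<in> {\<zero>\<^bsub>ring_module R\<^esub>}} R (fun_module R Y)"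
        by (rule submodule_vimage[OF module_fun_module module_ring_module insert.prems(2) M.zero_submodule])
          (use NF in \<open>auto simp: fun_module_carrier ring_module_def\<close>)
      then show ?thesis by (simp add: N0_def ring_module_def)
    qed
    have N0X: "N0 \<subseteq> carrier (fun_module R X)"
    proof
      fix z assume z: "z \<in> N0"
      then have "z \<in> carrier (fun_module R (insert x X))" "z x = \<zero>"
        using insert.prems(3) by (auto simp: N0_def)
      then show "z \<in> carrier (fun_module R X)" by (auto simp: fun_module_carrier)
    qed
    have XY: "X \<subseteq> Y" using insert.prems(1) by blast
    obtain S0 where S0: "S0 \<subseteq> N0" "finite S0"
      "\<forall>L. submodule L R (fun_module R Y) \<and> S0 \<subseteq> L \<longrightarrow> N0 \<subseteq> L"
      using insert.IH[OF XY N0 N0X] by metis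
    have "N \<subseteq> L" if L: "submodule L R (fun_module R Y)" and SL: "S0 \<union> g ` A \<subseteq> L" for L
    proof
      fix z assume z: "z \<in> N"
      have LN: "submodule (L \<inter> N) R (fun_module R Y)"
      proof (rule F.submoduleI_smult)
        show "L \<inter> N \<subseteq> carrier (fun_module R Y)" using E(1) by blast
        show "\<zero>\<^bsub>fun_module R Y\<^esub> \<in> L \<inter> N"
          using F.submodule_zero_closed[OF L] F.submodule_zero_closed[OF insert.prems(2)] by blast
      qed (use F.submoduleE(4,5)[OF L] E(4,5) in auto)
      have "A \<subseteq> (\<lambda>z. z x) ` (L \<inter> N)"
      proof
        fix a assume "a \<in> A"
        then have "g a \<in> L \<inter> N" "a = g a x" using g[of a] SL by auto
        then show "a \<in> (\<lambda>z. z x) ` (L \<inter> N)" by blast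
      qed
      then have "?I \<subseteq> (\<lambda>z. z x) ` (L \<inter> N)"
        using genideal_minimal[OF fun_module_coordinate_ideal[OF LN]] A(3) by simp
      then obtain l where l: "l \<in> L" "l \<in> N" "l x = z x" using z by force
      have "z \<ominus>\<^bsub>fun_module R Y\<^esub> l \<in> N0"
      proof -
        have "z x \<in> carrier R" using NF[OF z] by (auto simp: fun_module_carrier)
        then have "(z \<ominus>\<^bsub>fun_module R Y\<^esub> l) x = \<zero>"
          using fun_module_minus[OF NF[OF z] NF[OF l(2)]] l(3) by (simp add: a_minus_def r_neg)
        then show ?thesis using F.submodule_diff_closed[OF insert.prems(2) z l(2)] by (simp add: N0_def)
      qed
      then have "mcong (fun_module R Y) L z l" using S0(3) L SL unfolding mcong_def by blast
      then show "z \<in> L" using F.mcong_mem[OF L NF[OF z] l(1)] by blast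
    qed
    then show ?case using S0 g A(2) by (intro exI[of _ "S0 \<union> g ` A"]) (auto simp: N0_def)
  }
qed

lemma noetherian_fun_module:
  assumes "noetherian_ring R" "finite X"
  shows "noetherian_module R (fun_module R X)"
proof -
  interpret F: module R "fun_module R X" by (rule module_fun_module)
  show ?thesis
    by (rule F.noetherian_moduleI[OF assms(1)])
      (use fun_module_finitely_generated[OF assms order_refl] F.submoduleE(1) in blast)
qed

lemma fun_submodule:
  assumes "X \<subseteq> Y" "submodule N R (fun_module R X)"
  shows "submodule N R (fun_module R Y)"
proof -
  interpret F: module R "fun_module R X" by (rule module_fun_module)
  interpret G: module R "fun_module R Y" by (rule module_fun_module)
  note E = F.submoduleE[OF assms(2)]
  show ?thesis
    by (rule G.submoduleI_smult)
      (use E(1) fun_module_mono[OF assms(1)] E(4,5) F.submodule_zero_closed[OF assms(2)] in auto)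
qed

lemma grade_ge_fun_module:
  assumes J: "J \<subseteq> carrier R" and "ideal B R" "X \<subseteq> Y"
    and "grade_ge (ring_module R) J (carrier R) k B"
  shows "grade_ge (fun_module R Y) J (carrier (fun_module R X)) k
    {z \<in> carrier (fun_module R X). \<forall>S\<in>X. z S \<in> B}"
  using assms(2,4)
proof (induction k arbitrary: B)
  case (Suc k)
  interpret M: module R "ring_module R" by (rule module_ring_module)
  interpret F: module R "fun_module R Y" by (rule module_fun_module)
  let ?F = "\<lambda>B. {z \<in> carrier (fun_module R X). \<forall>S\<in>X. z S \<in> B}"
  obtain x where x: "x \<in> J" "nzd_mod (ring_module R) x (carrier R) B"
    "grade_ge (ring_module R) J (carrier R) k (add_mult (ring_module R) B x (carrier R))"
    using Suc.prems(2) by auto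
  have xR: "x \<in> carrier R" using x J by blast
  have cR: "carrier (ring_module R) = carrier R" by (simp add: ring_module_def)
  have "subquot R (ring_module R) (carrier R) B"
    using Suc.prems(1) ring_submodule_iff M.carrier_is_submodule cR ideal.Icarr[OF Suc.prems(1)]
    by (auto simp: subquot_def)
  from M.subquot_add_mult(1)[OF this xR]
  have id: "ideal (add_mult (ring_module R) B x (carrier R)) R" by (simp add: subquot_def ring_submodule_iff)
  have FY: "z \<in> carrier (fun_module R Y)" if "z \<in> carrier (fun_module R X)" for z
    using that fun_module_mono[OF assms(3)] by blast
  have "?F (add_mult (ring_module R) B x (carrier R))
    = add_mult (fun_module R Y) (?F B) x (carrier (fun_module R X))"
  proof (intro equalityI subsetI)
    fix z assume "z \<in> ?F (add_mult (ring_module R) B x (carrier R))"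
    then have z: "z \<in> carrier (fun_module R X)"
      "\<forall>S\<in>X. \<exists>a. a \<in> carrier R \<and> z S \<ominus>\<^bsub>ring_module R\<^esub> (x \<otimes> a) \<in> B"
      by (auto simp: add_mult_def mcong_def ring_module_def)
    then obtain w where w: "\<forall>S\<in>X. w S \<in> carrier R \<and> z S \<ominus>\<^bsub>ring_module R\<^esub> (x \<otimes> w S) \<in> B" by metis
    define w' where "w' = (\<lambda>S. if S \<in> X then w S else \<zero>)"
    have w': "w' \<in> carrier (fun_module R X)" using w by (auto simp: w'_def fun_module_carrier)
    have xw: "(\<lambda>S. x \<otimes> w' S) \<in> carrier (fun_module R X)" using w' xR by (auto simp: fun_module_carrier)
    have "z \<ominus>\<^bsub>fun_module R Y\<^esub> (\<lambda>S. x \<otimes> w' S) = (\<lambda>S. z S \<ominus> x \<otimes> w' S)"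
      by (rule fun_module_minus) (use z xw FY in auto)
    moreover have "\<dots> \<in> ?F B"
      using z(1) w w' xR ring_module_minus by (auto simp: fun_module_carrier w'_def a_minus_def)
    ultimately have "mcong (fun_module R Y) (?F B) z (x \<odot>\<^bsub>fun_module R Y\<^esub> w')" by (simp add: mcong_def)
    then show "z \<in> add_mult (fun_module R Y) (?F B) x (carrier (fun_module R X))"
      using w' FY[OF z(1)] by (auto intro: F.add_multI)
  next
    fix z assume "z \<in> add_mult (fun_module R Y) (?F B) x (carrier (fun_module R X))"
    then obtain w where z: "z \<in> carrier (fun_module R Y)" and w: "w \<in> carrier (fun_module R X)"
      and m: "z \<ominus>\<^bsub>fun_module R Y\<^esub> (\<lambda>S. x \<otimes> w S) \<in> ?F B"
      unfolding add_mult_def mcong_def by auto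
    have xw: "(\<lambda>S. x \<otimes> w S) \<in> carrier (fun_module R Y)" using FY[OF w] xR by (auto simp: fun_module_carrier)
    from m have m: "(\<lambda>S. z S \<ominus> x \<otimes> w S) \<in> ?F B" by (simp add: fun_module_minus[OF z xw])
    have "z S = \<zero>" if "S \<notin> X" for S
    proof -
      have "z S \<ominus> x \<otimes> w S = \<zero>" "w S = \<zero>" "z S \<in> carrier R" using m that w z by (auto simp: fun_module_carrier)
      then show ?thesis using xR by (simp add: a_minus_def)
    qed
    then have zX: "z \<in> carrier (fun_module R X)" using z by (auto simp: fun_module_carrier)
    moreover have "z S \<in> add_mult (ring_module R) B x (carrier R)" if "S \<in> X" for S
      unfolding add_mult_def mcong_def
    proof (intro CollectI conjI bexI[of _ "w S"])
      show "z S \<in> carrier (ring_module R)" "w S \<in> carrier R" using z w cR by (auto simp: fun_module_carrier)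
      then show "z S \<ominus>\<^bsub>ring_module R\<^esub> x \<odot>\<^bsub>ring_module R\<^esub> w S \<in> B"
        using ring_module_minus m that xR by (auto simp: ring_module_def)
    qed
    ultimately show "z \<in> ?F (add_mult (ring_module R) B x (carrier R))" by blast
  qed
  then have "grade_ge (fun_module R Y) J (carrier (fun_module R X)) k
    (add_mult (fun_module R Y) (?F B) x (carrier (fun_module R X)))"
    using Suc.IH[OF id x(3)] by simp
  moreover have "nzd_mod (fun_module R Y) x (carrier (fun_module R X)) (?F B)"
    using x(2) unfolding nzd_mod_def by (auto simp: fun_module_carrier ring_module_def)
  ultimately show ?case using x(1) by auto
qed simp

lemma grade_ge_fun_module_zero:
  assumes "J \<subseteq> carrier R" "X \<subseteq> Y" "grade_ge (ring_module R) J (carrier R) k {\<zero>}"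
  shows "grade_ge (fun_module R Y) J (carrier (fun_module R X)) k {\<lambda>S. \<zero>}"
proof -
  have "{z \<in> carrier (fun_module R X). \<forall>S\<in>X. z S \<in> {\<zero>}} = {\<lambda>S. \<zero>}"
    by (auto simp: fun_module_carrier)
  then show ?thesis using grade_ge_fun_module[OF assms(1) zeroideal assms(2,3)] by simp
qed

end

section \<open>The Koszul complex as a mapping cone\<close>

text \<open>For the list \<open>b # as\<close> the index \<open>0\<close> belongs to \<open>b\<close>, and the index \<open>Suc j\<close> to \<open>as ! j\<close>. The basis elements
\<open>e\<^sub>T\<close> with \<open>0 \<notin> T\<close> span a copy of the Koszul complex of \<open>as\<close>, and those with \<open>0 \<in> T\<close> a copy shifted by one
degree. The next three functions pass between an element and its pair of components.\<close>

definition cone_fst :: "(nat set \<Rightarrow> 'a) \<Rightarrow> nat set \<Rightarrow> 'a" where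
  "cone_fst z = (\<lambda>S. z (Suc ` S))"

definition cone_snd :: "(nat set \<Rightarrow> 'a) \<Rightarrow> nat set \<Rightarrow> 'a" where
  "cone_snd z = (\<lambda>S. z (insert 0 (Suc ` S)))"

definition cone :: "(nat set \<Rightarrow> 'a) \<Rightarrow> (nat set \<Rightarrow> 'a) \<Rightarrow> nat set \<Rightarrow> 'a" where
  "cone x y = (\<lambda>T. if 0 \<in> T then y (Suc -` T) else x (Suc -` T))"

lemma cone_simps [simp]: "cone_fst (cone x y) = x" "cone_snd (cone x y) = y"
proof -
  have "Suc -` (Suc ` S) = S" "Suc -` (insert 0 (Suc ` S)) = S" for S by auto
  then show "cone_fst (cone x y) = x" "cone_snd (cone x y) = y"
    by (simp_all add: cone_fst_def cone_snd_def cone_def)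
qed

lemma nat_set_cases:
  obtains S where "T = Suc ` S" | S where "T = insert 0 (Suc ` S)"
proof (cases "0 \<in> T")
  case True
  have "T = insert 0 (Suc ` (Suc -` T))"
  proof (intro equalityI subsetI)
    fix t assume "t \<in> T"
    then show "t \<in> insert 0 (Suc ` (Suc -` T))" by (cases t) auto
  qed (use True in auto)
  then show ?thesis using that by blast
next
  case False
  have "T = Suc ` (Suc -` T)"
  proof (intro equalityI subsetI)
    fix t assume "t \<in> T"
    then show "t \<in> Suc ` (Suc -` T)" using False by (cases t) auto
  qed auto
  then show ?thesis using that by blast
qed

lemma cone_eqI:
  assumes "cone_fst z = cone_fst w" "cone_snd z = cone_snd w"
  shows "z = w"
proof
  fix T
  show "z T = w T"
    using assms unfolding cone_fst_def cone_snd_def by (cases T rule: nat_set_cases) metis+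
qed

abbreviation subsets_of_card :: "nat \<Rightarrow> nat \<Rightarrow> nat set set" where
  "subsets_of_card n i \<equiv> {S. S \<subseteq> {..<n} \<and> card S = i}"

lemma koszul_module_eq: "koszul_module R fs i = fun_module R (subsets_of_card (length fs) i)"
  by (simp add: koszul_module_def fun_module_def)

context cring begin

abbreviation K :: "'a list \<Rightarrow> nat \<Rightarrow> (nat set \<Rightarrow> 'a) set" where
  "K fs i \<equiv> carrier (koszul_module R fs i)"

abbreviation V :: "(nat set \<Rightarrow> 'a) set" where
  "V \<equiv> {z. \<forall>S. z S \<in> carrier R}"

lemma koszul_carrier:
  "z \<in> K fs i \<longleftrightarrow> z \<in> V \<and> (\<forall>S. \<not> (S \<subseteq> {..<length fs} \<and> card S = i) \<longrightarrow> z S = \<zero>)"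
  by (simp add: koszul_module_eq fun_module_carrier)

lemma koszul_carrier_V: "z \<in> K fs i \<Longrightarrow> z \<in> V"
  by (simp add: koszul_carrier)

lemma koszul_diff_V:
  assumes "set fs \<subseteq> carrier R" "z \<in> V"
  shows "koszul_diff R fs z \<in> V"
proof -
  have "fs ! j \<in> carrier R" if "j < length fs" for j using that assms(1) nth_mem by blast
  then show ?thesis using assms(2) unfolding koszul_diff_def by (auto intro!: finsum_closed)
qed

lemma koszul_diff_add:
  assumes fs: "set fs \<subseteq> carrier R" and "z \<in> V" "w \<in> V"
  shows "koszul_diff R fs (\<lambda>S. z S \<oplus> w S) = (\<lambda>S. koszul_diff R fs z S \<oplus> koszul_diff R fs w S)"
proof
  fix T
  have f: "fs ! j \<in> carrier R" if "j < length fs" for j using that fs nth_mem by blast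
  let ?e = "\<lambda>j. (\<ominus> \<one>) [^] card {t \<in> T. t < j} \<otimes> fs ! j"
  have "koszul_diff R fs (\<lambda>S. z S \<oplus> w S) T =
      (\<Oplus>j\<in>{..<length fs} - T. ?e j \<otimes> z (insert j T) \<oplus> ?e j \<otimes> w (insert j T))"
    unfolding koszul_diff_def by (rule finsum_cong') (use assms f in \<open>auto simp: r_distr\<close>)
  also have "\<dots> = koszul_diff R fs z T \<oplus> koszul_diff R fs w T"
    unfolding koszul_diff_def by (rule finsum_addf) (use assms f in auto)
  finally show "koszul_diff R fs (\<lambda>S. z S \<oplus> w S) T = koszul_diff R fs z T \<oplus> koszul_diff R fs w T" .
qed

lemma koszul_diff_smult:
  assumes fs: "set fs \<subseteq> carrier R" and "z \<in> V" "r \<in> carrier R"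
  shows "koszul_diff R fs (\<lambda>S. r \<otimes> z S) = (\<lambda>S. r \<otimes> koszul_diff R fs z S)"
proof
  fix T
  have f: "fs ! j \<in> carrier R" if "j < length fs" for j using that fs nth_mem by blast
  show "koszul_diff R fs (\<lambda>S. r \<otimes> z S) T = r \<otimes> koszul_diff R fs z T"
    unfolding koszul_diff_def
    by (subst finsum_rdistr) (use assms f in \<open>auto intro!: finsum_cong' simp: m_ac\<close>)
qed

lemma koszul_diff_zero:
  assumes "set fs \<subseteq> carrier R"
  shows "koszul_diff R fs (\<lambda>S. \<zero>) = (\<lambda>S. \<zero>)"
  using koszul_diff_smult[OF assms, of "\<lambda>S. \<zero>" \<zero>] koszul_diff_V[OF assms, of "\<lambda>S. \<zero>"] by simp

lemma koszul_diff_uminus: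
  assumes "set fs \<subseteq> carrier R" "z \<in> V"
  shows "koszul_diff R fs (\<lambda>S. \<ominus> z S) = (\<lambda>S. \<ominus> koszul_diff R fs z S)"
proof -
  have "(\<lambda>S. (\<ominus> \<one>) \<otimes> z S) = (\<lambda>S. \<ominus> z S)" using assms by (auto simp: l_minus)
  moreover have "(\<lambda>S. (\<ominus> \<one>) \<otimes> koszul_diff R fs z S) = (\<lambda>S. \<ominus> koszul_diff R fs z S)"
    using koszul_diff_V[OF assms] by (auto simp: l_minus)
  ultimately show ?thesis using koszul_diff_smult[OF assms, of "\<ominus> \<one>"] by simp
qed

lemma koszul_diff_degree:
  assumes fs: "set fs \<subseteq> carrier R" and z: "z \<in> K fs i"
  shows "\<not> (T \<subseteq> {..<length fs} \<and> Suc (card T) = i) \<Longrightarrow> koszul_diff R fs z T = \<zero>"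
proof -
  assume T: "\<not> (T \<subseteq> {..<length fs} \<and> Suc (card T) = i)"
  have f: "fs ! j \<in> carrier R" if "j < length fs" for j using that fs nth_mem by blast
  have "z (insert j T) = \<zero>" if j: "j \<in> {..<length fs} - T" for j
  proof -
    have "\<not> (insert j T \<subseteq> {..<length fs} \<and> card (insert j T) = i)"
    proof
      assume *: "insert j T \<subseteq> {..<length fs} \<and> card (insert j T) = i"
      then have "finite T" using finite_subset[of T "{..<length fs}"] by simp
      then show False using * T j by simp
    qed
    then show ?thesis using z by (simp add: koszul_carrier)
  qed
  then have "koszul_diff R fs z T = (\<Oplus>j\<in>{..<length fs} - T. \<zero>)"
    unfolding koszul_diff_def using f by (intro finsum_cong') auto
  then show ?thesis by simp
qed

lemma koszul_diff_closed:
  assumes "set fs \<subseteq> carrier R" "z \<in> K fs (Suc i)"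
  shows "koszul_diff R fs z \<in> K fs i"
  using koszul_diff_degree[OF assms] koszul_diff_V[OF assms(1) koszul_carrier_V[OF assms(2)]]
  by (simp add: koszul_carrier)

lemma koszul_diff_degree_zero:
  assumes "set fs \<subseteq> carrier R" "z \<in> K fs 0"
  shows "koszul_diff R fs z = (\<lambda>S. \<zero>)"
  using koszul_diff_degree[OF assms] by auto

lemma cone_V: "z \<in> V \<Longrightarrow> cone_fst z \<in> V" "z \<in> V \<Longrightarrow> cone_snd z \<in> V" "x \<in> V \<Longrightarrow> y \<in> V \<Longrightarrow> cone x y \<in> V"
  by (auto simp: cone_fst_def cone_snd_def cone_def)

lemma koszul_diff_cone_fst:
  assumes b: "b \<in> carrier R" and as: "set as \<subseteq> carrier R" and z: "z \<in> V"
  shows "cone_fst (koszul_diff R (b # as) z) =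
    (\<lambda>S. koszul_diff R as (cone_fst z) S \<oplus> b \<otimes> cone_snd z S)"
proof
  fix S
  let ?n = "length as"
  have f: "as ! j \<in> carrier R" if "j < ?n" for j using that as nth_mem by blast
  define t where "t = (\<lambda>j. (\<ominus> \<one>) [^] card {t \<in> Suc ` S. t < j} \<otimes> (b # as) ! j \<otimes> z (insert j (Suc ` S)))"
  have tc: "t j \<in> carrier R" if "j < Suc ?n" for j
    using that b f z unfolding t_def by (cases j) auto
  have set: "{..<Suc ?n} - Suc ` S = insert 0 (Suc ` ({..<?n} - S))"
    by (auto simp: lessThan_Suc_eq_insert_0)
  have card: "card {t \<in> Suc ` S. t < Suc j} = card {t \<in> S. t < j}" for j
  proof -
    have "{t \<in> Suc ` S. t < Suc j} = Suc ` {t \<in> S. t < j}" by auto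
    then show ?thesis by (simp add: card_image)
  qed
  have "cone_fst (koszul_diff R (b # as) z) S = (\<Oplus>j\<in>insert 0 (Suc ` ({..<?n} - S)). t j)"
    unfolding cone_fst_def koszul_diff_def t_def by (simp add: set)
  also have "\<dots> = t 0 \<oplus> (\<Oplus>j\<in>Suc ` ({..<?n} - S). t j)"
    by (rule finsum_insert) (use tc in auto)
  also have "t 0 = b \<otimes> cone_snd z S" using b z by (simp add: t_def cone_snd_def)
  also have "(\<Oplus>j\<in>Suc ` ({..<?n} - S). t j) = (\<Oplus>j\<in>{..<?n} - S. t (Suc j))"
    by (rule finsum_reindex) (use tc in auto)
  also have "\<dots> = koszul_diff R as (cone_fst z) S"
    unfolding koszul_diff_def
    by (rule finsum_cong') (use f z in \<open>auto simp: t_def card cone_fst_def\<close>)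
  finally show "cone_fst (koszul_diff R (b # as) z) S = koszul_diff R as (cone_fst z) S \<oplus> b \<otimes> cone_snd z S"
    using koszul_diff_V[OF as cone_V(1)[OF z]] cone_V(2)[OF z] b by (simp add: a_comm)
qed

text \<open>The sign comes from the element \<open>0\<close>, which precedes all others in a set \<open>insert 0 (Suc ` S)\<close>.\<close>

lemma koszul_diff_cone_snd:
  assumes b: "b \<in> carrier R" and as: "set as \<subseteq> carrier R" and z: "z \<in> V"
  shows "cone_snd (koszul_diff R (b # as) z) = (\<lambda>S. \<ominus> koszul_diff R as (cone_snd z) S)"
proof
  fix S
  let ?n = "length as"
  have f: "as ! j \<in> carrier R" if "j < ?n" for j using that as nth_mem by blast
  define t where "t = (\<lambda>j. (\<ominus> \<one>) [^] card {t \<in> insert 0 (Suc ` S). t < j} \<otimes> (b # as) ! j \<otimes> z (insert j (insert 0 (Suc ` S))))"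
  have tc: "t j \<in> carrier R" if "j < Suc ?n" for j
    using that b f z unfolding t_def by (cases j) auto
  have set: "{..<Suc ?n} - insert 0 (Suc ` S) = Suc ` ({..<?n} - S)"
    by (auto simp: lessThan_Suc_eq_insert_0)
  have card: "card {t. (t = 0 \<or> t \<in> Suc ` S) \<and> t < Suc j} = Suc (card {t \<in> S. t < j})" for j
  proof -
    have "{t. (t = 0 \<or> t \<in> Suc ` S) \<and> t < Suc j} = insert 0 (Suc ` {t \<in> S. t < j})" by auto
    moreover have "finite {t \<in> S. t < j}" by simp
    ultimately show ?thesis by (simp add: card_image)
  qed
  have "cone_snd (koszul_diff R (b # as) z) S = (\<Oplus>j\<in>Suc ` ({..<?n} - S). t j)"
    unfolding cone_snd_def koszul_diff_def t_def by (simp add: set)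
  also have "\<dots> = (\<Oplus>j\<in>{..<?n} - S. t (Suc j))"
    by (rule finsum_reindex) (use tc in auto)
  also have "\<dots> = koszul_diff R as (\<lambda>S. \<ominus> cone_snd z S) S"
    unfolding koszul_diff_def
    by (rule finsum_cong')
      (use f z in \<open>auto simp: t_def card cone_snd_def insert_commute l_minus r_minus m_ac\<close>)
  also have "\<dots> = \<ominus> koszul_diff R as (cone_snd z) S"
    using koszul_diff_uminus[OF as cone_V(2)[OF z]] by simp
  finally show "cone_snd (koszul_diff R (b # as) z) S = \<ominus> koszul_diff R as (cone_snd z) S" .
qed

lemma koszul_diff_diff:
  assumes "set fs \<subseteq> carrier R" "z \<in> V"
  shows "koszul_diff R fs (koszul_diff R fs z) = (\<lambda>S. \<zero>)"
  using assms
proof (induction fs arbitrary: z)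
  case Nil
  then show ?case by (simp add: koszul_diff_def)
next
  case (Cons b as)
  have b: "b \<in> carrier R" and as: "set as \<subseteq> carrier R" using Cons.prems by auto
  let ?d = "koszul_diff R as" and ?D = "koszul_diff R (b # as)"
  note zV = Cons.prems(2)
  let ?x = "cone_fst z" and ?y = "cone_snd z"
  have x: "?x \<in> V" and y: "?y \<in> V" using cone_V zV by auto
  have D: "?D z \<in> V" using koszul_diff_V[OF Cons.prems] .
  have bY: "(\<lambda>S. b \<otimes> ?y S) \<in> V" using b y by auto
  have dx: "?d ?x \<in> V" and dy: "?d ?y \<in> V" using koszul_diff_V[OF as] x y by auto
  show ?case
  proof (rule cone_eqI)
    have "?d (\<lambda>S. ?d ?x S \<oplus> b \<otimes> ?y S) = (\<lambda>S. b \<otimes> ?d ?y S)"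
      using koszul_diff_add[OF as dx bY] koszul_diff_smult[OF as y b] Cons.IH[OF as x] b dy by simp
    then have "cone_fst (?D (?D z)) = (\<lambda>S. b \<otimes> ?d ?y S \<oplus> b \<otimes> (\<ominus> ?d ?y S))"
      using koszul_diff_cone_fst[OF b as D] koszul_diff_cone_fst[OF b as zV] koszul_diff_cone_snd[OF b as zV]
      by simp
    then show "cone_fst (?D (?D z)) = cone_fst (\<lambda>S. \<zero>)"
      using b dy by (simp add: cone_fst_def r_minus r_neg)
    have "?d (\<lambda>S. \<ominus> ?d ?y S) = (\<lambda>S. \<zero>)" using koszul_diff_uminus[OF as dy] Cons.IH[OF as y] by simp
    then show "cone_snd (?D (?D z)) = cone_snd (\<lambda>S. \<zero>)"
      using koszul_diff_cone_snd[OF b as D] koszul_diff_cone_snd[OF b as zV] by (simp add: cone_snd_def)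
  qed
qed

lemma koszul_carrier_cone:
  "z \<in> K (b # as) (Suc i) \<longleftrightarrow> cone_fst z \<in> K as (Suc i) \<and> cone_snd z \<in> K as i"
  "z \<in> K (b # as) 0 \<longleftrightarrow> cone_fst z \<in> K as 0 \<and> cone_snd z = (\<lambda>S. \<zero>)"
proof -
  let ?n = "length as"
  have 1: "Suc ` S \<subseteq> {..<Suc ?n} \<and> card (Suc ` S) = k \<longleftrightarrow> S \<subseteq> {..<?n} \<and> card S = k" for S k
    by (auto simp: card_image)
  have 2: "insert 0 (Suc ` S) \<subseteq> {..<Suc ?n} \<and> card (insert 0 (Suc ` S)) = Suc k \<longleftrightarrow> S \<subseteq> {..<?n} \<and> card S = k"
    for S k
  proof -
    have "insert 0 (Suc ` S) \<subseteq> {..<Suc ?n} \<longleftrightarrow> S \<subseteq> {..<?n}" by auto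
    moreover have "card (insert 0 (Suc ` S)) = Suc (card S)" if "S \<subseteq> {..<?n}"
      using finite_subset[OF that] by (simp add: card_image)
    ultimately show ?thesis by auto
  qed
  have 3: "\<not> (insert 0 (Suc ` S) \<subseteq> {..<Suc ?n} \<and> card (insert 0 (Suc ` S)) = 0)" for S
    using finite_subset[of "insert 0 (Suc ` S)" "{..<Suc ?n}"] by fastforce
  have V: "z \<in> V \<longleftrightarrow> cone_fst z \<in> V \<and> cone_snd z \<in> V"
  proof
    assume "cone_fst z \<in> V \<and> cone_snd z \<in> V"
    then have "z T \<in> carrier R" for T
      unfolding cone_fst_def cone_snd_def by (cases T rule: nat_set_cases) auto
    then show "z \<in> V" by simp
  qed (use cone_V in auto)
  have all: "(\<forall>T. P T) \<longleftrightarrow> (\<forall>S. P (Suc ` S)) \<and> (\<forall>S. P (insert 0 (Suc ` S)))" for P :: "nat set \<Rightarrow> bool"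
    using nat_set_cases by metis
  have supp: "(\<forall>T. \<not> (T \<subseteq> {..<length (b # as)} \<and> card T = k) \<longrightarrow> z T = \<zero>) \<longleftrightarrow>
      (\<forall>S. \<not> (Suc ` S \<subseteq> {..<Suc ?n} \<and> card (Suc ` S) = k) \<longrightarrow> cone_fst z S = \<zero>) \<and>
      (\<forall>S. \<not> (insert 0 (Suc ` S) \<subseteq> {..<Suc ?n} \<and> card (insert 0 (Suc ` S)) = k) \<longrightarrow> cone_snd z S = \<zero>)"
    for k
    using all[of "\<lambda>T. \<not> (T \<subseteq> {..<length (b # as)} \<and> card T = k) \<longrightarrow> z T = \<zero>"]
    unfolding cone_fst_def cone_snd_def length_Cons .
  have split: "(p \<longleftrightarrow> q \<and> r) \<Longrightarrow> (p' \<longleftrightarrow> q' \<and> r') \<Longrightarrow> (p \<and> p') \<longleftrightarrow> (q \<and> q') \<and> (r \<and> r')"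
    and split0: "(p \<longleftrightarrow> q \<and> r) \<Longrightarrow> (p' \<longleftrightarrow> q' \<and> r') \<Longrightarrow> (r' \<Longrightarrow> r) \<Longrightarrow> (p \<and> p') \<longleftrightarrow> (q \<and> q') \<and> r'"
    for p q r p' q' r' by blast+
  show "z \<in> K (b # as) (Suc i) \<longleftrightarrow> cone_fst z \<in> K as (Suc i) \<and> cone_snd z \<in> K as i"
    unfolding koszul_carrier by (rule split[OF V supp[of "Suc i", unfolded 1 2]])
  have "(\<forall>S. \<not> (insert 0 (Suc ` S) \<subseteq> {..<Suc ?n} \<and> card (insert 0 (Suc ` S)) = 0) \<longrightarrow> cone_snd z S = \<zero>)
    \<longleftrightarrow> cone_snd z = (\<lambda>S. \<zero>)"
    using 3 by (simp add: fun_eq_iff)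
  note supp0 = supp[of 0, unfolded 1 this]
  show "z \<in> K (b # as) 0 \<longleftrightarrow> cone_fst z \<in> K as 0 \<and> cone_snd z = (\<lambda>S. \<zero>)"
    unfolding koszul_carrier by (rule split0[OF V supp0]) simp
qed

text \<open>Multiplication by an element of the list is homotopic to zero. For \<open>b\<close> the homotopy of the cone is
\<open>(x,y) \<mapsto> (0,x)\<close>; a homotopy \<open>h\<close> on the complex of \<open>as\<close> extends to the cone as \<open>(x,y) \<mapsto> (hx, -hy)\<close>. Linearity of \<open>h\<close>
is part of the statement because \<open>h\<close> is applied to \<open>dx + by\<close>.\<close>

lemma koszul_homotopy:
  assumes "set fs \<subseteq> carrier R" "f \<in> set fs"
  shows "\<exists>h. (\<forall>z\<in>V. h z \<in> V) \<and> (\<forall>z\<in>V. \<forall>w\<in>V. h (\<lambda>S. z S \<oplus> w S) = (\<lambda>S. h z S \<oplus> h w S)) \<and>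
    (\<forall>r\<in>carrier R. \<forall>z\<in>V. h (\<lambda>S. r \<otimes> z S) = (\<lambda>S. r \<otimes> h z S)) \<and>
    (\<forall>i. \<forall>z\<in>K fs i. h z \<in> K fs (Suc i)) \<and>
    (\<forall>z\<in>V. (\<lambda>S. koszul_diff R fs (h z) S \<oplus> h (koszul_diff R fs z) S) = (\<lambda>S. f \<otimes> z S))"
  using assms
proof (induction fs)
  case (Cons b as)
  have b: "b \<in> carrier R" and as: "set as \<subseteq> carrier R" using Cons.prems by auto
  let ?d = "koszul_diff R as" and ?D = "koszul_diff R (b # as)"
  have ca: "cone_fst (\<lambda>S. z S \<oplus> w S) = (\<lambda>S. cone_fst z S \<oplus> cone_fst w S)"
    "cone_snd (\<lambda>S. z S \<oplus> w S) = (\<lambda>S. cone_snd z S \<oplus> cone_snd w S)" 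
    "cone_fst (\<lambda>S. r \<otimes> z S) = (\<lambda>S. r \<otimes> cone_fst z S)"
    "cone_snd (\<lambda>S. r \<otimes> z S) = (\<lambda>S. r \<otimes> cone_snd z S)" for r z w
    by (simp_all add: cone_fst_def cone_snd_def)
  have zero: "(\<lambda>S. \<zero>) \<in> V" "(\<lambda>S. \<zero>) \<in> K as i" for i by (simp_all add: koszul_carrier)
  have DV: "?D z \<in> V" if "z \<in> V" for z using koszul_diff_V[OF Cons.prems(1) that] .
  have dV: "?d z \<in> V" if "z \<in> V" for z using koszul_diff_V[OF as that] .
  show ?case
  proof (cases "f = b")
    case True
    let ?h = "\<lambda>z. cone (\<lambda>S. \<zero>) (cone_fst z)"
    have hd5: "(\<lambda>S. ?D (?h z) S \<oplus> ?h (?D z) S) = (\<lambda>S. f \<otimes> z S)" if z: "z \<in> V" for z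
    proof (rule cone_eqI)
      have h: "?h z \<in> V" by (rule cone_V(3)[OF zero(1) cone_V(1)[OF z]])
      have x: "cone_fst z S \<in> carrier R" "?d (cone_fst z) S \<in> carrier R" "cone_snd z S \<in> carrier R" for S
        using cone_V z dV[OF cone_V(1)[OF z]] by auto
      show "cone_fst (\<lambda>S. ?D (?h z) S \<oplus> ?h (?D z) S) = cone_fst (\<lambda>S. f \<otimes> z S)"
        unfolding ca koszul_diff_cone_fst[OF b as h] using x b True by (simp add: koszul_diff_zero[OF as])
      show "cone_snd (\<lambda>S. ?D (?h z) S \<oplus> ?h (?D z) S) = cone_snd (\<lambda>S. f \<otimes> z S)"
        unfolding ca koszul_diff_cone_snd[OF b as h] cone_simps koszul_diff_cone_fst[OF b as z]
        using x b True by (simp add: a_assoc[symmetric] l_neg)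
    qed
    have hK4: "?h z \<in> K (b # as) (Suc i)" if "z \<in> K (b # as) i" for z i
      using that zero unfolding koszul_carrier_cone by (cases i) (auto simp: koszul_carrier_cone)
    have ha2: "?h (\<lambda>S. z S \<oplus> w S) = (\<lambda>S. ?h z S \<oplus> ?h w S)" for z w
      by (rule cone_eqI) (simp_all add: ca)
    have hs3: "?h (\<lambda>S. r \<otimes> z S) = (\<lambda>S. r \<otimes> ?h z S)" if "r \<in> carrier R" for r z
      by (rule cone_eqI) (use that in \<open>simp_all add: ca\<close>)
    have hV1: "?h z \<in> V" if "z \<in> V" for z
      by (rule cone_V(3)[OF zero(1) cone_V(1)[OF that]])
    show ?thesis
      by (intro exI[of _ ?h] conjI ballI allI; (rule hV1 ha2 hs3 hK4 hd5; assumption))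
  next
    case False
    then have fas: "f \<in> set as" using Cons.prems(2) by simp
    from Cons.IH[OF as fas] obtain h where h: "\<forall>z\<in>V. h z \<in> V"
      "\<forall>z\<in>V. \<forall>w\<in>V. h (\<lambda>S. z S \<oplus> w S) = (\<lambda>S. h z S \<oplus> h w S)"
      "\<forall>r\<in>carrier R. \<forall>z\<in>V. h (\<lambda>S. r \<otimes> z S) = (\<lambda>S. r \<otimes> h z S)"
      "\<forall>i. \<forall>z\<in>K as i. h z \<in> K as (Suc i)"
      "\<forall>z\<in>V. (\<lambda>S. ?d (h z) S \<oplus> h (?d z) S) = (\<lambda>S. f \<otimes> z S)"
      by (elim exE conjE)
    note hV = h(1)[rule_format] and ha = h(2)[rule_format] and hs = h(3)[rule_format]
      and hK = h(4)[rule_format] and hd = h(5)[rule_format]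
    have fR: "f \<in> carrier R" using Cons.prems by blast
    have h0: "h (\<lambda>S. \<zero>) = (\<lambda>S. \<zero>)" using hs[of \<zero> "\<lambda>S. \<zero>"] hV[of "\<lambda>S. \<zero>"] zero by simp
    have hm: "h (\<lambda>S. \<ominus> z S) = (\<lambda>S. \<ominus> h z S)" if z: "z \<in> V" for z
    proof -
      have "(\<lambda>S. (\<ominus> \<one>) \<otimes> z S) = (\<lambda>S. \<ominus> z S)" using z by (auto simp: l_minus)
      moreover have "(\<lambda>S. (\<ominus> \<one>) \<otimes> h z S) = (\<lambda>S. \<ominus> h z S)" using hV[OF z] by (auto simp: l_minus)
      ultimately show ?thesis using hs[of "\<ominus> \<one>" z] z by simp
    qed
    let ?h = "\<lambda>z. cone (h (cone_fst z)) (\<lambda>S. \<ominus> h (cone_snd z) S)"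
    have hhV: "?h z \<in> V" if "z \<in> V" for z
    proof -
      have "h (cone_fst z) \<in> V" "h (cone_snd z) \<in> V" using hV cone_V that by auto
      then show ?thesis by (intro cone_V) auto
    qed
    have hd5: "(\<lambda>S. ?D (?h z) S \<oplus> ?h (?D z) S) = (\<lambda>S. f \<otimes> z S)" if z: "z \<in> V" for z
    proof (rule cone_eqI)
      let ?x = "cone_fst z" and ?y = "cone_snd z"
      have xV: "?x \<in> V" and yV: "?y \<in> V" using cone_V z by auto
      have byV: "(\<lambda>S. b \<otimes> ?y S) \<in> V" using yV b by auto
      have c: "?x S \<in> carrier R" "?y S \<in> carrier R" "h ?x S \<in> carrier R" "h ?y S \<in> carrier R"
        "?d (h ?x) S \<in> carrier R" "?d (h ?y) S \<in> carrier R" "h (?d ?x) S \<in> carrier R" "h (?d ?y) S \<in> carrier R" for S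
        using xV yV hV[OF xV] hV[OF yV] dV[OF hV[OF xV]] dV[OF hV[OF yV]] hV[OF dV[OF xV]] hV[OF dV[OF yV]] by auto
      have hx: "f \<otimes> ?x S = ?d (h ?x) S \<oplus> h (?d ?x) S" "f \<otimes> ?y S = ?d (h ?y) S \<oplus> h (?d ?y) S" for S
        using hd[OF xV] hd[OF yV] by (metis+)
      show "cone_fst (\<lambda>S. ?D (?h z) S \<oplus> ?h (?D z) S) = cone_fst (\<lambda>S. f \<otimes> z S)"
        unfolding ca koszul_diff_cone_fst[OF b as hhV[OF z]] cone_simps koszul_diff_cone_fst[OF b as z]
          ha[OF dV[OF xV] byV] hs[OF b yV] hx
      proof
        fix S
        have "(?d (h ?x) S \<oplus> b \<otimes> \<ominus> h ?y S) \<oplus> (h (?d ?x) S \<oplus> b \<otimes> h ?y S)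
          = (?d (h ?x) S \<oplus> h (?d ?x) S) \<oplus> (\<ominus> (b \<otimes> h ?y S) \<oplus> b \<otimes> h ?y S)"
          using c b by (simp add: r_minus a_ac)
        also have "\<dots> = ?d (h ?x) S \<oplus> h (?d ?x) S" using c b by (simp add: l_neg)
        finally show "?d (h ?x) S \<oplus> b \<otimes> \<ominus> h ?y S \<oplus> (h (?d ?x) S \<oplus> b \<otimes> h ?y S)
          = ?d (h ?x) S \<oplus> h (?d ?x) S" .
      qed
      have "?d (\<lambda>S. \<ominus> h ?y S) = (\<lambda>S. \<ominus> ?d (h ?y) S)" using koszul_diff_uminus[OF as hV[OF yV]] .
      moreover have "h (\<lambda>S. \<ominus> ?d ?y S) = (\<lambda>S. \<ominus> h (?d ?y) S)" using hm[OF dV[OF yV]] .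
      ultimately show "cone_snd (\<lambda>S. ?D (?h z) S \<oplus> ?h (?D z) S) = cone_snd (\<lambda>S. f \<otimes> z S)"
        unfolding ca koszul_diff_cone_snd[OF b as hhV[OF z]] cone_simps koszul_diff_cone_snd[OF b as z] hx
        using c by simp
    qed
    have hK4: "?h z \<in> K (b # as) (Suc i)" if z: "z \<in> K (b # as) i" for z i
    proof (cases i)
      case 0
      then have "cone_snd z = (\<lambda>S. \<zero>)" "cone_fst z \<in> K as 0" using z koszul_carrier_cone(2) by auto
      then show ?thesis using hK[of "cone_fst z" 0] h0 zero 0 by (simp add: koszul_carrier_cone)
    next
      case (Suc j)
      then have xy: "cone_fst z \<in> K as (Suc j)" "cone_snd z \<in> K as j" using z koszul_carrier_cone(1) by auto
      have "(\<lambda>S. \<ominus> h (cone_snd z) S) \<in> K as (Suc j)" using hK[OF xy(2)] by (auto simp: koszul_carrier)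
      then show ?thesis using hK[OF xy(1)] Suc by (simp add: koszul_carrier_cone)
    qed
    have ha2: "?h (\<lambda>S. z S \<oplus> w S) = (\<lambda>S. ?h z S \<oplus> ?h w S)" if "z \<in> V" "w \<in> V" for z w
    proof (rule cone_eqI)
      have V: "cone_fst z \<in> V" "cone_snd z \<in> V" "cone_fst w \<in> V" "cone_snd w \<in> V" using that cone_V by auto
      show "cone_fst (?h (\<lambda>S. z S \<oplus> w S)) = cone_fst (\<lambda>S. ?h z S \<oplus> ?h w S)"
        unfolding ca cone_simps ha[OF V(1,3)] ..
      have "h (cone_snd z) S \<in> carrier R" "h (cone_snd w) S \<in> carrier R" for S
        using hV[OF V(2)] hV[OF V(4)] by auto
      then show "cone_snd (?h (\<lambda>S. z S \<oplus> w S)) = cone_snd (\<lambda>S. ?h z S \<oplus> ?h w S)"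
        unfolding ca cone_simps ha[OF V(2,4)] by (simp add: minus_add)
    qed
    have hs3: "?h (\<lambda>S. r \<otimes> z S) = (\<lambda>S. r \<otimes> ?h z S)" if r: "r \<in> carrier R" and z: "z \<in> V" for r z
    proof (rule cone_eqI)
      have V: "cone_fst z \<in> V" "cone_snd z \<in> V" using z cone_V by auto
      show "cone_fst (?h (\<lambda>S. r \<otimes> z S)) = cone_fst (\<lambda>S. r \<otimes> ?h z S)"
        unfolding ca cone_simps hs[OF r V(1)] ..
      have "h (cone_snd z) S \<in> carrier R" for S using hV[OF V(2)] by auto
      then show "cone_snd (?h (\<lambda>S. r \<otimes> z S)) = cone_snd (\<lambda>S. r \<otimes> ?h z S)"
        unfolding ca cone_simps hs[OF r V(2)] using r by (simp add: r_minus)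
    qed
    show ?thesis
      by (intro exI[of _ ?h] conjI ballI allI; (rule hhV ha2 hs3 hK4 hd5; assumption))
  qed
qed simp

end

section \<open>Depth of Koszul cycles and boundaries\<close>

lemma grade_le_if_not_Suc_le:
  assumes "\<not> ereal (real (Suc n)) \<le> grade R J M"
  shows "grade R J M \<le> ereal (real n)"
proof (cases "set_smult R J M = carrier M")
  case False
  let ?S = "{ereal (real (length xs)) | xs. set xs \<subseteq> J \<and> regular_sequence R M xs}"
  have g: "grade R J M = Sup ?S" using False by (simp add: grade_def)
  have "length xs \<le> n" if "set xs \<subseteq> J" "regular_sequence R M xs" for xs
  proof (rule ccontr)
    assume "\<not> length xs \<le> n"
    then have "ereal (real (Suc n)) \<le> ereal (real (length xs))" by simp
    also have "\<dots> \<le> Sup ?S" by (rule Sup_upper) (use that in blast)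
    finally show False using assms g by simp
  qed
  then show ?thesis unfolding g by (auto intro!: Sup_least)
qed (use assms in \<open>simp add: grade_def\<close>)

text \<open>A chain of primes above \<open>J\<close> maps to a chain of primes of \<open>R/J\<close>, so a bound on the dimension of \<open>R/J\<close>
bounds the chains above \<open>J\<close>.\<close>

lemma krull_dim_quot_ge:
  assumes R: "cring R" and J: "ideal J R"
    and p: "\<forall>i\<le>n. primeideal (p i) R \<and> J \<subseteq> p i" "\<forall>i<n. p i \<subset> p (Suc i)"
  shows "ereal (real n) \<le> krull_dim (R Quot J)"
proof -
  interpret cring R by fact
  let ?q = "\<lambda>i. (+>\<^bsub>R\<^esub>) J ` p i"
  have mem: "J +>\<^bsub>R\<^esub> a \<in> ?q i \<longleftrightarrow> a \<in> p i" if i: "i \<le> n" and a: "a \<in> carrier R" for i a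
  proof -
    have id: "ideal (p i) R" using p(1) i primeideal.axioms(1) by blast
    have "\<Union>(?q i) = p i" using ideal_incl_iff[OF J id] p(1) i by auto
    moreover have "?q i \<subseteq> carrier (R Quot J)"
      using ideal.Icarr[OF ring_ideal_imp_quot_ideal[OF J id]] by blast
    ultimately show ?thesis using canonical_proj_vimage_mem_iff[OF J _ a, of "?q i"] by simp
  qed
  have "primeideal (?q i) (R Quot J)" if i: "i \<le> n" for i
  proof (rule primeidealI)
    have pi: "primeideal (p i) R" using p(1) i by blast
    have id: "ideal (p i) R" using primeideal.axioms(1)[OF pi] .
    show "ideal (?q i) (R Quot J)" by (rule ring_ideal_imp_quot_ideal[OF J id])
    show "cring (R Quot J)" by (rule ideal.quotient_is_cring[OF J R])
    have carr: "carrier (R Quot J) = (+>\<^bsub>R\<^esub>) J ` carrier R"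
      unfolding FactRing_def A_RCOSETS_def' by auto
    show "carrier (R Quot J) \<noteq> ?q i"
    proof
      assume "carrier (R Quot J) = ?q i"
      then have "J +>\<^bsub>R\<^esub> a \<in> ?q i" if a: "a \<in> carrier R" for a
      proof -
        have "J +>\<^bsub>R\<^esub> a \<in> (+>\<^bsub>R\<^esub>) J ` carrier R" using a by (rule imageI)
        then show ?thesis using \<open>carrier (R Quot J) = ?q i\<close> carr by metis
      qed
      then have "carrier R \<subseteq> p i" using mem[OF i] by (intro subsetI) simp
      then show False using primeideal.I_notcarr[OF pi] ideal.Icarr[OF id] by blast
    qed
    fix x y assume xy: "x \<in> carrier (R Quot J)" "y \<in> carrier (R Quot J)" "x \<otimes>\<^bsub>R Quot J\<^esub> y \<in> ?q i"
    then obtain a c where ac: "a \<in> carrier R" "c \<in> carrier R" "x = J +>\<^bsub>R\<^esub> a" "y = J +>\<^bsub>R\<^esub> c"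
      using carr by auto
    have "x \<otimes>\<^bsub>R Quot J\<^esub> y = J +>\<^bsub>R\<^esub> (a \<otimes>\<^bsub>R\<^esub> c)"
      using ideal.rcoset_mult_add[OF J ac(1,2)] ac(3,4) by (simp add: FactRing_def)
    then have "a \<otimes>\<^bsub>R\<^esub> c \<in> p i" using xy(3) mem[OF i] ac by simp
    then show "x \<in> ?q i \<or> y \<in> ?q i" using primeideal.I_prime[OF pi ac(1,2)] ac(3,4) by blast
  qed
  moreover have "?q i \<subset> ?q (Suc i)" if i: "i < n" for i
  proof -
    obtain a where a: "a \<in> p (Suc i)" "a \<notin> p i" using p(2) i by blast
    have "ideal (p (Suc i)) R" using p(1) i primeideal.axioms(1) by (metis Suc_leI)
    then have "a \<in> carrier R" using ideal.Icarr a(1) by metis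
    then have "J +>\<^bsub>R\<^esub> a \<notin> ?q i" using mem[of i a] i a(2) by simp
    moreover have "?q i \<subseteq> ?q (Suc i)" using p(2) i by (intro image_mono) blast
    ultimately show ?thesis using a(1) by blast
  qed
  ultimately have "ereal (real n) \<in> {ereal (real n) | n :: nat. \<exists>p.
      (\<forall>i\<le>n. primeideal (p i) (R Quot J)) \<and> (\<forall>i<n. p i \<subset> p (Suc i))}"
    by (intro CollectI exI[of _ n] conjI refl exI[of _ ?q]) auto
  then show ?thesis unfolding krull_dim_def by (rule Sup_upper)
qed

locale noetherian_local_ring = cring +
  fixes \<mm>
  assumes noetherian: "noetherian_ring R" and local: "local_ring R \<mm>"
begin

abbreviation F :: "nat \<Rightarrow> ('a, nat set \<Rightarrow> 'a) module" where
  "F n \<equiv> fun_module R (Pow {..<n})"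
abbreviation Z :: "'a list \<Rightarrow> nat \<Rightarrow> (nat set \<Rightarrow> 'a) set" where "Z \<equiv> koszul_cycles R"
abbreviation B :: "'a list \<Rightarrow> nat \<Rightarrow> (nat set \<Rightarrow> 'a) set" where "B \<equiv> koszul_boundaries R"
abbreviation zero_sub :: "(nat set \<Rightarrow> 'a) set" where "zero_sub \<equiv> {\<lambda>S. \<zero>}"

lemma noetherian_module_F: "noetherian_module R (F n)"
  by (rule noetherian_fun_module[OF noetherian]) simp

lemma \<mm>_ideal: "ideal \<mm> R" and \<mm>_carrier: "\<mm> \<subseteq> carrier R"
proof -
  show *: "ideal \<mm> R" using local_ring_maximal_proper[OF local] by blast
  show "\<mm> \<subseteq> carrier R" using ideal.Icarr[OF *] by blast
qed

lemma grade_ge_ring: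
  assumes J: "ideal J R" and g: "ereal (real k) \<le> grade R J (ring_module R)"
  shows "grade_ge (ring_module R) J (carrier R) k {\<zero>}"
proof -
  interpret M: module R "ring_module R" by (rule module_ring_module)
  have c: "carrier (ring_module R) = carrier R" "\<zero>\<^bsub>ring_module R\<^esub> = \<zero>" by (simp_all add: ring_module_def)
  have JR: "J \<subseteq> carrier R" using ideal.Icarr[OF J] by blast
  have "grade_ge (ring_module R) J (carrier (ring_module R)) k {\<zero>\<^bsub>ring_module R\<^esub>}"
  proof (rule M.grade_imp_grade_ge[OF JR g])
    assume eq: "set_smult R J (ring_module R) = carrier (ring_module R)"
    have "set_smult R J (ring_module R) \<subseteq> J"
      by (rule M.set_smult_least)
        (use ring_submodule_iff J ideal.I_r_closed[OF J] in \<open>auto simp: ring_module_def\<close>)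
    then have one: "\<one> \<in> J" using eq c by auto
    show "grade_ge (ring_module R) J (carrier (ring_module R)) k {\<zero>\<^bsub>ring_module R\<^esub>}"
    proof (cases k)
      case (Suc l)
      have S: "subquot R (ring_module R) (carrier (ring_module R)) {\<zero>\<^bsub>ring_module R\<^esub>}"
        using M.carrier_is_submodule M.zero_submodule by (simp add: subquot_def)
      have "add_mult (ring_module R) {\<zero>\<^bsub>ring_module R\<^esub>} \<one> (carrier (ring_module R)) = carrier (ring_module R)"
        (is "?L = _")
      proof
        show "?L \<subseteq> carrier (ring_module R)" using M.subquot_add_mult(1)[OF S one_closed] by (simp add: subquot_def)
        show "carrier (ring_module R) \<subseteq> ?L"
        proof
          fix u assume u: "u \<in> carrier (ring_module R)"
          then have "\<one> \<odot>\<^bsub>ring_module R\<^esub> u \<in> ?L" using M.subquot_add_mult(3)[OF S one_closed] by blast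
          then show "u \<in> ?L" using u by (simp add: M.smult_one)
        qed
      qed
      moreover have "grade_ge (ring_module R) J (carrier (ring_module R)) l (carrier (ring_module R))"
        by (rule M.grade_ge_trivial[OF one M.carrier_is_submodule one_closed])
      moreover have "nzd_mod (ring_module R) \<one> (carrier (ring_module R)) {\<zero>\<^bsub>ring_module R\<^esub>}"
        unfolding nzd_mod_def using M.smult_one by auto
      ultimately show ?thesis using Suc one unfolding grade_ge.simps(2) Suc by metis
    qed simp
  qed
  then show ?thesis using c by simp
qed

context
  fixes fs :: "'a list" and n :: nat
  assumes fs: "set fs \<subseteq> carrier R" and n: "length fs \<le> n"
begin

lemma koszul_indices: "subsets_of_card (length fs) i \<subseteq> Pow {..<n}"
  using n by auto

lemma K_submodule: "submodule (K fs i) R (F n)"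
proof -
  interpret M: module R "koszul_module R fs i" unfolding koszul_module_eq by (rule module_fun_module)
  show ?thesis
    using fun_submodule[OF koszul_indices M.carrier_is_submodule[unfolded koszul_module_eq]]
    by (simp add: koszul_module_eq)
qed

lemma zero_sub_submodule: "submodule zero_sub R (F n)"
  using module.zero_submodule[OF module_fun_module, of "Pow {..<n}"] by simp

lemma koszul_diff_linear:
  "z \<in> K fs i \<Longrightarrow> koszul_diff R fs z \<in> carrier (fun_module R UNIV)"
  "z \<in> K fs i \<Longrightarrow> w \<in> K fs i \<Longrightarrow>
    koszul_diff R fs (z \<oplus>\<^bsub>F n\<^esub> w) = koszul_diff R fs z \<oplus>\<^bsub>fun_module R X\<^esub> koszul_diff R fs w"
  "r \<in> carrier R \<Longrightarrow> z \<in> K fs i \<Longrightarrow>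
    koszul_diff R fs (r \<odot>\<^bsub>F n\<^esub> z) = r \<odot>\<^bsub>fun_module R X\<^esub> koszul_diff R fs z"
  using koszul_diff_V[OF fs koszul_carrier_V[of z fs i]]
    koszul_diff_add[OF fs koszul_carrier_V[of z fs i] koszul_carrier_V[of w fs i]]
    koszul_diff_smult[OF fs koszul_carrier_V[of z fs i], of r]
  by (simp_all add: fun_module_carrier)

lemma Z_submodule: "submodule (Z fs i) R (F n)"
proof -
  interpret U: module R "fun_module R UNIV" by (rule module_fun_module)
  have "submodule {z \<in> K fs i. koszul_diff R fs z \<in> {\<zero>\<^bsub>fun_module R UNIV\<^esub>}} R (F n)"
    by (rule submodule_vimage[where f = "koszul_diff R fs",
          OF module_fun_module module_fun_module K_submodule U.zero_submodule])
      (rule koszul_diff_linear; assumption)+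
  then show ?thesis by (simp add: koszul_cycles_def)
qed

lemma Z_subset_K: "Z fs i \<subseteq> K fs i"
  by (auto simp: koszul_cycles_def)

lemma B_subset_Z: "B fs i \<subseteq> Z fs i"
  using koszul_diff_closed[OF fs] koszul_diff_diff[OF fs koszul_carrier_V]
  by (auto simp: koszul_boundaries_def koszul_cycles_def)

lemma B_submodule: "submodule (B fs i) R (F n)"
  unfolding koszul_boundaries_def
proof (rule submodule_image[where f = "koszul_diff R fs", OF module_fun_module module_fun_module K_submodule])
  interpret M: module R "F n" by (rule module_fun_module)
  show "koszul_diff R fs z \<in> carrier (F n)" if "z \<in> K fs (Suc i)" for z
    using M.submodule_carrier[OF K_submodule koszul_diff_closed[OF fs that]] .
qed (rule koszul_diff_linear; assumption)+

lemma zero_sub_subset: "submodule N R (F n) \<Longrightarrow> zero_sub \<subseteq> N"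
  using module.submodule_zero_closed[OF module_fun_module, of N "Pow {..<n}"] by simp

lemma koszul_subquots:
  "subquot R (F n) (K fs i) (Z fs i)" "subquot R (F n) (Z fs i) (B fs i)"
  "subquot R (F n) (B fs i) zero_sub" "subquot R (F n) (Z fs i) zero_sub" "subquot R (F n) (K fs i) zero_sub"
  unfolding subquot_def
  using K_submodule Z_submodule B_submodule zero_sub_submodule Z_subset_K B_subset_Z zero_sub_subset by simp_all

lemma koszul_homology_killed:
  assumes "r \<in> Idl (set fs)" "z \<in> Z fs i"
  shows "(\<lambda>S. r \<otimes> z S) \<in> B fs i"
proof -
  interpret M: module R "F n" by (rule module_fun_module)
  let ?J = "{r \<in> carrier R. \<forall>z\<in>Z fs i. (\<lambda>S. r \<otimes> z S) \<in> B fs i}"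
  have "ideal ?J R"
    using M.conductor_ideal[OF B_submodule M.submoduleE(1)[OF Z_submodule], of i i] by simp
  moreover have "set fs \<subseteq> ?J"
  proof
    fix f assume f: "f \<in> set fs"
    from koszul_homotopy[OF fs f] obtain h where
      h: "\<forall>r\<in>carrier R. \<forall>z\<in>V. h (\<lambda>S. r \<otimes> z S) = (\<lambda>S. r \<otimes> h z S)" "\<forall>z\<in>V. h z \<in> V"
      "\<forall>i. \<forall>z\<in>K fs i. h z \<in> K fs (Suc i)"
      "\<forall>z\<in>V. (\<lambda>S. koszul_diff R fs (h z) S \<oplus> h (koszul_diff R fs z) S) = (\<lambda>S. f \<otimes> z S)"
      by (elim exE conjE)
    have zero_sub: "(\<lambda>S. \<zero>) \<in> V" by simp
    have h0: "h (\<lambda>S. \<zero>) = (\<lambda>S. \<zero>)"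
      using h(1)[rule_format, OF zero_closed zero_sub] h(2)[rule_format, OF zero_sub] by simp
    have "(\<lambda>S. f \<otimes> z S) \<in> B fs i" if z: "z \<in> Z fs i" for z
    proof -
      have zK: "z \<in> K fs i" using z Z_subset_K by blast
      have dz: "koszul_diff R fs z = (\<lambda>S. \<zero>)" using z by (simp add: koszul_cycles_def)
      have hz: "h z \<in> K fs (Suc i)" using h(3)[rule_format, OF zK] .
      have "(\<lambda>S. f \<otimes> z S) = koszul_diff R fs (h z)"
        using h(4)[rule_format, OF koszul_carrier_V[OF zK]] koszul_diff_V[OF fs koszul_carrier_V[OF hz]]
        unfolding dz h0 by simp
      then show ?thesis using hz unfolding koszul_boundaries_def by blast
    qed
    then show "f \<in> ?J" using f fs by blast
  qed
  ultimately have "Idl (set fs) \<subseteq> ?J" by (rule genideal_minimal)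
  then show ?thesis using assms by blast
qed

text \<open>The differential induces \<open>K\<^sub>i\<^sub>+\<^sub>1/Z\<^sub>i\<^sub>+\<^sub>1 \<cong> B\<^sub>i\<close>.\<close>

lemma grade_ge_boundaries_iff:
  assumes J: "J \<subseteq> carrier R"
  shows "grade_ge (F n) J (K fs (Suc i)) k (Z fs (Suc i)) \<longleftrightarrow> grade_ge (F n) J (B fs i) k zero_sub"
proof (rule grade_ge_iso[OF module_fun_module module_fun_module koszul_subquots(1,3) J,
    where f = "koszul_diff R fs"])
  interpret M: module R "F n" by (rule module_fun_module)
  show "koszul_diff R fs a \<in> B fs i" if "a \<in> K fs (Suc i)" for a
    using that unfolding koszul_boundaries_def by blast
  show "\<exists>a\<in>K fs (Suc i). mcong (F n) zero_sub a' (koszul_diff R fs a)" if a': "a' \<in> B fs i" for a'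
  proof -
    obtain a where a: "a \<in> K fs (Suc i)" "a' = koszul_diff R fs a"
      using a' unfolding koszul_boundaries_def by blast
    have "mcong (F n) zero_sub a' a'" using M.mcong_refl[OF zero_sub_submodule M.submodule_carrier[OF B_submodule a']] .
    then show ?thesis using a by blast
  qed
  show "koszul_diff R fs a \<in> zero_sub \<longleftrightarrow> a \<in> Z fs (Suc i)" if "a \<in> K fs (Suc i)" for a
    using that by (simp add: koszul_cycles_def)
qed (rule koszul_diff_linear; assumption)+

lemma grade_ge_K:
  assumes "J \<subseteq> carrier R" "grade_ge (ring_module R) J (carrier R) k {\<zero>}"
  shows "grade_ge (F n) J (K fs i) k zero_sub"
  unfolding koszul_module_eq by (rule grade_ge_fun_module_zero[OF assms(1) koszul_indices assms(2)])

lemma K_eq_zero_sub: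
  assumes "length fs < i"
  shows "K fs i = zero_sub"
proof -
  have "\<not> (S \<subseteq> {..<length fs} \<and> card S = i)" for S
  proof
    assume S: "S \<subseteq> {..<length fs} \<and> card S = i"
    then have "card S \<le> card {..<length fs}" by (intro card_mono) auto
    then show False using assms S by simp
  qed
  then show ?thesis unfolding koszul_module_eq by (auto simp: fun_module_carrier)
qed

lemma Z_B_eq_zero_sub: "length fs < i \<Longrightarrow> Z fs i = zero_sub \<and> B fs i = zero_sub"
  using K_eq_zero_sub[of i] Z_subset_K[of i] B_subset_Z[of i] zero_sub_subset[OF B_submodule[of i]] by blast

text \<open>An ideal \<open>J\<close> generated by \<open>r\<close> elements and of grade at least \<open>k\<close> has \<open>H\<^sub>i = 0\<close> for \<open>i > r - k\<close>. Going down
from \<open>i = r\<close>, the exact part of the complex resolves \<open>B\<^sub>i\<close> by free modules and keeps the grade of \<open>J\<close> on \<open>B\<^sub>i\<close> at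
least \<open>2\<close>. As \<open>Z\<^sub>i\<close> has grade at least \<open>1\<close>, the quotient \<open>H\<^sub>i\<close> has no socle; but it is annihilated by \<open>J\<close>.
Here \<open>m = r - i\<close>, and \<open>e\<close> is the excess of \<open>k\<close> over \<open>m + 1\<close>.\<close>

lemma koszul_homology_vanishing:
  assumes J: "J = Idl (set fs)" and g: "grade_ge (ring_module R) J (carrier R) (m + Suc e) {\<zero>}"
    and "i + m = length fs"
  shows "Z fs i = B fs i \<and> grade_ge (F n) J (B fs i) (Suc (Suc e)) zero_sub"
  using g assms(3)
proof (induction m arbitrary: i e)
  interpret M: noetherian_module R "F n" by (rule noetherian_module_F)
  have idJ: "ideal J R" using J genideal_ideal[OF fs] by simp
  have JR: "J \<subseteq> carrier R" using ideal.Icarr[OF idJ] by blast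
  have zJ: "\<zero> \<in> J" using additive_subgroup.zero_closed[OF ideal.axioms(1)[OF idJ]] .
  note gB = grade_ge_boundaries_iff[OF JR]
  have *: "Z fs i = B fs i" if g: "grade_ge (ring_module R) J (carrier R) (Suc 0) {\<zero>}"
    and b: "grade_ge (F n) J (B fs i) (Suc (Suc e)) zero_sub" for i e
  proof -
    have "grade_ge (F n) J (K fs i) (Suc 0) zero_sub" by (rule grade_ge_K[OF JR g])
    then have "grade_ge (F n) J (Z fs i) (Suc 0) zero_sub"
      using M.grade_ge_submodule[OF idJ koszul_subquots(1,4), where k = 0] by simp
    moreover have "grade_ge (F n) J (B fs i) (Suc (Suc 0)) zero_sub"
      by (rule M.grade_ge_antimono[OF _ b]) simp
    ultimately have "grade_ge (F n) J (Z fs i) (Suc 0) (B fs i)"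
      using M.grade_ge_quotient[OF idJ koszul_subquots(2,3)] by blast
    then have "no_socle (F n) J (Z fs i) (B fs i)" by (rule M.grade_ge_no_socle)
    moreover have "\<forall>j\<in>J. j \<odot>\<^bsub>F n\<^esub> z \<in> B fs i" if "z \<in> Z fs i" for z
      using koszul_homology_killed[OF _ that] J by simp
    ultimately show ?thesis using B_subset_Z[of i] unfolding no_socle_def by blast
  qed
  {
    case (0 i e)
    have "B fs i = zero_sub" using K_eq_zero_sub[of "Suc i"] 0 koszul_diff_zero[OF fs] by (simp add: koszul_boundaries_def)
    then have b: "grade_ge (F n) J (B fs i) (Suc (Suc e)) zero_sub"
      using M.grade_ge_trivial[OF zJ zero_sub_submodule zero_closed, of "Suc (Suc e)"] by metis
    have "grade_ge (ring_module R) J (carrier R) (Suc 0) {\<zero>}"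
      by (rule module.grade_ge_antimono[OF module_ring_module _ 0(1)]) simp
    then show ?case using *[OF _ b] b by blast
  next
    case (Suc m i e)
    have "grade_ge (ring_module R) J (carrier R) (m + Suc (Suc e)) {\<zero>}" using Suc.prems(1) by simp
    from Suc.IH[OF this, of "Suc i"] Suc.prems(2)
    have Z: "Z fs (Suc i) = B fs (Suc i)"
      and b: "grade_ge (F n) J (Z fs (Suc i)) (Suc (Suc (Suc e))) zero_sub" by simp_all
    have "grade_ge (ring_module R) J (carrier R) (Suc (Suc e)) {\<zero>}"
      by (rule module.grade_ge_antimono[OF module_ring_module _ Suc.prems(1)]) simp
    then have "grade_ge (F n) J (K fs (Suc i)) (Suc (Suc e)) zero_sub" by (rule grade_ge_K[OF JR])
    from M.grade_ge_quotient[OF idJ koszul_subquots(1,4) b this]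
    have b': "grade_ge (F n) J (B fs i) (Suc (Suc e)) zero_sub" unfolding gB .
    have "grade_ge (ring_module R) J (carrier R) (Suc 0) {\<zero>}"
      by (rule module.grade_ge_antimono[OF module_ring_module _ Suc.prems(1)]) simp
    then show ?case using *[OF _ b'] b' by blast
  }
qed

text \<open>Induction on \<open>i\<close> along \<open>0 \<rightarrow> B\<^sub>i \<rightarrow> Z\<^sub>i \<rightarrow> H\<^sub>i \<rightarrow> 0\<close> and \<open>0 \<rightarrow> Z\<^sub>i\<^sub>+\<^sub>1 \<rightarrow> K\<^sub>i\<^sub>+\<^sub>1 \<rightarrow> B\<^sub>i \<rightarrow> 0\<close>. They give
\<open>depth B\<^sub>i \<ge> min (depth Z\<^sub>i) (depth H\<^sub>i + 1)\<close> and
\<open>depth Z\<^sub>i\<^sub>+\<^sub>1 \<ge> min (depth K\<^sub>i\<^sub>+\<^sub>1) (depth B\<^sub>i + 1)\<close>.\<close>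

lemma grade_ge_cycles:
  assumes R: "\<And>k. k \<le> d \<Longrightarrow> grade_ge (ring_module R) \<mm> (carrier R) k {\<zero>}"
    and H: "\<And>j k. k + Suc s \<le> d + j \<Longrightarrow> grade_ge (F n) \<mm> (Z fs j) k (B fs j)"
    and "k \<le> d" "k + s \<le> d + i"
  shows "grade_ge (F n) \<mm> (Z fs i) k zero_sub"
  using assms(3-)
proof (induction i arbitrary: k)
  case 0
  have "Z fs 0 = K fs 0" using koszul_diff_degree_zero[OF fs] by (auto simp: koszul_cycles_def)
  then show ?case using grade_ge_K[OF \<mm>_carrier R[OF 0(1)]] by simp
next
  case (Suc i)
  interpret M: noetherian_module R "F n" by (rule noetherian_module_F)
  show ?case
  proof (cases k)
    case (Suc k')
    have "grade_ge (F n) \<mm> (B fs i) k' zero_sub"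
    proof (cases k')
      case k'': (Suc k'')
      have Z: "grade_ge (F n) \<mm> (Z fs i) (Suc k'') zero_sub"
        by (rule Suc.IH) (use Suc.prems Suc k'' in simp_all)
      have "grade_ge (F n) \<mm> (Z fs i) k'' (B fs i)"
        by (rule H) (use Suc.prems Suc k'' in simp)
      then show ?thesis using M.grade_ge_submodule[OF \<mm>_ideal koszul_subquots(2,3) Z] k'' by simp
    qed simp
    then have KZ: "grade_ge (F n) \<mm> (K fs (Suc i)) k' (Z fs (Suc i))"
      using grade_ge_boundaries_iff[OF \<mm>_carrier] by simp
    have K: "grade_ge (F n) \<mm> (K fs (Suc i)) (Suc k') zero_sub"
      by (rule grade_ge_K[OF \<mm>_carrier R]) (use Suc.prems Suc in simp)
    show ?thesis using M.grade_ge_submodule[OF \<mm>_ideal koszul_subquots(1,4) K KZ] Suc by simp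
  qed simp
qed

lemma koszul_homology_F:
  "koszul_homology R fs i = quot_module R ((F n)\<lparr>carrier := Z fs i\<rparr>) (B fs i)"
  unfolding koszul_homology_def koszul_module_eq
  by (simp only: fun_module_carrier_update[where X = "subsets_of_card (length fs) i" and Y = "Pow {..<n}"])

end

lemma koszul_diff_empty_mem:
  assumes "ideal J R" "set fs \<subseteq> J" "z \<in> V"
  shows "koszul_diff R fs z {} \<in> J"
  using assms(2-)
proof (induction fs arbitrary: z)
  interpret J: ideal J R by fact
  {
    case Nil
    then show ?case by (simp add: koszul_diff_def)
  next
    case (Cons b as)
    have b: "b \<in> carrier R" and as: "set as \<subseteq> carrier R" using Cons.prems J.Icarr by auto
    have "koszul_diff R (b # as) z {} = cone_fst (koszul_diff R (b # as) z) {}" by (simp add: cone_fst_def)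
    also have "\<dots> = koszul_diff R as (cone_fst z) {} \<oplus> b \<otimes> cone_snd z {}"
      using koszul_diff_cone_fst[OF b as Cons.prems(2)] by simp
    also have "\<dots> \<in> J"
      using Cons.IH[OF _ cone_V(1)[OF Cons.prems(2)]] Cons.prems(1) J.I_r_closed[of b "cone_snd z {}"]
        cone_V(2)[OF Cons.prems(2)] by auto
    finally show ?case .
  }
qed

text \<open>The inclusion from right to left uses that \<open>H\<^sub>0\<close> is annihilated by the ideal: \<open>z\<close> is its value at the
empty set times the basis element \<open>e\<close>.\<close>

lemma koszul_boundaries_zero:
  assumes fs: "set fs \<subseteq> carrier R"
  shows "B fs 0 = {z \<in> K fs 0. z {} \<in> Idl (set fs)}"
proof (intro equalityI subsetI)
  have id: "ideal (Idl (set fs)) R" using genideal_ideal[OF fs] .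
  fix z assume z: "z \<in> B fs 0"
  then obtain u where u: "u \<in> K fs (Suc 0)" "z = koszul_diff R fs u" unfolding koszul_boundaries_def by blast
  then show "z \<in> {z \<in> K fs 0. z {} \<in> Idl (set fs)}"
    using koszul_diff_closed[OF fs u(1)] koszul_diff_empty_mem[OF id genideal_self[OF fs] koszul_carrier_V[OF u(1)]]
    by simp
next
  fix z assume z: "z \<in> {z \<in> K fs 0. z {} \<in> Idl (set fs)}"
  define e where "e = (\<lambda>S :: nat set. if S = {} then \<one> else \<zero>)"
  have supp: "z S = \<zero>" if "S \<noteq> {}" for S
  proof -
    have "\<not> (S \<subseteq> {..<length fs} \<and> card S = 0)" using that finite_subset[of S "{..<length fs}"] by auto
    then show ?thesis using z by (simp add: koszul_carrier)
  qed
  have zc: "z {} \<in> carrier R" using z by (simp add: koszul_carrier)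
  have eK: "e \<in> K fs 0" by (auto simp: koszul_carrier e_def)
  then have "e \<in> Z fs 0" using koszul_diff_degree_zero[OF fs eK] by (simp add: koszul_cycles_def)
  then have "(\<lambda>S. z {} \<otimes> e S) \<in> B fs 0" using koszul_homology_killed[OF fs order_refl, of "z {}" e 0] z by simp
  moreover have "(\<lambda>S. z {} \<otimes> e S) = z" using supp zc by (auto simp: e_def fun_eq_iff)
  ultimately show "z \<in> B fs 0" by simp
qed

section \<open>Multiplication by one element on Koszul homology\<close>

context
  fixes b :: 'a and as :: "'a list"
  assumes b: "b \<in> carrier R" and as: "set as \<subseteq> carrier R"
begin

lemma b_as_carrier: "set (b # as) \<subseteq> carrier R" using b as by simp

text \<open>The kernel of \<open>Z\<^sub>i \<rightarrow> bH\<^sub>i\<close>, and also the image of \<open>Z\<^sub>i\<^sub>+\<^sub>1(b,a) \<rightarrow> Z\<^sub>i\<close>.\<close>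

definition W :: "nat \<Rightarrow> (nat set \<Rightarrow> 'a) set" where
  "W i = {y \<in> Z as i. (\<lambda>S. b \<otimes> y S) \<in> B as i}"

text \<open>The copy of \<open>Z\<^sub>i\<close> in \<open>Z\<^sub>i(b,a)\<close>, the kernel of the projection to the second component.\<close>

definition Z_fst :: "nat \<Rightarrow> (nat set \<Rightarrow> 'a) set" where
  "Z_fst i = {z \<in> Z (b # as) i. cone_snd z = (\<lambda>S. \<zero>)}"

abbreviation FF where "FF \<equiv> F (Suc (length as))"

lemma lengths: "length as \<le> Suc (length as)" "length (b # as) \<le> Suc (length as)" by simp_all

lemma W_submodule: "submodule (W i) R FF"
proof -
  interpret M: module R FF by (rule module_fun_module)
  have c: "z \<in> carrier FF" if "z \<in> Z as i" for z
    using M.submodule_carrier[OF Z_submodule[OF as lengths(1)] that] .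
  have zc: "z S \<in> carrier R" if "z \<in> Z as i" for z S
    using c[OF that] by (simp add: fun_module_carrier)
  have bz: "(\<lambda>S. b \<otimes> z S) \<in> carrier FF" if "z \<in> Z as i" for z
    using M.smult_closed[OF b c[OF that]] by simp
  show ?thesis
    unfolding W_def
    by (rule submodule_vimage[OF module_fun_module module_fun_module
          Z_submodule[OF as lengths(1)] B_submodule[OF as lengths(1)] bz])
      (use b zc in \<open>auto simp: r_distr m_lcomm\<close>)
qed

lemma Z_fst_submodule: "submodule (Z_fst i) R FF"
proof -
  interpret M: module R FF by (rule module_fun_module)
  interpret U: module R "fun_module R UNIV" by (rule module_fun_module)
  have c: "z \<in> carrier FF" if "z \<in> Z (b # as) i" for z
    using M.submodule_carrier[OF Z_submodule[OF b_as_carrier lengths(2)] that] .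
  have "submodule {z \<in> Z (b # as) i. cone_snd z \<in> {\<zero>\<^bsub>fun_module R UNIV\<^esub>}} R FF"
    by (rule submodule_vimage[OF module_fun_module module_fun_module
          Z_submodule[OF b_as_carrier lengths(2)] U.zero_submodule])
      (use c in \<open>auto simp: fun_module_carrier cone_snd_def\<close>)
  then show ?thesis by (simp add: Z_fst_def)
qed

lemma cone_subquots:
  "subquot R FF (Z as i) (W i)" "subquot R FF (W i) zero_sub"
  "subquot R FF (Z (b # as) i) (Z_fst i)" "subquot R FF (Z_fst i) zero_sub"
  unfolding subquot_def
  using Z_submodule[OF as lengths(1), of i] W_submodule[of i] Z_fst_submodule[of i]
    Z_submodule[OF b_as_carrier lengths(2), of i] zero_sub_submodule[OF as lengths(1)]
    zero_sub_subset[OF as lengths(1) W_submodule[of i]] zero_sub_subset[OF as lengths(1) Z_fst_submodule[of i]]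
  by (auto simp: W_def Z_fst_def)

lemma cone_cycle_iff:
  "z \<in> Z (b # as) (Suc i) \<longleftrightarrow> cone_fst z \<in> K as (Suc i) \<and> cone_snd z \<in> Z as i \<and>
    (\<lambda>S. koszul_diff R as (cone_fst z) S \<oplus> b \<otimes> cone_snd z S) = (\<lambda>S. \<zero>)"
proof -
  have "koszul_diff R (b # as) z = (\<lambda>S. \<zero>) \<longleftrightarrow>
      (\<lambda>S. koszul_diff R as (cone_fst z) S \<oplus> b \<otimes> cone_snd z S) = (\<lambda>S. \<zero>) \<and>
      koszul_diff R as (cone_snd z) = (\<lambda>S. \<zero>)" if z: "z \<in> V"
  proof -
    have d: "koszul_diff R as (cone_snd z) S \<in> carrier R" for S
      using koszul_diff_V[OF as cone_V(2)[OF z]] by simp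
    have zero: "cone_fst (\<lambda>S. \<zero>) = (\<lambda>S. \<zero>)" "cone_snd (\<lambda>S. \<zero>) = (\<lambda>S. \<zero>)"
      by (simp_all add: cone_fst_def cone_snd_def)
    have "koszul_diff R (b # as) z = (\<lambda>S. \<zero>) \<longleftrightarrow>
      cone_fst (koszul_diff R (b # as) z) = (\<lambda>S. \<zero>) \<and> cone_snd (koszul_diff R (b # as) z) = (\<lambda>S. \<zero>)"
      using cone_eqI[of "koszul_diff R (b # as) z" "\<lambda>S. \<zero>"] zero by metis
    moreover have "(\<lambda>S. \<ominus> koszul_diff R as (cone_snd z) S) = (\<lambda>S. \<zero>) \<longleftrightarrow>
      koszul_diff R as (cone_snd z) = (\<lambda>S. \<zero>)"
    proof -
      have "\<ominus> x = \<zero> \<longleftrightarrow> x = \<zero>" if "x \<in> carrier R" for x using that by (metis minus_minus minus_zero)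
      then show ?thesis using d by (simp add: fun_eq_iff)
    qed
    ultimately show ?thesis
      unfolding koszul_diff_cone_fst[OF b as z] koszul_diff_cone_snd[OF b as z] by simp
  qed
  then show ?thesis
    using koszul_carrier_V[of z "b # as" "Suc i"] koszul_carrier_cone(1)[of z b as i]
    unfolding koszul_cycles_def by blast
qed

lemma cone_snd_cycle: 
  assumes "z \<in> Z (b # as) (Suc i)"
  shows "cone_snd z \<in> W i"
proof -
  interpret M: module R FF by (rule module_fun_module)
  have z: "cone_fst z \<in> K as (Suc i)" "cone_snd z \<in> Z as i"
    and e: "koszul_diff R as (cone_fst z) S \<oplus> b \<otimes> cone_snd z S = \<zero>" for S
    using assms unfolding cone_cycle_iff by (auto simp: fun_eq_iff)
  have c: "koszul_diff R as (cone_fst z) S \<in> carrier R" "b \<otimes> cone_snd z S \<in> carrier R" for S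
    using koszul_diff_V[OF as koszul_carrier_V[OF z(1)]] z(2) Z_subset_K[OF as lengths(1), of i] b
      koszul_carrier_V[of "cone_snd z" as i] by auto
  have "b \<otimes> cone_snd z S = (\<ominus> \<one>) \<otimes> koszul_diff R as (cone_fst z) S" for S
  proof -
    have "b \<otimes> cone_snd z S \<oplus> koszul_diff R as (cone_fst z) S = \<zero>" using e c a_comm by metis
    then have "\<ominus> koszul_diff R as (cone_fst z) S = b \<otimes> cone_snd z S"
      using minus_equality c by blast
    then show ?thesis using c(1)[of S] by (simp add: l_minus)
  qed
  moreover have "(\<lambda>S. (\<ominus> \<one>) \<otimes> koszul_diff R as (cone_fst z) S) \<in> B as i"
  proof -
    have "koszul_diff R as (cone_fst z) \<in> B as i" using z(1) unfolding koszul_boundaries_def by blast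
    from M.submoduleE(4)[OF B_submodule[OF as lengths(1)] _ this, of "\<ominus> \<one>"] show ?thesis by simp
  qed
  ultimately show ?thesis using z(2) by (simp add: W_def)
qed

text \<open>If \<open>by = dx\<close>, then \<open>(-x, y)\<close> is a cycle of the cone.\<close>

lemma cone_snd_surj:
  assumes y: "y \<in> W i"
  shows "\<exists>z\<in>Z (b # as) (Suc i). cone_snd z = y"
proof -
  interpret M: module R "koszul_module R as (Suc i)" unfolding koszul_module_eq by (rule module_fun_module)
  obtain x where x: "x \<in> K as (Suc i)" "(\<lambda>S. b \<otimes> y S) = koszul_diff R as x"
    using y unfolding W_def koszul_boundaries_def by blast
  have mx: "(\<lambda>S. \<ominus> x S) \<in> K as (Suc i)" using x(1) by (auto simp: koszul_carrier)
  have d: "koszul_diff R as x S \<in> carrier R" for S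
    using koszul_diff_V[OF as koszul_carrier_V[OF x(1)]] by simp
  have "koszul_diff R as (\<lambda>S. \<ominus> x S) S \<oplus> b \<otimes> y S = \<zero>" for S
  proof -
    have "b \<otimes> y S = koszul_diff R as x S" using x(2) by (rule fun_cong)
    then show ?thesis using koszul_diff_uminus[OF as koszul_carrier_V[OF x(1)]] d by (simp add: l_neg)
  qed
  then have "cone (\<lambda>S. \<ominus> x S) y \<in> Z (b # as) (Suc i)"
    unfolding cone_cycle_iff using mx y by (simp add: W_def)
  then show ?thesis by (metis cone_simps(2))
qed

lemma grade_ge_W_iff:
  assumes J: "J \<subseteq> carrier R"
  shows "grade_ge FF J (Z (b # as) (Suc i)) k (Z_fst (Suc i)) \<longleftrightarrow> grade_ge FF J (W i) k zero_sub"
proof (rule grade_ge_iso[OF module_fun_module module_fun_module cone_subquots(3,2) J, where f = cone_snd])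
  interpret M: module R FF by (rule module_fun_module)
  show "cone_snd a \<in> W i" if "a \<in> Z (b # as) (Suc i)" for a using cone_snd_cycle[OF that] .
  show "\<exists>a\<in>Z (b # as) (Suc i). mcong FF zero_sub a' (cone_snd a)" if a': "a' \<in> W i" for a'
    using cone_snd_surj[OF a'] M.mcong_refl[OF zero_sub_submodule[OF as lengths(1)] M.submodule_carrier[OF W_submodule a']]
    by metis
qed (simp_all add: Z_fst_def cone_snd_def)

lemma grade_ge_Z_fst_iff:
  assumes J: "J \<subseteq> carrier R"
  shows "grade_ge FF J (Z_fst (Suc i)) k zero_sub \<longleftrightarrow> grade_ge FF J (Z as (Suc i)) k zero_sub"
proof (rule grade_ge_iso[OF module_fun_module module_fun_module cone_subquots(4)
    koszul_subquots(4)[OF as lengths(1)] J, where f = cone_fst])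
  interpret M: module R FF by (rule module_fun_module)
  have iff: "a \<in> Z_fst (Suc i) \<longleftrightarrow> cone_fst a \<in> Z as (Suc i) \<and> cone_snd a = (\<lambda>S. \<zero>)" for a
  proof -
    have "koszul_diff R as x S \<oplus> b \<otimes> \<zero> = koszul_diff R as x S" if "x \<in> K as (Suc i)" for x S
      using koszul_diff_V[OF as koszul_carrier_V[OF that]] b by simp
    moreover have "(\<lambda>S. \<zero>) \<in> Z as i"
      using M.submodule_zero_closed[OF Z_submodule[OF as lengths(1), of i]] by simp
    ultimately show ?thesis
      unfolding Z_fst_def mem_Collect_eq cone_cycle_iff using b by (auto simp: koszul_cycles_def)
  qed
  show "cone_fst a \<in> Z as (Suc i)" if "a \<in> Z_fst (Suc i)" for a using that iff by blast
  show "\<exists>a\<in>Z_fst (Suc i). mcong FF zero_sub a' (cone_fst a)" if a': "a' \<in> Z as (Suc i)" for a'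
  proof -
    have "cone a' (\<lambda>S. \<zero>) \<in> Z_fst (Suc i)" using a' iff by simp
    moreover have "mcong FF zero_sub a' (cone_fst (cone a' (\<lambda>S. \<zero>)))"
      using M.mcong_refl[OF zero_sub_submodule[OF as lengths(1)]
        M.submodule_carrier[OF Z_submodule[OF as lengths(1)] a']] by simp
    ultimately show ?thesis by blast
  qed
  show "cone_fst a \<in> zero_sub \<longleftrightarrow> a \<in> zero_sub" if a: "a \<in> Z_fst (Suc i)" for a
  proof
    assume "cone_fst a \<in> zero_sub"
    then have fst: "cone_fst a = (\<lambda>S. \<zero>)" by simp
    have "a = (\<lambda>S. \<zero>)"
      by (rule cone_eqI) (use a fst in \<open>simp_all add: Z_fst_def cone_fst_def cone_snd_def\<close>)
    then show "a \<in> zero_sub" by simp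
  qed (simp add: cone_fst_def)
qed (simp_all add: cone_fst_def)

text \<open>The annihilator of \<open>bH\<^sub>i \<cong> Z\<^sub>i/W\<^sub>i\<close>.\<close>

definition scaled_ann :: "nat \<Rightarrow> 'a set" where
  "scaled_ann i = {r \<in> carrier R. \<forall>z\<in>Z as i. (\<lambda>S. r \<otimes> z S) \<in> W i}"

lemma scaled_ann_ideal: "ideal (scaled_ann i) R"
proof -
  interpret M: module R FF by (rule module_fun_module)
  show ?thesis
    using M.conductor_ideal[OF W_submodule M.submoduleE(1)[OF Z_submodule[OF as lengths(1)]], of i i]
    by (simp add: scaled_ann_def)
qed

text \<open>The acyclicity argument, as a descending induction with \<open>m = s - i\<close>. The complex behind it is
\<open>0 \<rightarrow> Z\<^sub>s(b,a) \<rightarrow> \<dots> \<rightarrow> Z\<^sub>0(b,a)\<close> with maps \<open>(x,y) \<mapsto> (y,0)\<close>; its homology in degree \<open>i\<close> is \<open>bH\<^sub>i\<close>.\<close>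

lemma W_eq_and_grade_ge:
  assumes s: "length as + t = d"
    and C: "\<And>i k. k \<le> d \<Longrightarrow> k + length as \<le> d + i \<Longrightarrow> grade_ge FF \<mm> (Z (b # as) i) k zero_sub"
    and top: "Z (b # as) (Suc (length as)) = zero_sub"
    and dim: "\<And>i n p. i \<ge> 1 \<Longrightarrow> (\<forall>j\<le>n. primeideal (p j) R \<and> scaled_ann i \<subseteq> p j) \<Longrightarrow>
        (\<forall>j<n. p j \<subset> p (Suc j)) \<Longrightarrow> n \<le> t"
    and "i + m = length as"
  shows "grade_ge FF \<mm> (W i) (Suc (t + i)) zero_sub \<and> (i \<ge> 1 \<longrightarrow> Z as i = W i)"
  using assms(5)
proof (induction m arbitrary: i)
  interpret M: noetherian_module R FF by (rule noetherian_module_F)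
  have eq: "Z as i = W i" if i: "i \<ge> 1" "i \<le> length as" and g: "grade_ge FF \<mm> (W i) (Suc (t + i)) zero_sub" for i
  proof -
    note idJ = scaled_ann_ideal[of i]
    have JR: "scaled_ann i \<subseteq> carrier R" by (auto simp: scaled_ann_def)
    have low: "grade_ge FF (scaled_ann i) A k D" if "subquot R FF A D" "grade_ge FF \<mm> A (k + t) D" for A D k
      using M.grade_ge_of_dim_le[OF local that(1) idJ _ that(2)] dim[OF i(1)] by blast
    have "grade_ge FF \<mm> (W i) (Suc (Suc 0) + t) zero_sub" by (rule M.grade_ge_antimono[OF _ g]) (use i in simp)
    from low[OF cone_subquots(2) this] have gW: "grade_ge FF (scaled_ann i) (W i) (Suc (Suc 0)) zero_sub" .
    have "grade_ge FF \<mm> (Z (b # as) i) (Suc 0 + t) zero_sub" by (rule C) (use i s in simp_all)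
    from low[OF koszul_subquots(4)[OF b_as_carrier lengths(2)] this]
    obtain x where x: "x \<in> scaled_ann i" "nzd_mod FF x (Z (b # as) i) zero_sub" by auto
    then have "nzd_mod FF x (Z_fst i) zero_sub" unfolding nzd_mod_def Z_fst_def by blast
    then have "grade_ge FF (scaled_ann i) (Z_fst i) (Suc 0) zero_sub" using x(1) by auto
    moreover obtain i' where i': "i = Suc i'" using i(1) by (cases i) simp_all
    ultimately have gZ: "grade_ge FF (scaled_ann i) (Z as i) (Suc 0) zero_sub"
      using grade_ge_Z_fst_iff[OF JR, of i'] unfolding i' by blast
    have "grade_ge FF (scaled_ann i) (Z as i) (Suc 0) (W i)"
      by (rule M.grade_ge_quotient[OF idJ cone_subquots(1,2) gW gZ])
    then have "no_socle FF (scaled_ann i) (Z as i) (W i)" by (rule M.grade_ge_no_socle)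
    then have "Z as i \<subseteq> W i" unfolding no_socle_def scaled_ann_def by auto
    then show ?thesis by (auto simp: W_def)
  qed
  {
    case (0 i)
    have "W i \<subseteq> zero_sub"
    proof
      fix y assume "y \<in> W i"
      then obtain z where z: "z \<in> Z (b # as) (Suc i)" "cone_snd z = y" using cone_snd_surj by blast
      then have "z = (\<lambda>S. \<zero>)" using top 0 by simp
      then show "y \<in> zero_sub" using z(2) by (simp add: cone_snd_def fun_eq_iff)
    qed
    then have W: "W i = zero_sub" using zero_sub_subset[OF as lengths(1) W_submodule] by blast
    have z: "\<zero> \<in> \<mm>" using additive_subgroup.zero_closed[OF ideal.axioms(1)[OF \<mm>_ideal]] .
    have "grade_ge FF \<mm> (W i) (Suc (t + i)) zero_sub"
      unfolding W by (rule M.grade_ge_trivial[OF z zero_sub_submodule[OF as lengths(1)] zero_closed])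
    then show ?case using eq[of i] 0 by simp
  next
    case (Suc m i)
    from Suc.IH[of "Suc i"] Suc.prems
    have g: "grade_ge FF \<mm> (W (Suc i)) (Suc (t + Suc i)) zero_sub" and e: "Z as (Suc i) = W (Suc i)" by simp_all
    have gZ: "grade_ge FF \<mm> (Z_fst (Suc i)) (Suc (Suc (t + i))) zero_sub"
      using g grade_ge_Z_fst_iff[OF \<mm>_carrier, of i "Suc (Suc (t + i))"]
      unfolding e by (simp del: grade_ge.simps)
    have "grade_ge FF \<mm> (Z (b # as) (Suc i)) (Suc (t + i)) zero_sub" by (rule C) (use Suc.prems s in simp_all)
    from M.grade_ge_quotient[OF \<mm>_ideal cone_subquots(3,4) gZ this]
    have "grade_ge FF \<mm> (W i) (Suc (t + i)) zero_sub" unfolding grade_ge_W_iff[OF \<mm>_carrier] .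
    then show ?case using eq[of i] Suc.prems by simp
  }
qed

text \<open>It suffices to test \<open>b\<close>, since the other generators of \<open>I\<close> lie in the ideal generated by \<open>as\<close>.\<close>

lemma colon_eq:
  "colon_ideal R (Idl (set as)) (Idl (set (b # as))) = {r \<in> carrier R. r \<otimes> b \<in> Idl (set as)}"
proof (intro equalityI subsetI)
  fix r assume "r \<in> colon_ideal R (Idl (set as)) (Idl (set (b # as)))"
  then show "r \<in> {r \<in> carrier R. r \<otimes> b \<in> Idl (set as)}"
    using genideal_self[OF b_as_carrier] unfolding colon_ideal_def by simp
next
  fix r assume "r \<in> {r \<in> carrier R. r \<otimes> b \<in> Idl (set as)}"
  then have r: "r \<in> carrier R" "r \<otimes> b \<in> Idl (set as)" by auto
  interpret A: ideal "Idl (set as)" R by (rule genideal_ideal[OF as])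
  interpret M: module R "ring_module R" by (rule module_ring_module)
  have "submodule {x \<in> carrier R. r \<otimes> x \<in> Idl (set as)} R (ring_module R)"
    by (rule M.submoduleI_smult)
      (use r in \<open>auto simp: ring_module_def r_distr m_lcomm A.I_l_closed\<close>)
  then have "ideal {x \<in> carrier R. r \<otimes> x \<in> Idl (set as)} R" by (simp add: ring_submodule_iff)
  moreover have "set (b # as) \<subseteq> {x \<in> carrier R. r \<otimes> x \<in> Idl (set as)}"
    using r b as genideal_self[OF as] A.I_l_closed by auto
  ultimately have "Idl (set (b # as)) \<subseteq> {x \<in> carrier R. r \<otimes> x \<in> Idl (set as)}"
    by (rule genideal_minimal)
  then show "r \<in> colon_ideal R (Idl (set as)) (Idl (set (b # as)))"
    using r unfolding colon_ideal_def by blast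
qed

text \<open>Evaluation at the empty set identifies \<open>Z\<^sub>0 = K\<^sub>0\<close> with \<open>R\<close> and \<open>W\<^sub>0\<close> with the colon ideal.\<close>

lemma grade_ge_colon:
  assumes J: "J \<subseteq> carrier R" and g: "grade_ge FF J (Z as 0) k (W 0)"
  shows "ereal (real k) \<le> depth R J
    (quot_module R (ring_module R) (colon_ideal R (Idl (set as)) (Idl (set (b # as)))))"
proof -
  interpret M: module R FF by (rule module_fun_module)
  interpret N: module R "ring_module R" by (rule module_ring_module)
  let ?C = "{r \<in> carrier R. r \<otimes> b \<in> Idl (set as)}"
  interpret A: ideal "Idl (set as)" R by (rule genideal_ideal[OF as])
  have c: "carrier (ring_module R) = carrier R" by (simp add: ring_module_def)
  have "submodule ?C R (ring_module R)"
    by (rule N.submoduleI_smult)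
      (use b in \<open>auto simp: ring_module_def l_distr m_assoc A.I_l_closed\<close>)
  then have S: "subquot R (ring_module R) (carrier R) ?C"
    using N.carrier_is_submodule c by (auto simp: subquot_def)
  have ZK: "Z as 0 = K as 0" using koszul_diff_degree_zero[OF as] by (auto simp: koszul_cycles_def)
  have Kc: "z {} \<in> carrier R" if "z \<in> K as 0" for z using that by (simp add: koszul_carrier)
  have "grade_ge FF J (Z as 0) k (W 0) \<longleftrightarrow> grade_ge (ring_module R) J (carrier R) k ?C"
  proof (rule grade_ge_iso[OF module_fun_module module_ring_module cone_subquots(1) S J, where f = "\<lambda>z. z {}"])
    show "a {} \<in> carrier R" if "a \<in> Z as 0" for a using that Kc ZK by blast
    show "\<exists>a\<in>Z as 0. mcong (ring_module R) ?C r (a {})" if r: "r \<in> carrier R" for r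
    proof
      let ?a = "\<lambda>S :: nat set. if S = {} then r else \<zero>"
      show "?a \<in> Z as 0" using r unfolding ZK by (auto simp: koszul_carrier)
      show "mcong (ring_module R) ?C r (?a {})"
        using N.mcong_refl[of ?C r] S r c by (simp add: subquot_def)
    qed
    show "a {} \<in> ?C \<longleftrightarrow> a \<in> W 0" if a: "a \<in> Z as 0" for a
    proof -
      have aK: "a \<in> K as 0" using a ZK by simp
      have "(\<lambda>S. b \<otimes> a S) \<in> K as 0" using aK b by (auto simp: koszul_carrier)
      then show ?thesis
        using a Kc[OF aK] b unfolding W_def koszul_boundaries_zero[OF as] by (simp add: m_comm)
    qed
  qed (simp_all add: ring_module_def)
  then have "grade_ge (ring_module R) J (carrier R) k ?C" using g by blast
  from N.grade_ge_imp_depth_quot[OF S J this]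
  have "ereal (real k) \<le> depth R J (quot_module R ((ring_module R)\<lparr>carrier := carrier R\<rparr>) ?C)" .
  moreover have "(ring_module R)\<lparr>carrier := carrier R\<rparr> = ring_module R" by (simp add: ring_module_def)
  ultimately show ?thesis unfolding colon_eq by simp
qed

lemma annihilator_scaled_homology:
  "annihilator R (scaled_module b (koszul_homology R as i)) = scaled_ann i"
  "carrier (scaled_module b (koszul_homology R as i)) = (\<lambda>z. B as i +>\<^bsub>FF\<^esub> (\<lambda>S. b \<otimes> z S)) ` Z as i"
  "\<zero>\<^bsub>koszul_homology R as i\<^esub> = B as i"
proof -
  interpret M: module R FF by (rule module_fun_module)
  let ?H = "koszul_homology R as i"
  note S = koszul_subquots(2)[OF as lengths(1), of i]
  note q = M.quot_coset_simps[OF S, folded koszul_homology_F[OF as lengths(1)]]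
  note EZ = M.submoduleE[OF Z_submodule[OF as lengths(1), of i]]
  have B: "submodule (B as i) R FF" by (rule B_submodule[OF as lengths(1)])
  have bz: "(\<lambda>S. r \<otimes> z S) \<in> Z as i" if "z \<in> Z as i" "r \<in> carrier R" for r z
    using EZ(4)[OF that(2,1)] by simp
  have "carrier (scaled_module b ?H) = (\<lambda>x. b \<odot>\<^bsub>?H\<^esub> x) ` carrier ?H" by (simp add: scaled_module_def)
  also have "\<dots> = (\<lambda>z. b \<odot>\<^bsub>?H\<^esub> (B as i +>\<^bsub>FF\<^esub> z)) ` Z as i" unfolding q(1) image_image ..
  also have "\<dots> = (\<lambda>z. B as i +>\<^bsub>FF\<^esub> (\<lambda>S. b \<otimes> z S)) ` Z as i"
    by (rule image_cong[OF refl]) (use q(3)[OF b] in simp)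
  finally show carr: "carrier (scaled_module b ?H) = (\<lambda>z. B as i +>\<^bsub>FF\<^esub> (\<lambda>S. b \<otimes> z S)) ` Z as i" .
  show zero: "\<zero>\<^bsub>?H\<^esub> = B as i" by (rule q(5))
  have act: "r \<odot>\<^bsub>?H\<^esub> (B as i +>\<^bsub>FF\<^esub> (\<lambda>S. b \<otimes> z S)) = \<zero>\<^bsub>?H\<^esub> \<longleftrightarrow> (\<lambda>S. r \<otimes> z S) \<in> W i"
    if r: "r \<in> carrier R" and z: "z \<in> Z as i" for r z
  proof -
    have c: "(\<lambda>S. r \<otimes> (b \<otimes> z S)) \<in> carrier FF" using bz[OF bz[OF z b] r] EZ(1) by blast
    have zS: "z S \<in> carrier R" for S using EZ(1) z by (auto simp: fun_module_carrier)
    have "r \<odot>\<^bsub>?H\<^esub> (B as i +>\<^bsub>FF\<^esub> (\<lambda>S. b \<otimes> z S)) = B as i +>\<^bsub>FF\<^esub> (\<lambda>S. r \<otimes> (b \<otimes> z S))"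
      using q(3)[OF r bz[OF z b]] by simp
    also have "\<dots> = \<zero>\<^bsub>?H\<^esub> \<longleftrightarrow> (\<lambda>S. r \<otimes> (b \<otimes> z S)) \<in> B as i"
      unfolding q(4) using M.coset_eq_iff[OF B c M.zero_closed] M.mcong_zero_iff[OF c] by simp
    also have "\<dots> \<longleftrightarrow> (\<lambda>S. r \<otimes> z S) \<in> W i"
      using bz[OF z r] zS r b by (simp add: W_def m_lcomm)
    finally show ?thesis .
  qed
  have "smult (scaled_module b ?H) = smult ?H" "\<zero>\<^bsub>scaled_module b ?H\<^esub> = \<zero>\<^bsub>?H\<^esub>"
    by (simp_all add: scaled_module_def)
  then show "annihilator R (scaled_module b ?H) = scaled_ann i"
    unfolding annihilator_def carr scaled_ann_def using act by (auto simp: ball_simps)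
qed

lemma scaled_homology_zero:
  assumes "Z as i = W i"
  shows "carrier (scaled_module b (koszul_homology R as i)) = {\<zero>\<^bsub>koszul_homology R as i\<^esub>}"
proof -
  interpret M: module R FF by (rule module_fun_module)
  have B: "submodule (B as i) R FF" by (rule B_submodule[OF as lengths(1)])
  have "B as i +>\<^bsub>FF\<^esub> (\<lambda>S. b \<otimes> z S) = B as i" if "z \<in> Z as i" for z
  proof -
    have m: "(\<lambda>S. b \<otimes> z S) \<in> B as i" using that unfolding assms by (simp add: W_def)
    have "u \<in> B as i +>\<^bsub>FF\<^esub> (\<lambda>S. b \<otimes> z S) \<longleftrightarrow> u \<in> B as i" for u
    proof -
      have "u \<in> B as i +>\<^bsub>FF\<^esub> (\<lambda>S. b \<otimes> z S) \<longleftrightarrow> u \<in> carrier FF \<and> mcong FF (B as i) u (\<lambda>S. b \<otimes> z S)"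
        by (rule M.mem_coset_iff[OF B M.submodule_carrier[OF B m]])
      also have "\<dots> \<longleftrightarrow> u \<in> B as i"
        using M.mcong_mem[OF B _ m] M.submodule_carrier[OF B] M.submodule_diff_closed[OF B _ m]
        unfolding mcong_def by metis
      finally show ?thesis .
    qed
    then show ?thesis by blast
  qed
  moreover have "Z as i \<noteq> {}" using M.submoduleE(2)[OF Z_submodule[OF as lengths(1)]] .
  ultimately show ?thesis unfolding annihilator_scaled_homology(2,3) by force
qed

end

end

theorem corollary4p6:
  fixes R :: "('a, 'r) ring_scheme" and \<mm> I :: "'a set"
    and b :: 'a and as :: "'a list" and d :: nat
  assumes "cohen_macaulay_local_ring R \<mm>"
    and "krull_dim R = ereal (real d)"
    and "b \<in> carrier R" and "set as \<subseteq> carrier R"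
    and "I = Idl\<^bsub>R\<^esub> (set (b # as))"
    and "grade R I (ring_module R) \<ge> 1"
    and "sliding_depth R \<mm> (b # as)"
    and "\<And>i :: nat. i \<ge> 1 \<Longrightarrow>
           module_dim R (scaled_module b (koszul_homology R as i))
             \<le> ereal (real d) - ereal (real (length as))"
  shows "(\<forall>i\<ge>1. carrier (scaled_module b (koszul_homology R as i)) =
             {\<zero>\<^bsub>koszul_homology R as i\<^esub>}) \<and>
         depth R \<mm> (quot_module R (ring_module R) (colon_ideal R (Idl\<^bsub>R\<^esub> (set as)) I))
           \<ge> ereal (real d) - ereal (real (length as))"
proof -
  have noeth: "noetherian_ring R" and loc: "local_ring R \<mm>" and cm: "depth R \<mm> (ring_module R) = krull_dim R"
    using assms(1) by (auto simp: cohen_macaulay_local_ring_def)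
  have "cring R" using loc by (simp add: local_ring_def)
  then interpret noetherian_local_ring R \<mm>
    by (intro noetherian_local_ring.intro noetherian_local_ring_axioms.intro noeth loc)
  let ?s = "length as" and ?fs = "b # as"
  note b = assms(3) and as = assms(4) and I = assms(5)
  have fs: "set ?fs \<subseteq> carrier R" using b as by simp
  have lengths: "?s \<le> Suc ?s" "length ?fs \<le> Suc ?s" by simp_all
  have idI: "ideal I R" unfolding I by (rule genideal_ideal[OF fs])
  have R: "grade_ge (ring_module R) \<mm> (carrier R) k {\<zero>\<^bsub>R\<^esub>}" if "k \<le> d" for k
    by (rule grade_ge_ring[OF \<mm>_ideal]) (use that cm assms(2) in \<open>simp add: depth_def\<close>)
  \<comment> \<open>The dimension hypothesis, in the form of a bound on chains of primes.\<close>
  have dim: "ereal (real n) \<le> ereal (real d) - ereal (real ?s)"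
    if "i \<ge> 1" "\<forall>j\<le>n. primeideal (p j) R \<and> scaled_ann b as i \<subseteq> p j" "\<forall>j<n. p j \<subset> p (Suc j)" for i n p
    using krull_dim_quot_ge[OF \<open>cring R\<close> scaled_ann_ideal[OF b as] that(2,3)] assms(8)[OF that(1)]
    unfolding module_dim_def annihilator_scaled_homology(1)[OF b as] by (rule order_trans)
  show ?thesis
  proof (cases "?s \<le> d")
    case False
    \<comment> \<open>A chain of primes above the annihilator would have length at most \<open>d - s < 0\<close>; so there are none.\<close>
    have "Z as i = W b as i" if i: "i \<ge> 1" for i
    proof -
      have "scaled_ann b as i = carrier R"
      proof (rule ccontr)
        assume "scaled_ann b as i \<noteq> carrier R"
        then have "scaled_ann b as i \<subseteq> \<mm>"
          by (rule local_ring_proper_ideal[OF noeth loc scaled_ann_ideal[OF b as]])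
        moreover have "primeideal \<mm> R"
          using maximalideal_prime loc by (simp add: local_ring_def)
        ultimately have "ereal (real 0) \<le> ereal (real d) - ereal (real ?s)"
          using dim[OF i, of 0 "\<lambda>_. \<mm>"] by simp
        then show False using False by simp
      qed
      then have "(\<lambda>S. \<one>\<^bsub>R\<^esub> \<otimes>\<^bsub>R\<^esub> z S) \<in> W b as i" if "z \<in> Z as i" for z
        using that one_closed unfolding scaled_ann_def[OF b as] by blast
      moreover have "(\<lambda>S. \<one>\<^bsub>R\<^esub> \<otimes>\<^bsub>R\<^esub> z S) = z" if "z \<in> Z as i" for z
        using that Z_subset_K[OF as lengths(1), of i] koszul_carrier_V[of z as i] by auto
      ultimately show ?thesis by (auto simp: W_def[OF b as])
    qed
    moreover have "ereal (real d) - ereal (real ?s) \<le> ereal (real 0)" using False by simp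
    moreover have "ereal (real 0) \<le> depth R \<mm> (quot_module R (ring_module R) (colon_ideal R (Idl\<^bsub>R\<^esub> (set as)) I))"
      unfolding I by (rule grade_ge_colon[OF b as \<mm>_carrier]) simp
    ultimately show ?thesis using scaled_homology_zero[OF b as] by (meson order_trans)
  next
    case True
    then obtain t where t: "?s + t = d" using le_Suc_ex by metis
    interpret M: noetherian_module R "F (Suc ?s)" by (rule noetherian_module_F)
    have zm: "\<zero>\<^bsub>R\<^esub> \<in> \<mm>" using additive_subgroup.zero_closed[OF ideal.axioms(1)[OF \<mm>_ideal]] .
    have van: "Z ?fs j = B ?fs j" if "ereal (real (m + 1)) \<le> grade R I (ring_module R)" "j + m = length ?fs" for j m
    proof -
      have "grade_ge (ring_module R) I (carrier R) (m + Suc 0) {\<zero>\<^bsub>R\<^esub>}"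
        using grade_ge_ring[OF idI that(1)] by simp
      then show ?thesis using koszul_homology_vanishing[OF fs lengths(2) I _ that(2)] by blast
    qed
    have triv: "grade_ge (F (Suc ?s)) \<mm> (Z ?fs j) k (B ?fs j)" if "Z ?fs j = B ?fs j" for j k
      using M.grade_ge_trivial[OF zm B_submodule[OF fs lengths(2)] zero_closed] that by metis
    \<comment> \<open>Here \<open>m = s + 1 - j\<close>. If \<open>grade I > m\<close>, the homology vanishes; if not, sliding depth gives the bound.\<close>
    have H: "grade_ge (F (Suc ?s)) \<mm> (Z ?fs j) k (B ?fs j)" if k: "k + Suc ?s \<le> d + j" for j k
    proof (cases "j \<le> Suc ?s")
      case False
      then show ?thesis using Z_B_eq_zero_sub[OF fs lengths(2), of j] by (intro triv) simp
    next
      case j: True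
      then obtain m where m: "j + m = Suc ?s" using le_Suc_ex by metis
      show ?thesis
      proof (cases "ereal (real (Suc m)) \<le> grade R I (ring_module R)")
        case True
        then show ?thesis using van[of m j] m by (intro triv) simp
      next
        case False
        then have "grade R I (ring_module R) \<le> ereal (real m)" by (rule grade_le_if_not_Suc_le)
        then have "ereal (real d) - ereal (real m) \<le> krull_dim R - grade R I (ring_module R)"
          unfolding assms(2) by (intro ereal_minus_mono) auto
        moreover have "ereal (real k) \<le> ereal (real d) - ereal (real m)"
          using k m by simp
        moreover have "ereal (real k) \<le> krull_dim R - ereal (real (length ?fs)) + ereal (real j)"
          using k unfolding assms(2) by simp
        ultimately have "ereal (real k) \<le> depth R \<mm> (koszul_homology R ?fs j)"
          using assms(7) unfolding sliding_depth_def I by (meson min.boundedI order_trans)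
        then show ?thesis
          using M.depth_quot_imp_grade_ge[OF loc koszul_subquots(2)[OF fs lengths(2)]]
          unfolding koszul_homology_F[OF fs lengths(2)] by blast
      qed
    qed
    have C: "grade_ge (F (Suc ?s)) \<mm> (Z ?fs i) k zero_sub" if "k \<le> d" "k + ?s \<le> d + i" for i k
      by (rule grade_ge_cycles[OF fs lengths(2) R H that])
    have top: "Z ?fs (Suc ?s) = zero_sub"
    proof -
      have "B ?fs (Suc ?s) = zero_sub"
        using K_eq_zero_sub[OF fs lengths(2), of "Suc (Suc ?s)"] koszul_diff_zero[OF fs]
        by (simp add: koszul_boundaries_def)
      then show ?thesis using van[of 0 "Suc ?s"] assms(6) by (simp add: one_ereal_def)
    qed
    have dim': "n \<le> t" if "i \<ge> 1" "\<forall>j\<le>n. primeideal (p j) R \<and> scaled_ann b as i \<subseteq> p j"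
      "\<forall>j<n. p j \<subset> p (Suc j)" for i n p
      using dim[OF that] t by simp
    have main: "grade_ge (F (Suc ?s)) \<mm> (W b as i) (Suc (t + i)) zero_sub \<and> (i \<ge> 1 \<longrightarrow> Z as i = W b as i)"
      if "i + m = ?s" for i m
      by (rule W_eq_and_grade_ge[OF b as t C top dim' that])
    have "Z as i = W b as i" if i: "i \<ge> 1" for i
    proof (cases "i \<le> ?s")
      case True
      then obtain m where "i + m = ?s" using le_Suc_ex by metis
      then show ?thesis using main i by blast
    next
      case False
      then show ?thesis
        using Z_B_eq_zero_sub[OF as lengths(1), of i] zero_sub_subset[OF as lengths(1) W_submodule[OF b as], of i]
        by (auto simp: W_def[OF b as])
    qed
    moreover have "ereal (real t) \<le> depth R \<mm> (quot_module R (ring_module R) (colon_ideal R (Idl\<^bsub>R\<^esub> (set as)) I))"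
      unfolding I
    proof (rule grade_ge_colon[OF b as \<mm>_carrier])
      have W: "grade_ge (F (Suc ?s)) \<mm> (W b as 0) (Suc t) zero_sub" using main[of 0 ?s] by simp
      have "Z as 0 = K as 0" using koszul_diff_degree_zero[OF as] by (auto simp: koszul_cycles_def)
      then have "grade_ge (F (Suc ?s)) \<mm> (Z as 0) t zero_sub"
        using grade_ge_K[OF as lengths(1) \<mm>_carrier R[of t]] t by simp
      then show "grade_ge (F (Suc ?s)) \<mm> (Z as 0) t (W b as 0)"
        by (rule M.grade_ge_quotient[OF \<mm>_ideal cone_subquots(1,2)[OF b as] W])
    qed
    moreover have "ereal (real d) - ereal (real ?s) = ereal (real t)" using t by simp
    ultimately show ?thesis using scaled_homology_zero[OF b as] by simp
  qed
qed

end
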